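(* Let $d\ge 3$ be a fixed integer and let $\alpha>0$. Let $X=A\odot W$ be the $n\times n$ weighted random $d$-regular graph whose edge-weights are i.i.d. Weibull random variables with shape parameter $\alpha$, and let $\mathbf f=(f_i)_{i\in[n]}$ be a top eigenvector of $X$ (an eigenvector associated with the largest eigenvalue $\lambda_1(X)$). Then for any $\varepsilon>0$, for sufficiently large $n$ (depending on $\alpha$ and $\varepsilon$), with probability at least $1-e^{-(\log n)^{1/2}}$ there exists a subset $\mathcal I\subseteq[n]$ with $|\mathcal I|\le n^{\varepsilon}$ such that $$\Big(\sum_{i\in\mathcal I}|f_i|^2\Big)^{1/2}\ge(1-\varepsilon)\|\mathbf f\|_2.\qquad( * )$$ If in particular $\alpha\in(0,2)$, then there is a constant $\zeta_\alpha\in(0,1)$ such that (for any $\varepsilon>0$ and sufficiently large $n$) with probability at least $1-e^{-(\log n)^{1/2}}$ there exists a collection $\mathcal J$ of at most $e^{\varepsilon(\log n)^{\zeta_\alpha}}$ vertex-disjoint edges in the random $d$-regular graph $A$ such that $( * )$ holds with $\mathcal I:=\{v\in[n]: v\text{ is a vertex of some edge in }\mathcal J\}$.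
   Context: Random $d$-regular graph: a graph chosen uniformly from the set of simple $d$-regular graphs with vertex set $[n]=\{1,\dots,n\}$ ($n$ ranges over integers for which this set is nonempty, i.e. $n>d$ and $nd$ even). $A=(A_{ij})$ is its (symmetric $0/1$, zero-diagonal) adjacency matrix; the graph is identified with $A$. $W=(W_{ij})_{i,j\in[n]}$ is a symmetric random matrix independent of $A$, with $\{W_{ij}\}_{1\le i<j\le n}$ i.i.d.; $X_{ij}=A_{ij}W_{ij}$. The common law of the $W_{ij}$ ($i<j$) does not depend on $n$ and is Weibull with shape parameter $\alpha>0$ in the following sense: there are constants $C_1,C_2>0$ such that for all $t\ge 1$, $$\tfrac{C_1}{2}e^{-t^\alpha}\le\mathbb P(W_{ij}\ge t)\le\tfrac{C_2}{2}e^{-t^\alpha}\quad\text{and}\quad \tfrac{C_1}{2}e^{-t^\alpha}\le\mathbb P(W_{ij}\le -t)\le\tfrac{C_2}{2}e^{-t^\alpha}.$$ The integer $d$ and the law of the weights are fixed throughout (thresholds "sufficiently large $n$" may depend on them). *)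

theory Defs
  imports "HOL-Probability.Probability" "Jordan_Normal_Form.Spectral_Radius"
begin

text \<open>The vertex set is \<open>{..<n}\<close> rather than \<open>{1..n}\<close>, since matrices are indexed from \<open>0\<close>.
  A simple \<open>d\<close>-regular graph is identified with its adjacency matrix.\<close>

definition regular_adjacency :: "nat \<Rightarrow> nat \<Rightarrow> real mat set" where
  "regular_adjacency d n =
     {A \<in> carrier_mat n n.
        (\<forall>i<n. \<forall>j<n. A $$ (i, j) \<in> {0, 1}) \<and>
        transpose_mat A = A \<and>
        (\<forall>i<n. A $$ (i, i) = 0) \<and>
        (\<forall>i<n. card {j. j < n \<and> A $$ (i, j) = 1} = d)}"

definition edges :: "real mat \<Rightarrow> nat set set" where
  "edges A = {{i, j} | i j. i < dim_row A \<and> j < dim_row A \<and> A $$ (i, j) = 1}"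

definition hadamard_mat :: "real mat \<Rightarrow> real mat \<Rightarrow> real mat" where
  "hadamard_mat A B = mat (dim_row A) (dim_col A) (\<lambda>(i, j). A $$ (i, j) * B $$ (i, j))"

text \<open>The Borel \<open>\<sigma>\<close>-algebra on \<open>n \<times> n\<close> matrices, generated by the entries.
  It only serves to say that matrices are random; the measure it carries is irrelevant.\<close>

definition mat_borel :: "nat \<Rightarrow> real mat measure" where
  "mat_borel n =
     vimage_algebra (carrier_mat n n) (\<lambda>A. \<lambda>p\<in>{..<n} \<times> {..<n}. A $$ p)
       (PiM ({..<n} \<times> {..<n}) (\<lambda>_. borel))"

definition weibull_law :: "real \<Rightarrow> real measure \<Rightarrow> bool" where
  "weibull_law \<alpha> \<mu> \<longleftrightarrow>
     prob_space \<mu> \<and> sets \<mu> = sets borel \<and>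
     (\<exists>C\<^sub>1>0. \<exists>C\<^sub>2>0. \<forall>t\<ge>1.
        C\<^sub>1 / 2 * exp (- (t powr \<alpha>)) \<le> measure \<mu> {t..} \<and>
        measure \<mu> {t..} \<le> C\<^sub>2 / 2 * exp (- (t powr \<alpha>)) \<and>
        C\<^sub>1 / 2 * exp (- (t powr \<alpha>)) \<le> measure \<mu> {..-t} \<and>
        measure \<mu> {..-t} \<le> C\<^sub>2 / 2 * exp (- (t powr \<alpha>)))"

text \<open>\<open>A\<close> is the adjacency matrix of a uniform random \<open>d\<close>-regular graph and \<open>W\<close> is the matrix of
  weights, with law \<open>\<mu>\<close> above the diagonal (the diagonal of \<open>W\<close> is arbitrary). As \<open>M\<close> is a
  probability space, \<open>adjacency\<close> forces \<open>regular_adjacency d n\<close> to be nonempty, that is,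
  \<open>d < n\<close> with \<open>n * d\<close> even (or \<open>n = 0\<close>).\<close>

locale weighted_random_regular_graph = prob_space M
  for M :: "'a measure" +
  fixes d n :: nat
    and \<mu> :: "real measure"
    and A W :: "'a \<Rightarrow> real mat"
  assumes adjacency: "A \<in> measurable M (count_space (regular_adjacency d n))"
    and uniform: "distr M (count_space (regular_adjacency d n)) A =
      uniform_count_measure (regular_adjacency d n)"
    and weights: "random_variable (mat_borel n) W"
    and weights_symmetric: "\<And>\<omega>. \<omega> \<in> space M \<Longrightarrow> transpose_mat (W \<omega>) = W \<omega>"
    and weights_indep:
      "indep_vars (\<lambda>_. borel) (\<lambda>p \<omega>. W \<omega> $$ p) {(i, j). i < j \<and> j < n}"
    and weights_law:
      "\<And>i j. i < j \<Longrightarrow> j < n \<Longrightarrow> distr M borel (\<lambda>\<omega>. W \<omega> $$ (i, j)) = \<mu>"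
    and indep: "indep_var (mat_borel n) A (mat_borel n) W"

definition top_eigenvector :: "real mat \<Rightarrow> real vec \<Rightarrow> bool" where
  "top_eigenvector X f \<longleftrightarrow> eigenvector X f (Max (spectrum X))"

definition localized_on :: "real \<Rightarrow> real vec \<Rightarrow> nat set \<Rightarrow> bool" where
  "localized_on \<epsilon> f I \<longleftrightarrow>
     L2_set (vec_index f) I \<ge> (1 - \<epsilon>) * L2_set (vec_index f) {..<dim_vec f}"

end

theory Submission
  imports Defs "HOL-Real_Asymp.Real_Asymp"
begin

text \<open>Put \<open>L = ln n\<close> and \<open>Z e = |W e| ^ \<alpha>\<close>, whose tails are those of an exponential variable up to constants.
  Fix the graph. The edges with \<open>Z e \<ge> h\<close>, for \<open>h\<close> a small fraction of \<open>L\<close>, form components of size at most \<open>K\<close>,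
  since a connected set carrying total weight \<open>\<Sum>e. Z e\<close> well above \<open>L\<close> does not occur; all other edges
  change the quadratic form by at most \<open>d * h ^ (1 / \<alpha>)\<close>. Hence the top eigenvector has almost all its mass on the
  components whose own top eigenvalue is close to that of the whole matrix.

  To count these components, consider the expected number of small connected sets whose top eigenvalue exceeds
  \<open>y\<close>. Replacing \<open>y\<close> by \<open>s * y\<close> changes this number only by the factor \<open>n ^ o(1)\<close> as \<open>s\<close> tends to \<open>1\<close>, because scaling
  the weights of a bounded number of edges does. So for a suitable \<open>y\<close> it lies between two small powers of \<open>n\<close> both
  at \<open>y\<close> and at \<open>y / s\<close>: by the second moment method the top eigenvalue is at least \<open>y\<close>, and by Markov's inequality
  at most \<open>n ^ \<epsilon>\<close> vertices are in components exceeding \<open>y / s\<close>. This works for every \<open>d\<close>-regular graph.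

  If \<open>\<alpha> < 2\<close> and no heavy edge lies in a triangle, then by the weighted Mantel inequality the top
  eigenvalue of a component is at most \<open>sqrt (\<Sum>e. Z e ^ (2 / \<alpha>))\<close>, and as \<open>\<Sum>e. Z e\<close> is at most \<open>L (1 + o(1))\<close> this can only
  be close to \<open>L ^ (1 / \<alpha>)\<close> if a single edge carries almost all the weight. Only
  \<open>exp (\<epsilon> * L ^ \<zeta>)\<close> edges have \<open>Z e\<close> above \<open>L\<close> minus a small multiple of \<open>L ^ \<zeta>\<close>. Switching bounds the expected
  number of triangles in the random graph.\<close>


section \<open>Top eigenvectors as Rayleigh maximizers\<close>

text \<open>The claim bounds from below the probability of an event quantified over all top
  eigenvectors, and a nonmeasurable set has \<open>prob\<close> 0, so this event must itself be
  shown measurable. For this reason eigenvectors are replaced by maximizers of the Rayleigh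
  quotient, and these by approximate maximizers with rational coordinates. For general \<alpha> the
  location of the top eigenvalue depends on the graph and is never computed: a discrete intermediate
  value argument along \<open>y0 * s ^ i\<close> finds the threshold, and only the ratio of
  consecutive expected counts is estimated. For \<alpha> < 2 a single edge is asymptotically optimal
  and the threshold is explicit. With components of size L^(1/8), the edges below h cost a relative
  error of order at most L^(-1/16), because 1 / \<alpha> > 1/2. A component whose largest
  \<open>Z e\<close> stays below L by order L^(31/32) loses a relative amount of order L^(-1/32),
  which dominates that error; this is the origin of \<zeta> = 31/32.\<close>

definition qform :: "nat set \<Rightarrow> (nat \<Rightarrow> nat \<Rightarrow> real) \<Rightarrow> (nat \<Rightarrow> real) \<Rightarrow> real" where
  "qform S x f = (\<Sum>i\<in>S. \<Sum>j\<in>S. x i j * f i * f j)"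

definition sqn :: "nat set \<Rightarrow> (nat \<Rightarrow> real) \<Rightarrow> real" where
  "sqn S f = (\<Sum>i\<in>S. (f i)\<^sup>2)"

text \<open>Cross-multiplied, so that no division by zero occurs. The zero vector satisfies it,
  whence the condition \<open>sqn {..<n} f > 0\<close> wherever maximizers are used.\<close>

definition rayleigh_max :: "nat \<Rightarrow> (nat \<Rightarrow> nat \<Rightarrow> real) \<Rightarrow> (nat \<Rightarrow> real) \<Rightarrow> bool" where
  "rayleigh_max n x f \<longleftrightarrow>
     (\<forall>g. qform {..<n} x g * sqn {..<n} f \<le> qform {..<n} x f * sqn {..<n} g)"

lemma sqn_nonneg: "0 \<le> sqn S f"
  unfolding sqn_def by (intro sum_nonneg) auto

lemma sqn_mono: "finite T \<Longrightarrow> S \<subseteq> T \<Longrightarrow> sqn S f \<le> sqn T f"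
  unfolding sqn_def by (intro sum_mono2) auto

lemma sqn_eq_0_iff: "finite S \<Longrightarrow> sqn S f = 0 \<longleftrightarrow> (\<forall>i\<in>S. f i = 0)"
  unfolding sqn_def by (subst sum_nonneg_eq_0_iff) auto

lemma sqn_scale: "sqn S (\<lambda>i. c * f i) = c\<^sup>2 * sqn S f"
  unfolding sqn_def by (simp add: power_mult_distrib sum_distrib_left)

lemma qform_scale: "qform S x (\<lambda>i. c * f i) = c\<^sup>2 * qform S x f"
  unfolding qform_def by (simp add: sum_distrib_left power2_eq_square algebra_simps)

lemma qform_cong: "(\<And>i. i \<in> S \<Longrightarrow> f i = g i) \<Longrightarrow> qform S x f = qform S x g"
  unfolding qform_def by (intro sum.cong refl) simp

lemma sqn_cong: "(\<And>i. i \<in> S \<Longrightarrow> f i = g i) \<Longrightarrow> sqn S f = sqn S g"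
  unfolding sqn_def by (intro sum.cong refl) simp

lemma tendsto_qform:
  assumes "\<And>i. i \<in> S \<Longrightarrow> (\<lambda>k. F k i) \<longlonglongrightarrow> l i"
  shows "(\<lambda>k. qform S x (F k)) \<longlonglongrightarrow> qform S x l"
  unfolding qform_def by (intro tendsto_intros assms)

lemma tendsto_sqn:
  assumes "\<And>i. i \<in> S \<Longrightarrow> (\<lambda>k. F k i) \<longlonglongrightarrow> l i"
  shows "(\<lambda>k. sqn S (F k)) \<longlonglongrightarrow> sqn S l"
  unfolding sqn_def by (intro tendsto_intros assms)

lemma abs_le_sqrt_sqn:
  assumes "finite S" "i \<in> S" shows "\<bar>f i\<bar> \<le> sqrt (sqn S f)"
proof -
  have "(f i)\<^sup>2 \<le> sqn S f"
    unfolding sqn_def using assms by (intro member_le_sum) auto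
  then have "sqrt ((f i)\<^sup>2) \<le> sqrt (sqn S f)" by (rule real_sqrt_le_mono)
  then show ?thesis by simp
qed

text \<open>Bolzano-Weierstrass, extracting a subsequence one coordinate at a time: vectors are
  plain functions of which only the values below n matter.\<close>

lemma bounded_functions_convergent_subseq:
  fixes F :: "nat \<Rightarrow> nat \<Rightarrow> real"
  assumes "\<And>k i. i < n \<Longrightarrow> \<bar>F k i\<bar> \<le> B"
  shows "\<exists>r l. strict_mono (r :: nat \<Rightarrow> nat) \<and> (\<forall>i<n. (\<lambda>k. F (r k) i) \<longlonglongrightarrow> l i)"
  using assms
proof (induction n)
  case 0
  then show ?case by (auto intro!: exI[of _ id] strict_mono_id)
next
  case (Suc n)
  then obtain r l where r: "strict_mono (r :: nat \<Rightarrow> nat)"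
    and l: "\<forall>i<n. (\<lambda>k. F (r k) i) \<longlonglongrightarrow> l i" by (metis less_Suc_eq)
  have "bounded (range (\<lambda>k. F (r k) n))"
    using Suc.prems by (auto simp: bounded_iff)
  then obtain m r' where r': "strict_mono (r' :: nat \<Rightarrow> nat)"
    and m: "((\<lambda>k. F (r k) n) \<circ> r') \<longlonglongrightarrow> m"
    using bounded_imp_convergent_subsequence by blast
  have "(\<lambda>k. F ((r \<circ> r') k) i) \<longlonglongrightarrow> (l(n := m)) i" if "i < Suc n" for i
  proof (cases "i = n")
    case True then show ?thesis using m by (simp add: o_def)
  next
    case False
    then have "(\<lambda>k. F (r k) i) \<longlonglongrightarrow> l i" using l that by simp
    from LIMSEQ_subseq_LIMSEQ[OF this r'] False show ?thesis by (simp add: o_def)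
  qed
  then show ?case using strict_mono_o[OF r r'] by blast
qed

lemma qform_le_sum_abs:
  assumes "finite S" "sqn S f = 1"
  shows "qform S x f \<le> (\<Sum>i\<in>S. \<Sum>j\<in>S. \<bar>x i j\<bar>)"
  unfolding qform_def
proof (intro sum_mono)
  fix i j assume "i \<in> S" "j \<in> S"
  then have 1: "\<bar>f i\<bar> \<le> 1" "\<bar>f j\<bar> \<le> 1" 
    using abs_le_sqrt_sqn[OF assms(1), of i f] abs_le_sqrt_sqn[OF assms(1), of j f] assms(2) by auto
  have "x i j * f i * f j \<le> \<bar>x i j\<bar> * \<bar>f i\<bar> * \<bar>f j\<bar>" by (metis abs_ge_self abs_mult)
  also have "\<dots> \<le> \<bar>x i j\<bar> * 1 * 1" using 1 by (intro mult_mono) auto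
  finally show "x i j * f i * f j \<le> \<bar>x i j\<bar>" by simp
qed

lemma rayleigh_max_unitI:
  assumes f: "sqn {..<n} f = 1"
    and max: "\<And>g. sqn {..<n} g = 1 \<Longrightarrow> qform {..<n} x g \<le> qform {..<n} x f"
  shows "rayleigh_max n x f"
  unfolding rayleigh_max_def
proof
  fix g
  show "qform {..<n} x g * sqn {..<n} f \<le> qform {..<n} x f * sqn {..<n} g"
  proof (cases "sqn {..<n} g = 0")
    case True
    then have "\<forall>i<n. g i = 0" by (simp add: sqn_eq_0_iff)
    then have "qform {..<n} x g = 0" by (simp add: qform_def)
    then show ?thesis using True by simp
  next
    case False
    define c where "c = 1 / sqrt (sqn {..<n} g)"
    have pos: "sqn {..<n} g > 0" using False sqn_nonneg[of "{..<n}" g] by simp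
    have c2: "c\<^sup>2 = 1 / sqn {..<n} g" using pos by (simp add: c_def power_divide)
    have "sqn {..<n} (\<lambda>i. c * g i) = 1" using pos by (simp add: sqn_scale c2)
    from max[OF this] have "qform {..<n} x g / sqn {..<n} g \<le> qform {..<n} x f"
      by (simp add: qform_scale c2)
    then show ?thesis using pos f by (simp add: field_simps)
  qed
qed

text \<open>Compactness of the unit sphere: a maximizing sequence has coordinates bounded by 1, and
  both forms are continuous in finitely many coordinates.\<close>

lemma rayleigh_max_exists:
  assumes "0 < n"
  shows "\<exists>f. sqn {..<n} f = 1 \<and> rayleigh_max n x f"
proof -
  define Q where "Q = qform {..<n} x"
  define V where "V = Q ` {g. sqn {..<n} g = 1}"
  have "sqn {..<n} (\<lambda>i. if i = 0 then 1 else 0) = 1"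
    unfolding sqn_def using assms by (subst sum.remove[of _ 0]) auto
  then have ne: "V \<noteq> {}" unfolding V_def by auto
  have bdd: "bdd_above V" unfolding V_def Q_def
    by (rule bdd_aboveI[of _ "\<Sum>i<n. \<Sum>j<n. \<bar>x i j\<bar>"]) (auto intro: qform_le_sum_abs)
  define s where "s = Sup V"
  have "\<exists>g. sqn {..<n} g = 1 \<and> Q g > s - 1 / real (Suc k)" for k
  proof -
    have "s - 1 / real (Suc k) < Sup V" by (simp add: s_def)
    then obtain v where "v \<in> V" "v > s - 1 / real (Suc k)" using less_cSup_iff[OF ne bdd] by auto
    then show ?thesis by (auto simp: V_def)
  qed
  then obtain G where G: "\<And>k. sqn {..<n} (G k) = 1" "\<And>k. Q (G k) > s - 1 / real (Suc k)"
    by metis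
  have "\<bar>G k i\<bar> \<le> 1" if "i < n" for k i
    using abs_le_sqrt_sqn[of "{..<n}" i "G k"] G(1)[of k] that by simp
  then obtain r l where r: "strict_mono (r :: nat \<Rightarrow> nat)" and l: "\<forall>i<n. (\<lambda>k. G (r k) i) \<longlonglongrightarrow> l i"
    using bounded_functions_convergent_subseq[of n G 1] by blast
  have "(\<lambda>k. sqn {..<n} (G (r k))) \<longlonglongrightarrow> sqn {..<n} l"
    using l by (intro tendsto_sqn) auto
  then have l1: "sqn {..<n} l = 1" using G(1) by (simp add: LIMSEQ_const_iff)
  have Ql: "(\<lambda>k. Q (G (r k))) \<longlonglongrightarrow> Q l"
    unfolding Q_def using l by (intro tendsto_qform) auto
  have "(\<lambda>k. s - 1 / real (Suc k)) \<longlonglongrightarrow> s - 0"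
    by (intro tendsto_diff tendsto_const LIMSEQ_Suc[OF lim_1_over_n])
  then have "((\<lambda>k. s - 1 / real (Suc k)) \<circ> r) \<longlonglongrightarrow> s"
    using LIMSEQ_subseq_LIMSEQ[OF _ r] by fastforce
  then have "s \<le> Q l"
    by (rule LIMSEQ_le[OF _ Ql]) (use G(2) less_imp_le in \<open>auto simp: o_def\<close>)
  moreover have "Q g \<le> s" if "sqn {..<n} g = 1" for g
    unfolding s_def by (rule cSup_upper[OF _ bdd]) (use that in \<open>auto simp: V_def\<close>)
  ultimately have "rayleigh_max n x l"
    using l1 by (intro rayleigh_max_unitI) (auto simp: Q_def intro: order_trans)
  then show ?thesis using l1 by blast
qed

text \<open>First-order condition at a maximum. At t = P / q with q > \<bar>Q\<bar> the linear term
  outweighs the quadratic one, so a nonzero P would make the expression positive.\<close>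

lemma linear_coeff_zero:
  fixes P Q :: real
  assumes "\<And>t. 2 * t * P + t\<^sup>2 * Q \<le> 0"
  shows "P = 0"
proof (rule ccontr)
  assume "P \<noteq> 0"
  define q where "q = \<bar>Q\<bar> + 1"
  have q: "q > 0" "2 * q + Q > 0" by (auto simp: q_def abs_if)
  have "2 * (P / q) * P + (P / q)\<^sup>2 * Q = P\<^sup>2 / q\<^sup>2 * (2 * q + Q)"
    using q(1) by (simp add: power2_eq_square field_simps)
  moreover have "\<dots> > 0"
    using \<open>P \<noteq> 0\<close> q by (intro mult_pos_pos divide_pos_pos) auto
  ultimately show False using assms[of "P / q"] by linarith
qed

lemma qform_perturb:
  assumes "finite S" "i \<in> S" and sym: "\<And>a b. a \<in> S \<Longrightarrow> b \<in> S \<Longrightarrow> x a b = x b a"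
  shows "qform S x (\<lambda>k. f k + (if k = i then t else 0)) =
    qform S x f + 2 * t * (\<Sum>j\<in>S. x i j * f j) + t\<^sup>2 * x i i"
proof -
  have "qform S x (\<lambda>k. f k + (if k = i then t else 0)) =
    (\<Sum>a\<in>S. \<Sum>b\<in>S. x a b * f a * f b + (if b = i then x a i * f a * t else 0) +
       (if a = i then x i b * t * f b else 0) + (if a = i then (if b = i then x i i * t * t else 0) else 0))"
    unfolding qform_def by (intro sum.cong refl) (auto simp: algebra_simps)
  also have "\<dots> = qform S x f + (\<Sum>a\<in>S. x a i * f a * t) + (\<Sum>b\<in>S. x i b * t * f b) + x i i * t * t"
  proof -
    have 1: "(\<Sum>a\<in>S. \<Sum>b\<in>S. if b = i then x a i * f a * t else 0) = (\<Sum>a\<in>S. x a i * f a * t)"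
      using assms by (intro sum.cong refl) (simp add: sum.delta)
    have 2: "(\<Sum>a\<in>S. \<Sum>b\<in>S. if a = i then x i b * t * f b else 0) = (\<Sum>b\<in>S. x i b * t * f b)"
      using assms by (subst sum.swap) (intro sum.cong refl, simp add: sum.delta)
    have 3: "(\<Sum>a\<in>S. \<Sum>b\<in>S. if a = i then (if b = i then x i i * t * t else 0) else 0) = x i i * t * t"
    proof -
      have "(\<Sum>a\<in>S. \<Sum>b\<in>S. if a = i then (if b = i then x i i * t * t else 0) else 0) =
        (\<Sum>a\<in>S. if a = i then x i i * t * t else 0)"
        using assms by (intro sum.cong refl) (simp add: sum.delta)
      then show ?thesis using assms by (simp add: sum.delta)
    qed
    show ?thesis by (simp add: sum.distrib 1 2 3 qform_def)
  qed
  also have "(\<Sum>a\<in>S. x a i * f a * t) = t * (\<Sum>j\<in>S. x i j * f j)"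
    using assms by (auto simp: sum_distrib_left sym intro!: sum.cong)
  also have "(\<Sum>b\<in>S. x i b * t * f b) = t * (\<Sum>j\<in>S. x i j * f j)"
    by (auto simp: sum_distrib_left intro!: sum.cong)
  finally show ?thesis by (simp add: power2_eq_square algebra_simps)
qed

lemma sqn_perturb:
  assumes "finite S" "i \<in> S"
  shows "sqn S (\<lambda>k. f k + (if k = i then t else 0)) = sqn S f + 2 * t * f i + t\<^sup>2"
proof -
  have "sqn S (\<lambda>k. f k + (if k = i then t else 0)) =
    (\<Sum>k\<in>S. (f k)\<^sup>2 + (if k = i then 2 * t * f i + t\<^sup>2 else 0))"
    unfolding sqn_def by (intro sum.cong refl) (auto simp: power2_eq_square algebra_simps)
  also have "\<dots> = sqn S f + (2 * t * f i + t\<^sup>2)"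
    using assms by (simp add: sum.distrib sum.delta sqn_def)
  finally show ?thesis by simp
qed

text \<open>Perturbing coordinate i alone yields row i of the eigenvalue equation: the coefficient
  of 2 * t in the maximality inequality must vanish.\<close>

lemma rayleigh_max_eigen:
  assumes max: "rayleigh_max n x f" and pos: "sqn {..<n} f > 0" and i: "i < n"
    and sym: "\<And>a b. a < n \<Longrightarrow> b < n \<Longrightarrow> x a b = x b a"
  shows "(\<Sum>j<n. x i j * f j) = qform {..<n} x f / sqn {..<n} f * f i"
proof -
  let ?P = "(\<Sum>j<n. x i j * f j) * sqn {..<n} f - qform {..<n} x f * f i"
  have "2 * t * ?P + t\<^sup>2 * (x i i * sqn {..<n} f - qform {..<n} x f) \<le> 0" for t
  proof -
    have "qform {..<n} x (\<lambda>k. f k + (if k = i then t else 0)) * sqn {..<n} f \<le>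
      qform {..<n} x f * sqn {..<n} (\<lambda>k. f k + (if k = i then t else 0))"
      using max unfolding rayleigh_max_def by blast
    moreover have "qform {..<n} x (\<lambda>k. f k + (if k = i then t else 0)) =
      qform {..<n} x f + 2 * t * (\<Sum>j<n. x i j * f j) + t\<^sup>2 * x i i"
      using i sym by (intro qform_perturb) auto
    moreover have "sqn {..<n} (\<lambda>k. f k + (if k = i then t else 0)) = sqn {..<n} f + 2 * t * f i + t\<^sup>2"
      using i by (intro sqn_perturb) auto
    ultimately show ?thesis by (simp add: algebra_simps)
  qed
  then have "?P = 0" by (rule linear_coeff_zero)
  then show ?thesis using pos by (simp add: field_simps)
qed

section \<open>Eigenvectors of a symmetric matrix and its Rayleigh quotient\<close>

lemma eigenvector_iff_sum:
  fixes X :: "real mat"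
  assumes "X \<in> carrier_mat n n"
  shows "eigenvector X v k \<longleftrightarrow> v \<in> carrier_vec n \<and> v \<noteq> 0\<^sub>v n \<and>
    (\<forall>i<n. (\<Sum>j<n. X $$ (i, j) * v $ j) = k * v $ i)"
proof -
  have "X *\<^sub>v v = k \<cdot>\<^sub>v v \<longleftrightarrow> (\<forall>i<n. (\<Sum>j<n. X $$ (i, j) * v $ j) = k * v $ i)"
    if v: "v \<in> carrier_vec n"
  proof -
    have "(X *\<^sub>v v) $ i = (\<Sum>j<n. X $$ (i, j) * v $ j)" if "i < n" for i
      using assms v that by (auto simp: scalar_prod_def atLeast0LessThan intro!: sum.cong)
    moreover have "(k \<cdot>\<^sub>v v) $ i = k * v $ i" if "i < n" for i
      using v that by auto
    ultimately show ?thesis using assms v by (auto simp: vec_eq_iff)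
  qed
  then show ?thesis using assms by (auto simp: eigenvector_def)
qed

lemma sqn_vec_pos:
  assumes "v \<in> carrier_vec n" "v \<noteq> 0\<^sub>v n" shows "sqn {..<n} (vec_index v) > 0"
proof -
  have "sqn {..<n} (vec_index v) \<noteq> 0"
  proof
    assume "sqn {..<n} (vec_index v) = 0"
    then have "\<forall>i<n. v $ i = 0" by (simp add: sqn_eq_0_iff)
    then have "v = 0\<^sub>v n" using assms(1) by (intro eq_vecI) auto
    then show False using assms by simp
  qed
  then show ?thesis using sqn_nonneg[of "{..<n}" "vec_index v"] by simp
qed

text \<open>The maximum of the Rayleigh quotient is an eigenvalue because a maximizer exists and
  solves the eigenvalue equation; it is the largest one because the quotient at any eigenvector
  equals its eigenvalue.\<close>

lemma top_eigenvector_iff_rayleigh: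
  fixes X :: "real mat"
  assumes n: "0 < n" and X: "X \<in> carrier_mat n n" and sym: "\<And>i j. i < n \<Longrightarrow> j < n \<Longrightarrow> X $$ (i, j) = X $$ (j, i)"
  shows "top_eigenvector X v \<longleftrightarrow> v \<in> carrier_vec n \<and> v \<noteq> 0\<^sub>v n \<and>
    rayleigh_max n (\<lambda>i j. X $$ (i, j)) (vec_index v)"
proof -
  define x where "x = (\<lambda>i j. X $$ (i, j))"
  obtain f where f1: "sqn {..<n} f = 1" and fm: "rayleigh_max n x f"
    using rayleigh_max_exists[OF n] by blast
  define lam where "lam = qform {..<n} x f"
  have quot: "qform {..<n} x (vec_index w) = k * sqn {..<n} (vec_index w)"
    if "\<forall>i<n. (\<Sum>j<n. X $$ (i, j) * w $ j) = k * w $ i" for w k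
  proof -
    have "qform {..<n} x (vec_index w) = (\<Sum>i<n. w $ i * (\<Sum>j<n. X $$ (i, j) * w $ j))"
      unfolding qform_def x_def by (simp add: sum_distrib_left algebra_simps)
    also have "\<dots> = k * sqn {..<n} (vec_index w)"
      using that by (simp add: sqn_def sum_distrib_left power2_eq_square algebra_simps)
    finally show ?thesis .
  qed
  have le: "qform {..<n} x g \<le> lam * sqn {..<n} g" for g
    using fm f1 unfolding rayleigh_max_def lam_def by (metis mult.right_neutral)
  have eig: "eigenvector X w lam"
    if w: "w \<in> carrier_vec n" "w \<noteq> 0\<^sub>v n" "rayleigh_max n x (vec_index w)" for w
  proof -
    have pos: "sqn {..<n} (vec_index w) > 0" using w sqn_vec_pos by blast
    have "lam * sqn {..<n} (vec_index w) \<le> qform {..<n} x (vec_index w) * 1"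
      using w(3) f1 unfolding rayleigh_max_def lam_def by metis
    with le[of "vec_index w"] have "qform {..<n} x (vec_index w) / sqn {..<n} (vec_index w) = lam"
      using pos by (simp add: field_simps)
    then have "\<forall>i<n. (\<Sum>j<n. x i j * w $ j) = lam * w $ i"
      using rayleigh_max_eigen[OF w(3) pos] sym by (simp add: x_def)
    then show ?thesis using w by (simp add: eigenvector_iff_sum[OF X] x_def)
  qed
  define w where "w = vec n f"
  have wf: "vec_index w i = f i" if "i < n" for i using that by (simp add: w_def)
  have "sqn {..<n} (vec_index w) = 1" using f1 sqn_cong[of "{..<n}" "vec_index w" f] wf by simp
  moreover have "qform {..<n} x (vec_index w) = qform {..<n} x f"
    using qform_cong[of "{..<n}" "vec_index w" f] wf by simp
  ultimately have "rayleigh_max n x (vec_index w)"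
    using fm f1 unfolding rayleigh_max_def by simp
  moreover have "w \<noteq> 0\<^sub>v n"
    using \<open>sqn {..<n} (vec_index w) = 1\<close> by (auto simp: sqn_def)
  ultimately have "eigenvector X w lam" using eig by (simp add: w_def)
  then have in_spec: "lam \<in> spectrum X" unfolding spectrum_def eigenvalue_def by blast
  have "Max (spectrum X) = lam"
  proof (rule Max_eqI[OF card_finite_spectrum(1)[OF X] _ in_spec])
    fix k assume "k \<in> spectrum X"
    then obtain u where "eigenvector X u k" unfolding spectrum_def eigenvalue_def by blast
    then have u: "u \<in> carrier_vec n" "u \<noteq> 0\<^sub>v n" "\<forall>i<n. (\<Sum>j<n. X $$ (i, j) * u $ j) = k * u $ i"
      by (auto simp: eigenvector_iff_sum[OF X])
    from le[of "vec_index u"] quot[OF u(3)] sqn_vec_pos[OF u(1,2)] show "k \<le> lam" by simp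
  qed
  then have top: "top_eigenvector X v \<longleftrightarrow> eigenvector X v lam" by (simp add: top_eigenvector_def)
  show ?thesis
  proof
    assume "top_eigenvector X v"
    then have v: "v \<in> carrier_vec n" "v \<noteq> 0\<^sub>v n" "\<forall>i<n. (\<Sum>j<n. X $$ (i, j) * v $ j) = lam * v $ i"
      by (auto simp: top eigenvector_iff_sum[OF X])
    have "rayleigh_max n x (vec_index v)"
      unfolding rayleigh_max_def
    proof
      fix g
      have "qform {..<n} x g * sqn {..<n} (vec_index v) \<le> lam * sqn {..<n} g * sqn {..<n} (vec_index v)"
        using le sqn_nonneg by (intro mult_right_mono)
      then show "qform {..<n} x g * sqn {..<n} (vec_index v) \<le> qform {..<n} x (vec_index v) * sqn {..<n} g"
        using quot[OF v(3)] by (simp add: algebra_simps)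
    qed
    then show "v \<in> carrier_vec n \<and> v \<noteq> 0\<^sub>v n \<and> rayleigh_max n (\<lambda>i j. X $$ (i, j)) (vec_index v)"
      using v by (simp add: x_def)
  next
    assume "v \<in> carrier_vec n \<and> v \<noteq> 0\<^sub>v n \<and> rayleigh_max n (\<lambda>i j. X $$ (i, j)) (vec_index v)"
    then show "top_eigenvector X v" using eig top by (simp add: x_def)
  qed
qed

section \<open>Growing lists and block decompositions\<close>

text \<open>Connected vertex sets are enumerated by lists in which every vertex is adjacent to a later one:
  unlike connected sets, these lists are counted by an immediate induction.\<close>

fun grow :: "'a set \<Rightarrow> ('a \<Rightarrow> 'a \<Rightarrow> bool) \<Rightarrow> 'a list \<Rightarrow> bool" where
  "grow U E [] = False"
| "grow U E [v] = (v \<in> U)"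
| "grow U E (u # x # xs) =
     (u \<in> U \<and> u \<notin> set (x # xs) \<and> (\<exists>y\<in>set (x # xs). E y u) \<and> grow U E (x # xs))"

lemma grow_Cons: "grow U E (u # xs) \<longleftrightarrow>
    u \<in> U \<and> (xs = [] \<or> u \<notin> set xs \<and> (\<exists>y\<in>set xs. E y u) \<and> grow U E xs)"
  by (cases xs) auto

lemma grow_subset: "grow U E xs \<Longrightarrow> set xs \<subseteq> U"
  by (induction U E xs rule: grow.induct) auto

lemma grow_distinct: "grow U E xs \<Longrightarrow> distinct xs"
  by (induction U E xs rule: grow.induct) auto

lemma grow_mono:
  assumes "grow U E xs" "\<And>x y. x \<in> U \<Longrightarrow> y \<in> U \<Longrightarrow> E x y \<Longrightarrow> F x y"
  shows "grow U F xs"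
  using assms(1)
proof (induction xs)
  case (Cons u xs)
  show ?case
  proof (cases "xs = []")
    case False
    then obtain y where "u \<in> U" "u \<notin> set xs" "y \<in> set xs" "E y u" "grow U E xs"
      using Cons.prems by (auto simp: grow_Cons)
    moreover from this have "F y u" using assms(2) grow_subset[of U E xs] by blast
    ultimately show ?thesis using Cons.IH by (auto simp: grow_Cons)
  qed (use Cons.prems in simp)
qed simp

lemma grow_suffix: "grow U E (ys @ xs) \<Longrightarrow> xs \<noteq> [] \<Longrightarrow> grow U E xs"
  by (induction ys) (auto simp: grow_Cons)

lemma finite_grow: "finite U \<Longrightarrow> finite {xs. grow U E xs \<and> P xs}"
  by (rule finite_subset[OF _ finite_subset_distinct[of U]]) (auto dest: grow_subset grow_distinct)

text \<open>A list of length k + 2 through v either has v as its head, and then its tail passes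
  through one of at most d neighbours of v, or has v in its tail, and then the head is a neighbour
  of one of k + 1 vertices; d + (k + 1) * d = (k + 2) * d. Lists through a prescribed vertex are
  counted since the second moment method needs the number of lists meeting a given one.\<close>

lemma card_grow_containing:
  assumes U: "finite U" and sym: "\<And>x y. E x y \<Longrightarrow> E y x"
    and deg: "\<And>y. y \<in> U \<Longrightarrow> card {u \<in> U. E y u} \<le> d" and v: "v \<in> U"
  shows "card {xs. grow U E xs \<and> length xs = Suc k \<and> v \<in> set xs} \<le> (Suc k * d) ^ k"
  using v
proof (induction k arbitrary: v)
  case 0
  have "{xs. grow U E xs \<and> length xs = Suc 0 \<and> v \<in> set xs} \<subseteq> {[v]}"
    by (auto simp: length_Suc_conv)
  from card_mono[OF _ this] show ?case by simp
next
  case (Suc k)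
  let ?G = "\<lambda>v. {xs. grow U E xs \<and> length xs = Suc k \<and> v \<in> set xs}"
  let ?A = "\<Union>xs\<in>?G v. \<Union>y\<in>set xs. (\<lambda>u. u # xs) ` {u \<in> U. E y u}"
  let ?B = "\<Union>y\<in>{y \<in> U. E v y}. (\<lambda>xs. v # xs) ` ?G y"
  have fin: "finite (?G w)" for w using U by (rule finite_grow)
  have "{xs. grow U E xs \<and> length xs = Suc (Suc k) \<and> v \<in> set xs} \<subseteq> ?A \<union> ?B"
  proof
    fix zs assume "zs \<in> {xs. grow U E xs \<and> length xs = Suc (Suc k) \<and> v \<in> set xs}"
    then obtain u xs where zs: "zs = u # xs" and g: "grow U E (u # xs)" and l: "length xs = Suc k"
      and v: "v = u \<or> v \<in> set xs" by (auto simp: length_Suc_conv)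
    from g l obtain y where y: "y \<in> set xs" "E y u" and gx: "grow U E xs" and u: "u \<in> U"
      by (auto simp: grow_Cons)
    have "y \<in> U" using grow_subset[OF gx] y by auto
    from v show "zs \<in> ?A \<union> ?B"
    proof
      assume "v = u"
      then have "zs \<in> ?B" using zs y gx l sym[OF y(2)] \<open>y \<in> U\<close> by auto
      then show ?thesis by simp
    next
      assume "v \<in> set xs"
      then have "zs \<in> ?A" using zs y gx l u by auto
      then show ?thesis by simp
    qed
  qed
  moreover have "finite (?A \<union> ?B)" using fin U by auto
  ultimately have "card {xs. grow U E xs \<and> length xs = Suc (Suc k) \<and> v \<in> set xs} \<le> card (?A \<union> ?B)"
    by (intro card_mono)
  also have "\<dots> \<le> card ?A + card ?B" by (rule card_Un_le)
  also have "\<dots> \<le> (Suc k * d) ^ k * (Suc k * d) + d * (Suc k * d) ^ k"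
  proof (rule add_mono)
    have "card ?A \<le> (\<Sum>xs\<in>?G v. Suc k * d)"
    proof (rule order_trans[OF card_UN_le[OF fin] sum_mono])
      fix xs assume xs: "xs \<in> ?G v"
      then have sub: "set xs \<subseteq> U" using grow_subset by blast
      have "card (\<Union>y\<in>set xs. (\<lambda>u. u # xs) ` {u \<in> U. E y u}) \<le> (\<Sum>y\<in>set xs. d)"
      proof (rule order_trans[OF card_UN_le sum_mono])
        fix y assume "y \<in> set xs"
        then have "card {u \<in> U. E y u} \<le> d" using deg sub by blast
        then show "card ((\<lambda>u. u # xs) ` {u \<in> U. E y u}) \<le> d"
          using card_image_le[of "{u \<in> U. E y u}" "\<lambda>u. u # xs"] U by simp
      qed simp
      also have "\<dots> = card (set xs) * d" by simp
      also have "\<dots> \<le> Suc k * d" using card_length[of xs] xs by (intro mult_right_mono) auto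
      finally show "card (\<Union>y\<in>set xs. (\<lambda>u. u # xs) ` {u \<in> U. E y u}) \<le> Suc k * d" .
    qed
    also have "\<dots> = card (?G v) * (Suc k * d)" by (simp only: sum_constant of_nat_id)
    also have "\<dots> \<le> (Suc k * d) ^ k * (Suc k * d)"
      using Suc.IH[OF Suc.prems] by (rule mult_right_mono) simp
    finally show "card ?A \<le> (Suc k * d) ^ k * (Suc k * d)" .
  next
    have "card ?B \<le> (\<Sum>y\<in>{y \<in> U. E v y}. (Suc k * d) ^ k)"
    proof (rule order_trans[OF card_UN_le sum_mono])
      fix y assume "y \<in> {y \<in> U. E v y}"
      then have "card (?G y) \<le> (Suc k * d) ^ k" using Suc.IH by blast
      then show "card ((\<lambda>xs. v # xs) ` ?G y) \<le> (Suc k * d) ^ k"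
        using card_image_le[OF fin, of "\<lambda>xs. v # xs" y] by simp
    qed (use U in auto)
    also have "\<dots> = card {y \<in> U. E v y} * (Suc k * d) ^ k" by (simp only: sum_constant of_nat_id)
    also have "\<dots> \<le> d * (Suc k * d) ^ k"
      using deg[OF Suc.prems] by (rule mult_right_mono) simp
    finally show "card ?B \<le> d * (Suc k * d) ^ k" .
  qed
  also have "(Suc k * d) ^ k * (Suc k * d) + d * (Suc k * d) ^ k = (Suc k * d) ^ k * (Suc (Suc k) * d)"
    by (simp add: algebra_simps)
  also have "\<dots> \<le> (Suc (Suc k) * d) ^ k * (Suc (Suc k) * d)"
    by (intro mult_right_mono power_mono) auto
  also have "\<dots> = (Suc (Suc k) * d) ^ Suc k" by (simp only: power_Suc mult.commute)
  finally show ?case .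
qed

definition growing_lists :: "'a set \<Rightarrow> ('a \<Rightarrow> 'a \<Rightarrow> bool) \<Rightarrow> nat \<Rightarrow> 'a list set" where
  "growing_lists U E K = {xs. grow U E xs \<and> length xs \<le> K}"

lemma finite_growing_lists: "finite U \<Longrightarrow> finite (growing_lists U E K)"
  unfolding growing_lists_def by (rule finite_grow)

lemma card_growing_lists_containing:
  assumes U: "finite U" and sym: "\<And>x y. E x y \<Longrightarrow> E y x"
    and deg: "\<And>y. y \<in> U \<Longrightarrow> card {u \<in> U. E y u} \<le> d" and v: "v \<in> U" and d: "d > 0"
  shows "card {xs \<in> growing_lists U E K. v \<in> set xs} \<le> K * (K * d) ^ K"
proof -
  have "{xs \<in> growing_lists U E K. v \<in> set xs} \<subseteq>
    (\<Union>k<K. {xs. grow U E xs \<and> length xs = Suc k \<and> v \<in> set xs})"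
  proof
    fix xs assume "xs \<in> {xs \<in> growing_lists U E K. v \<in> set xs}"
    then show "xs \<in> (\<Union>k<K. {xs. grow U E xs \<and> length xs = Suc k \<and> v \<in> set xs})"
      by (cases xs) (auto simp: growing_lists_def)
  qed
  then have "card {xs \<in> growing_lists U E K. v \<in> set xs} \<le>
      card (\<Union>k<K. {xs. grow U E xs \<and> length xs = Suc k \<and> v \<in> set xs})"
    by (intro card_mono finite_UN_I finite_grow U) auto
  also have "\<dots> \<le> (\<Sum>k<K. (K * d) ^ K)"
  proof (rule order_trans[OF card_UN_le sum_mono])
    fix k assume k: "k \<in> {..<K}"
    have "card {xs. grow U E xs \<and> length xs = Suc k \<and> v \<in> set xs} \<le> (Suc k * d) ^ k"
      by (rule card_grow_containing[OF U sym deg v])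
    also have "\<dots> \<le> (K * d) ^ k" using k by (intro power_mono mult_right_mono) auto
    also have "\<dots> \<le> (K * d) ^ K" using k d by (intro power_increasing) auto
    finally show "card {xs. grow U E xs \<and> length xs = Suc k \<and> v \<in> set xs} \<le> (K * d) ^ K" .
  qed simp
  finally show ?thesis by simp
qed

lemma card_growing_lists:
  assumes U: "finite U" and sym: "\<And>x y. E x y \<Longrightarrow> E y x"
    and deg: "\<And>y. y \<in> U \<Longrightarrow> card {u \<in> U. E y u} \<le> d" and d: "d > 0"
  shows "card (growing_lists U E K) \<le> card U * (K * (K * d) ^ K)"
proof -
  have "growing_lists U E K \<subseteq> (\<Union>v\<in>U. {xs \<in> growing_lists U E K. v \<in> set xs})"
  proof
    fix xs assume xs: "xs \<in> growing_lists U E K"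
    then have "hd xs \<in> set xs" "set xs \<subseteq> U"
      by (cases xs, auto simp: growing_lists_def dest!: grow_subset)+
    then show "xs \<in> (\<Union>v\<in>U. {xs \<in> growing_lists U E K. v \<in> set xs})" using xs by auto
  qed
  then have "card (growing_lists U E K) \<le> card (\<Union>v\<in>U. {xs \<in> growing_lists U E K. v \<in> set xs})"
    by (intro card_mono) (auto simp: U finite_growing_lists)
  also have "\<dots> \<le> (\<Sum>v\<in>U. K * (K * d) ^ K)"
    by (rule order_trans[OF card_UN_le[OF U] sum_mono])
       (rule card_growing_lists_containing[OF U sym deg _ d])
  finally show ?thesis by simp
qed

text \<open>If only the head lies in T, symmetry and closure carry membership to its neighbour in
  the tail, so the induction hypothesis applies to the tail in any case; closure then brings the
  head back in.\<close>

lemma grow_closed_absorb: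
  assumes "grow U E xs" "\<And>x y. E x y \<Longrightarrow> E y x"
    and "\<And>y u. y \<in> T \<Longrightarrow> u \<in> U \<Longrightarrow> E y u \<Longrightarrow> u \<in> T" and "set xs \<inter> T \<noteq> {}"
  shows "set xs \<subseteq> T"
  using assms(1,4)
proof (induction xs)
  case Nil then show ?case by simp
next
  case (Cons u xs)
  show ?case
  proof (cases "xs = []")
    case True
    then show ?thesis using Cons.prems by auto
  next
    case False
    then obtain y where g: "grow U E xs" and u: "u \<in> U" and y: "y \<in> set xs" "E y u"
      using Cons.prems(1) by (auto simp: grow_Cons)
    have "y \<in> U" using grow_subset[OF g] y by auto
    have "set xs \<inter> T \<noteq> {}"
      using Cons.prems(2) assms(2)[OF y(2)] assms(3)[OF _ \<open>y \<in> U\<close>] y by auto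
    then have "set xs \<subseteq> T" using Cons.IH g by blast
    then show ?thesis using assms(3)[OF _ u y(2)] y by auto
  qed
qed

text \<open>The blocks are the connected components of E. Lengths are bounded, since a list longer
  than K + 1 has a growing suffix of the forbidden length K + 1; hence every vertex lies in a
  growing list of maximal length, which cannot be extended and so is closed.\<close>

lemma grow_partition:
  assumes U: "finite U" and sym: "\<And>x y. E x y \<Longrightarrow> E y x"
    and short: "\<And>xs. grow U E xs \<Longrightarrow> length xs \<noteq> Suc K"
  obtains P where "\<And>S. S \<in> P \<Longrightarrow> \<exists>xs. grow U E xs \<and> length xs \<le> K \<and> set xs = S"
    and "\<Union>P = U" and "disjoint P"
    and "\<And>S y u. S \<in> P \<Longrightarrow> y \<in> S \<Longrightarrow> u \<in> U \<Longrightarrow> E y u \<Longrightarrow> u \<in> S"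
proof -
  have len: "length xs \<le> K" if "grow U E xs" for xs
  proof (rule ccontr)
    assume "\<not> length xs \<le> K"
    then have l: "length (drop (length xs - Suc K) xs) = Suc K" by simp
    then have "grow U E (drop (length xs - Suc K) xs)"
      using that grow_suffix[of U E "take (length xs - Suc K) xs" "drop (length xs - Suc K) xs"]
      by (metis append_take_drop_id length_0_conv nat.distinct(1))
    then show False using short l by blast
  qed
  define P where "P = {set xs | xs. grow U E xs \<and> (\<forall>y\<in>set xs. \<forall>u\<in>U. E y u \<longrightarrow> u \<in> set xs)}"
  show thesis
  proof
    show "\<exists>xs. grow U E xs \<and> length xs \<le> K \<and> set xs = S" if "S \<in> P" for S
      using that len unfolding P_def by blast
    show "u \<in> S" if "S \<in> P" "y \<in> S" "u \<in> U" "E y u" for S y u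
      using that unfolding P_def by blast
    show "disjoint P"
      unfolding disjoint_def
    proof (intro ballI impI)
      fix S T assume S: "S \<in> P" and T: "T \<in> P" and "S \<noteq> T"
      show "S \<inter> T = {}"
      proof (rule ccontr)
        assume ne: "S \<inter> T \<noteq> {}"
        have sub: "S \<subseteq> T" if "S \<in> P" "T \<in> P" "S \<inter> T \<noteq> {}" for S T
        proof -
          from that obtain xs where "grow U E xs" "S = set xs" unfolding P_def by blast
          moreover have "u \<in> T" if "y \<in> T" "u \<in> U" "E y u" for y u
            using that \<open>T \<in> P\<close> unfolding P_def by blast
          ultimately show ?thesis using grow_closed_absorb[of U E xs T] sym that(3) by blast
        qed
        from sub[OF S T ne] sub[OF T S] ne have "S = T" by blast
        then show False using \<open>S \<noteq> T\<close> by simp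
      qed
    qed
    show "\<Union>P = U"
    proof
      show "\<Union>P \<subseteq> U" unfolding P_def using grow_subset by fastforce
      show "U \<subseteq> \<Union>P"
      proof
        fix v assume v: "v \<in> U"
        let ?Q = "\<lambda>xs. grow U E xs \<and> v \<in> set xs"
        have q1: "?Q [v]" using v by simp
        have q2: "\<forall>xs. ?Q xs \<longrightarrow> length xs < Suc K" using len by (simp add: less_Suc_eq_le)
        from ex_has_greatest_nat[of ?Q "[v]" length "Suc K", OF q1 q2]
        obtain xs where xs: "?Q xs" and max: "\<forall>ys. ?Q ys \<longrightarrow> length ys \<le> length xs"
          by blast
        have "u \<in> set xs" if "y \<in> set xs" "u \<in> U" "E y u" for y u
        proof (rule ccontr)
          assume "u \<notin> set xs"
          then have "?Q (u # xs)" using xs that by (auto simp: grow_Cons)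
          then show False using max by fastforce
        qed
        then have "set xs \<in> P" unfolding P_def using xs by blast
        then show "v \<in> \<Union>P" using xs by blast
      qed
    qed
  qed
qed

section \<open>Block decompositions and bounds for quadratic forms\<close>

lemma sqn_partition:
  assumes U: "finite U" "\<Union>P = U" and P: "disjoint P"
  shows "sqn U f = (\<Sum>S\<in>P. sqn S f)"
proof -
  have fin: "\<forall>S\<in>P. finite S" using U by (meson Union_upper finite_subset)
  have dj: "\<forall>A\<in>P. \<forall>B\<in>P. A \<noteq> B \<longrightarrow> A \<inter> B = {}" using P by (simp add: disjoint_def)
  have "(\<Sum>i\<in>\<Union>P. (f i)\<^sup>2) = (\<Sum>S\<in>P. \<Sum>i\<in>S. (f i)\<^sup>2)"
    using sum.Union_disjoint[OF fin dj] by (simp only: comp_def)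
  then show ?thesis by (simp only: sqn_def U(2))
qed

lemma qform_partition:
  assumes U: "finite U" "\<Union>P = U" and P: "disjoint P"
    and block: "\<And>S i j. S \<in> P \<Longrightarrow> i \<in> S \<Longrightarrow> j \<in> U \<Longrightarrow> x i j \<noteq> 0 \<Longrightarrow> j \<in> S"
  shows "qform U x f = (\<Sum>S\<in>P. qform S x f)"
proof -
  have fin: "\<forall>S\<in>P. finite S" using U by (meson Union_upper finite_subset)
  have dj: "\<forall>A\<in>P. \<forall>B\<in>P. A \<noteq> B \<longrightarrow> A \<inter> B = {}" using P by (simp add: disjoint_def)
  have "(\<Sum>i\<in>\<Union>P. \<Sum>j\<in>U. x i j * f i * f j) = (\<Sum>S\<in>P. \<Sum>i\<in>S. \<Sum>j\<in>U. x i j * f i * f j)"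
    using sum.Union_disjoint[OF fin dj] by (simp only: comp_def)
  also have "\<dots> = (\<Sum>S\<in>P. qform S x f)"
    unfolding qform_def
  proof (rule sum.cong[OF refl], rule sum.cong[OF refl])
    fix S i assume "S \<in> P" "i \<in> S"
    then have "S \<subseteq> U" "\<forall>j\<in>U - S. x i j * f i * f j = 0" using U(2) block by auto
    then show "(\<Sum>j\<in>U. x i j * f i * f j) = (\<Sum>j\<in>S. x i j * f i * f j)"
      using U(1) by (intro sum.mono_neutral_right)
  qed
  finally show ?thesis by (simp only: qform_def U(2))
qed

text \<open>By 2 * \<bar>f i * f j\<bar> \<le> (f i)^2 + (f j)^2 every entry is charged half to each
  endpoint, and each vertex is charged by at most d neighbours. This is the crude bound for all
  weights treated as errors.\<close>

lemma qform_le_degree: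
  assumes S: "finite S" and sym: "\<And>i j. E i j \<Longrightarrow> E j i"
    and deg: "\<And>i. i \<in> S \<Longrightarrow> card {j \<in> S. E i j} \<le> d" and c: "0 \<le> c"
    and x: "\<And>i j. i \<in> S \<Longrightarrow> j \<in> S \<Longrightarrow> \<bar>x i j\<bar> \<le> (if E i j then c else 0)"
  shows "qform S x f \<le> d * c * sqn S f"
proof -
  have half: "(\<Sum>i\<in>S. \<Sum>j\<in>S. if E i j then c * (f i)\<^sup>2 / 2 else 0) \<le> d * c * sqn S f / 2"
  proof -
    have "(\<Sum>i\<in>S. \<Sum>j\<in>S. if E i j then c * (f i)\<^sup>2 / 2 else 0) =
      (\<Sum>i\<in>S. card {j \<in> S. E i j} * (c * (f i)\<^sup>2 / 2))"
      using S by (intro sum.cong refl) (simp add: sum.If_cases Int_def)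
    also have "\<dots> \<le> (\<Sum>i\<in>S. d * (c * (f i)\<^sup>2 / 2))"
      using deg c by (intro sum_mono mult_right_mono) auto
    also have "\<dots> = d * c * sqn S f / 2"
      by (simp add: sqn_def sum_distrib_left sum_divide_distrib algebra_simps)
    finally show ?thesis .
  qed
  have "qform S x f \<le> (\<Sum>i\<in>S. \<Sum>j\<in>S. (if E i j then c * (f i)\<^sup>2 / 2 else 0) +
      (if E j i then c * (f j)\<^sup>2 / 2 else 0))"
    unfolding qform_def
  proof (intro sum_mono)
    fix i j assume ij: "i \<in> S" "j \<in> S"
    have "x i j * f i * f j \<le> \<bar>x i j\<bar> * (\<bar>f i\<bar> * \<bar>f j\<bar>)"
      by (metis abs_ge_self abs_mult mult.assoc)
    also have "\<bar>f i\<bar> * \<bar>f j\<bar> \<le> (f i)\<^sup>2 / 2 + (f j)\<^sup>2 / 2"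
      using sum_squares_bound[of "\<bar>f i\<bar>" "\<bar>f j\<bar>"] by simp
    then have "\<bar>x i j\<bar> * (\<bar>f i\<bar> * \<bar>f j\<bar>) \<le> \<bar>x i j\<bar> * ((f i)\<^sup>2 / 2 + (f j)\<^sup>2 / 2)"
      by (intro mult_left_mono) auto
    also have "\<dots> \<le> (if E i j then c else 0) * ((f i)\<^sup>2 / 2 + (f j)\<^sup>2 / 2)"
      using x[OF ij] by (intro mult_right_mono) auto
    also have "\<dots> = (if E i j then c * (f i)\<^sup>2 / 2 else 0) + (if E j i then c * (f j)\<^sup>2 / 2 else 0)"
      using sym[of i j] sym[of j i] by (auto simp: algebra_simps)
    finally show "x i j * f i * f j \<le> (if E i j then c * (f i)\<^sup>2 / 2 else 0) + (if E j i then c * (f j)\<^sup>2 / 2 else 0)" .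
  qed
  also have "\<dots> = (\<Sum>i\<in>S. \<Sum>j\<in>S. if E i j then c * (f i)\<^sup>2 / 2 else 0) +
      (\<Sum>j\<in>S. \<Sum>i\<in>S. if E j i then c * (f j)\<^sup>2 / 2 else 0)"
    by (simp add: sum.distrib) (rule sum.swap)
  also have "\<dots> \<le> d * c * sqn S f / 2 + d * c * sqn S f / 2"
    by (intro add_mono half)
  also have "\<dots> = d * c * sqn S f" by (rule field_sum_of_halves)
  finally show ?thesis .
qed

text \<open>Adjacent vertices have disjoint neighbourhoods, so \<open>y i + y j \<le> s\<close>
  along every edge. Averaging this with weights x i * x j gives 2 * (sum of x i * (y i)^2) \<le> s *
  q, and Cauchy-Schwarz bounds the left side from below by 2 * q^2 / s.\<close>

lemma triangle_free_weighted_mantel: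
  fixes x :: "'a \<Rightarrow> real"
  assumes S: "finite S" and x: "\<And>i. i \<in> S \<Longrightarrow> 0 \<le> x i" and sym: "\<And>i j. E i j \<Longrightarrow> E j i"
    and tf: "\<And>i j k. i \<in> S \<Longrightarrow> j \<in> S \<Longrightarrow> k \<in> S \<Longrightarrow> E i j \<Longrightarrow> E j k \<Longrightarrow> E i k \<Longrightarrow> False"
  shows "(\<Sum>i\<in>S. \<Sum>j\<in>S. if E i j then x i * x j else 0) \<le> (\<Sum>i\<in>S. x i)\<^sup>2 / 2"
proof -
  define s where "s = (\<Sum>i\<in>S. x i)"
  define y where "y i = (\<Sum>j\<in>S. if E i j then x j else 0)" for i
  define q where "q = (\<Sum>i\<in>S. x i * y i)"
  have s0: "0 \<le> s" unfolding s_def using x by (intro sum_nonneg) auto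
  have y0: "0 \<le> y i" for i unfolding y_def using x by (intro sum_nonneg) auto
  have q0: "0 \<le> q" unfolding q_def using x y0 by (intro sum_nonneg) auto
  have q_eq: "q = (\<Sum>i\<in>S. \<Sum>j\<in>S. if E i j then x i * x j else 0)"
    unfolding q_def y_def by (auto simp: sum_distrib_left intro!: sum.cong)
  have disj: "y i + y j \<le> s" if "i \<in> S" "j \<in> S" "E i j" for i j
  proof -
    have "y i + y j = (\<Sum>k\<in>S. (if E i k then x k else 0) + (if E j k then x k else 0))"
      by (simp add: y_def sum.distrib)
    also have "\<dots> \<le> (\<Sum>k\<in>S. x k)"
      using tf[OF that(1,2) _ that(3)] x by (intro sum_mono) auto
    finally show ?thesis by (simp add: s_def)
  qed
  have "2 * (\<Sum>i\<in>S. x i * (y i)\<^sup>2) =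
    (\<Sum>i\<in>S. \<Sum>j\<in>S. if E i j then x i * x j * y i else 0) + (\<Sum>i\<in>S. \<Sum>j\<in>S. if E i j then x i * x j * y j else 0)"
  proof -
    have 1: "(\<Sum>i\<in>S. \<Sum>j\<in>S. if E i j then x i * x j * y i else 0) = (\<Sum>i\<in>S. x i * (y i)\<^sup>2)"
    proof (intro sum.cong refl)
      fix i
      have "x i * (y i)\<^sup>2 = (\<Sum>j\<in>S. (if E i j then x j else 0)) * (x i * y i)"
        by (simp add: y_def power2_eq_square)
      then show "(\<Sum>j\<in>S. if E i j then x i * x j * y i else 0) = x i * (y i)\<^sup>2"
        by (auto simp: sum_distrib_right intro!: sum.cong)
    qed
    have "(\<Sum>i\<in>S. \<Sum>j\<in>S. if E i j then x i * x j * y j else 0) =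
        (\<Sum>j\<in>S. \<Sum>i\<in>S. if E i j then x i * x j * y j else 0)" by (rule sum.swap)
    also have "\<dots> = (\<Sum>i\<in>S. \<Sum>j\<in>S. if E i j then x i * x j * y i else 0)"
      using sym by (intro sum.cong refl) (auto simp: mult.commute)
    finally show ?thesis using 1 by simp
  qed
  also have "\<dots> = (\<Sum>i\<in>S. \<Sum>j\<in>S. if E i j then x i * x j * (y i + y j) else 0)"
    by (simp only: sum.distrib[symmetric]) (intro sum.cong refl, simp add: algebra_simps)
  also have "\<dots> \<le> (\<Sum>i\<in>S. \<Sum>j\<in>S. if E i j then x i * x j * s else 0)"
    using disj x by (intro sum_mono) (auto intro!: mult_left_mono)
  also have "\<dots> = s * q"
    unfolding q_eq by (auto simp: sum_distrib_left intro!: sum.cong)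
  finally have a: "2 * (\<Sum>i\<in>S. x i * (y i)\<^sup>2) \<le> s * q" .
  have "q\<^sup>2 = (\<Sum>i\<in>S. sqrt (x i) * (sqrt (x i) * y i))\<^sup>2"
    unfolding q_def using x by (intro arg_cong[of _ _ "\<lambda>t. t\<^sup>2"] sum.cong) (auto simp flip: mult.assoc)
  also have "\<dots> \<le> (\<Sum>i\<in>S. (sqrt (x i))\<^sup>2) * (\<Sum>i\<in>S. (sqrt (x i) * y i)\<^sup>2)"
    by (rule Cauchy_Schwarz_ineq_sum)
  also have "\<dots> = s * (\<Sum>i\<in>S. x i * (y i)\<^sup>2)"
    unfolding s_def using x by (simp add: power_mult_distrib)
  finally have "2 * q\<^sup>2 \<le> s * (2 * (\<Sum>i\<in>S. x i * (y i)\<^sup>2))" by simp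
  also have "\<dots> \<le> s * (s * q)" using a s0 by (rule mult_left_mono)
  finally have "q * (2 * q) \<le> q * s\<^sup>2" by (simp add: power2_eq_square algebra_simps)
  then have "q \<le> s\<^sup>2 / 2"
    using q0 by (cases "q = 0") (auto simp: mult_le_cancel_left_pos)
  then show ?thesis by (simp add: q_eq s_def)
qed

text \<open>Cauchy-Schwarz separates the entries from the products f i * f j; the squares of the
  latter form the Mantel sum with weights (f i)^2. The double sum counts each edge twice, so after
  halving the bound is the l2 norm of the edge weights.\<close>

lemma qform_le_triangle_free:
  assumes S: "finite S" and sym: "\<And>i j. E i j \<Longrightarrow> E j i"
    and tf: "\<And>i j k. i \<in> S \<Longrightarrow> j \<in> S \<Longrightarrow> k \<in> S \<Longrightarrow> E i j \<Longrightarrow> E j k \<Longrightarrow> E i k \<Longrightarrow> False"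
    and x: "\<And>i j. i \<in> S \<Longrightarrow> j \<in> S \<Longrightarrow> \<not> E i j \<Longrightarrow> x i j = 0"
  shows "qform S x f \<le> sqrt ((\<Sum>i\<in>S. \<Sum>j\<in>S. (x i j)\<^sup>2) / 2) * sqn S f"
proof -
  have "qform S x f = (\<Sum>(i,j)\<in>S \<times> S. x i j * (if E i j then f i * f j else 0))"
    unfolding qform_def sum.cartesian_product using x by (intro sum.cong) (auto simp: mult.assoc)
  then have "(qform S x f)\<^sup>2 = (\<Sum>p\<in>S \<times> S. x (fst p) (snd p) * (if E (fst p) (snd p) then f (fst p) * f (snd p) else 0))\<^sup>2"
    by (simp add: case_prod_beta)
  also have "\<dots> \<le> (\<Sum>p\<in>S \<times> S. (x (fst p) (snd p))\<^sup>2) *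
      (\<Sum>p\<in>S \<times> S. (if E (fst p) (snd p) then f (fst p) * f (snd p) else 0)\<^sup>2)"
    by (rule Cauchy_Schwarz_ineq_sum)
  also have "(\<Sum>p\<in>S \<times> S. (if E (fst p) (snd p) then f (fst p) * f (snd p) else 0)\<^sup>2) =
      (\<Sum>i\<in>S. \<Sum>j\<in>S. if E i j then (f i)\<^sup>2 * (f j)\<^sup>2 else 0)"
    unfolding sum.cartesian_product by (intro sum.cong) (auto simp: power_mult_distrib)
  also have "(\<Sum>p\<in>S \<times> S. (x (fst p) (snd p))\<^sup>2) = (\<Sum>i\<in>S. \<Sum>j\<in>S. (x i j)\<^sup>2)"
    unfolding sum.cartesian_product by (simp add: case_prod_beta)
  also have "(\<Sum>i\<in>S. \<Sum>j\<in>S. (x i j)\<^sup>2) * (\<Sum>i\<in>S. \<Sum>j\<in>S. if E i j then (f i)\<^sup>2 * (f j)\<^sup>2 else 0) \<le>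
      (\<Sum>i\<in>S. \<Sum>j\<in>S. (x i j)\<^sup>2) * ((sqn S f)\<^sup>2 / 2)"
    unfolding sqn_def using S sym tf
    by (intro mult_left_mono triangle_free_weighted_mantel) (auto intro!: sum_nonneg)
  also have "\<dots> = (\<Sum>i\<in>S. \<Sum>j\<in>S. (x i j)\<^sup>2) / 2 * (sqn S f)\<^sup>2" by simp
  finally have "qform S x f \<le> sqrt ((\<Sum>i\<in>S. \<Sum>j\<in>S. (x i j)\<^sup>2) / 2 * (sqn S f)\<^sup>2)"
    by (rule real_le_rsqrt)
  also have "\<dots> = sqrt ((\<Sum>i\<in>S. \<Sum>j\<in>S. (x i j)\<^sup>2) / 2) * sqn S f"
    using sqn_nonneg[of S f] by (simp only: real_sqrt_mult real_sqrt_abs abs_of_nonneg)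
  finally show ?thesis .
qed

section \<open>Triangles in random regular graphs\<close>

text \<open>Ordered triples, so each triangle counts six times; the pair (u, v) of outer vertices is
  the edge that the switching removes.\<close>

definition triangles :: "real mat \<Rightarrow> (nat \<times> nat \<times> nat) set" where
  "triangles A = {(u, w, v). u < dim_row A \<and> w < dim_row A \<and> v < dim_row A \<and>
     A $$ (u, w) = 1 \<and> A $$ (w, v) = 1 \<and> A $$ (u, v) = 1}"

definition nbrs :: "real mat \<Rightarrow> nat \<Rightarrow> nat set" where
  "nbrs A i = {j. j < dim_row A \<and> A $$ (i, j) = 1}"

text \<open>Comparing the unordered sets \<open>{i, j}\<close> keeps the result symmetric by
  construction.\<close>

definition switch :: "nat \<Rightarrow> nat \<Rightarrow> nat \<Rightarrow> nat \<Rightarrow> real mat \<Rightarrow> real mat" where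
  "switch u v x y A = mat (dim_row A) (dim_row A) (\<lambda>(i, j).
     if {i, j} = {u, v} \<or> {i, j} = {x, y} then 0
     else if {i, j} = {u, x} \<or> {i, j} = {v, y} then 1 else A $$ (i, j))"

lemma regular_adjacencyD:
  assumes "A \<in> regular_adjacency d n"
  shows "A \<in> carrier_mat n n" "\<And>i j. i < n \<Longrightarrow> j < n \<Longrightarrow> A $$ (i, j) \<in> {0, 1}"
    "\<And>i j. i < n \<Longrightarrow> j < n \<Longrightarrow> A $$ (i, j) = A $$ (j, i)"
    "\<And>i. i < n \<Longrightarrow> A $$ (i, i) = 0" "\<And>i. i < n \<Longrightarrow> card (nbrs A i) = d"
proof -
  show c: "A \<in> carrier_mat n n" using assms by (auto simp: regular_adjacency_def)
  show "A $$ (i, j) \<in> {0, 1}" if "i < n" "j < n" for i j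
    using assms that by (auto simp: regular_adjacency_def)
  show "A $$ (i, j) = A $$ (j, i)" if "i < n" "j < n" for i j
  proof -
    have "transpose_mat A = A" using assms by (auto simp: regular_adjacency_def)
    then have "A $$ (i, j) = transpose_mat A $$ (i, j)" by simp
    also have "\<dots> = A $$ (j, i)" using c that by auto
    finally show ?thesis .
  qed
  show "A $$ (i, i) = 0" if "i < n" for i using assms that by (auto simp: regular_adjacency_def)
  show "card (nbrs A i) = d" if "i < n" for i
    using assms c that by (auto simp: regular_adjacency_def nbrs_def)
qed

lemma finite_regular_adjacency: "finite (regular_adjacency d n)"
proof (rule finite_subset)
  show "regular_adjacency d n \<subseteq> mat n n ` (({..<n} \<times> {..<n}) \<rightarrow>\<^sub>E {0, 1})"
  proof
    fix A assume A: "A \<in> regular_adjacency d n"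
    have "A = mat n n (restrict (($$) A) ({..<n} \<times> {..<n}))"
      using regular_adjacencyD(1)[OF A] by (intro eq_matI) auto
    moreover have "restrict (($$) A) ({..<n} \<times> {..<n}) \<in> ({..<n} \<times> {..<n}) \<rightarrow>\<^sub>E {0, 1}"
      using regular_adjacencyD(2)[OF A] by (auto simp: PiE_iff)
    ultimately show "A \<in> mat n n ` (({..<n} \<times> {..<n}) \<rightarrow>\<^sub>E {0, 1})" by blast
  qed
qed (intro finite_imageI finite_PiE, auto)

lemma card_replace: "finite N \<Longrightarrow> a \<in> N \<Longrightarrow> b \<notin> N \<Longrightarrow> card (insert b (N - {a})) = card N"
  by (metis Diff_iff card.remove card_insert_disjoint finite_Diff)

text \<open>Each of u, v, x, y loses exactly one neighbour and gains exactly one; the gain is new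
  because ux and vy are not edges before.\<close>

lemma switch_regular:
  assumes A: "A \<in> regular_adjacency d n"
    and lt: "u < n" "v < n" "x < n" "y < n"
    and dist: "u \<noteq> v" "x \<noteq> y" "x \<noteq> u" "x \<noteq> v" "y \<noteq> u" "y \<noteq> v"
    and e: "A $$ (u, v) = 1" "A $$ (x, y) = 1" "A $$ (u, x) \<noteq> 1" "A $$ (v, y) \<noteq> 1"
  shows "switch u v x y A \<in> regular_adjacency d n"
proof -
  note [[linarith_neq_limit = 0]]
  note R = regular_adjacencyD[OF A]
  define B where "B = switch u v x y A"
  have dimA: "dim_row A = n" using R(1) by auto
  have B: "B $$ (i, j) = (if {i, j} = {u, v} \<or> {i, j} = {x, y} then 0
     else if {i, j} = {u, x} \<or> {i, j} = {v, y} then 1 else A $$ (i, j))" if "i < n" "j < n" for i j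
    using that by (simp add: B_def switch_def dimA)
  have c: "B \<in> carrier_mat n n" by (simp add: B_def switch_def dimA)
  have sym: "A $$ (v, u) = 1" "A $$ (y, x) = 1" "A $$ (x, u) \<noteq> 1" "A $$ (y, v) \<noteq> 1"
    using e R(3) lt by metis+
  have nb: "nbrs B i =
     (if i = u then insert x (nbrs A u - {v}) else if i = v then insert y (nbrs A v - {u})
      else if i = x then insert u (nbrs A x - {y}) else if i = y then insert v (nbrs A y - {x})
      else nbrs A i)" if "i < n" for i
  proof -
    have mem: "j \<in> nbrs B i \<longleftrightarrow> j < n \<and> \<not> ({i, j} = {u, v} \<or> {i, j} = {x, y}) \<and>
      ({i, j} = {u, x} \<or> {i, j} = {v, y} \<or> A $$ (i, j) = 1)" for j
    proof (cases "j < n")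
      case True
      then show ?thesis using c B[OF that True] by (simp add: nbrs_def)
    qed (use c in \<open>simp add: nbrs_def\<close>)
    have memA: "j \<in> nbrs A i \<longleftrightarrow> j < n \<and> A $$ (i, j) = 1" for i j
      by (simp add: nbrs_def dimA)
    note ne = dist dist[symmetric]
    have "nbrs B i = insert x (nbrs A u - {v})" if i: "i = u"
    proof -
      have "j \<in> nbrs B i \<longleftrightarrow> j \<in> insert x (nbrs A u - {v})" for j
        unfolding mem unfolding i using ne lt by (cases "j = x"; cases "j = v"; simp add: memA doubleton_eq_iff)
      then show ?thesis by blast
    qed
    moreover
    have "nbrs B i = insert y (nbrs A v - {u})" if i: "i = v"
    proof -
      have "j \<in> nbrs B i \<longleftrightarrow> j \<in> insert y (nbrs A v - {u})" for j
        unfolding mem unfolding i using ne lt by (cases "j = y"; cases "j = u"; simp add: memA doubleton_eq_iff)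
      then show ?thesis by blast
    qed
    moreover
    have "nbrs B i = insert u (nbrs A x - {y})" if i: "i = x"
    proof -
      have "j \<in> nbrs B i \<longleftrightarrow> j \<in> insert u (nbrs A x - {y})" for j
        unfolding mem unfolding i using ne lt by (cases "j = u"; cases "j = y"; simp add: memA doubleton_eq_iff)
      then show ?thesis by blast
    qed
    moreover
    have "nbrs B i = insert v (nbrs A y - {x})" if i: "i = y"
    proof -
      have "j \<in> nbrs B i \<longleftrightarrow> j \<in> insert v (nbrs A y - {x})" for j
        unfolding mem unfolding i using ne lt by (cases "j = v"; cases "j = x"; simp add: memA doubleton_eq_iff)
      then show ?thesis by blast
    qed
    moreover have "nbrs B i = nbrs A i" if "i \<noteq> u" "i \<noteq> v" "i \<noteq> x" "i \<noteq> y"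
    proof -
      have "j \<in> nbrs B i \<longleftrightarrow> j \<in> nbrs A i" for j
        unfolding mem using that by (simp add: memA doubleton_eq_iff)
      then show ?thesis by blast
    qed
    ultimately show ?thesis by presburger
  qed
  have fin: "finite (nbrs A i)" for i by (simp add: nbrs_def)
  have "card (nbrs B i) = d" if "i < n" for i
  proof -
    have "card (insert x (nbrs A u - {v})) = d" "card (insert y (nbrs A v - {u})) = d"
      "card (insert u (nbrs A x - {y})) = d" "card (insert v (nbrs A y - {x})) = d"
      using e sym lt R(5) fin by ((subst card_replace, auto simp: nbrs_def dimA)[])+
    then show ?thesis using nb[OF that] R(5)[OF that] by (simp split: if_splits)
  qed
  then have deg: "card {j. j < n \<and> B $$ (i, j) = 1} = d" if "i < n" for i
    using that c by (simp add: nbrs_def)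
  have "transpose_mat B = B"
  proof (rule eq_matI)
    fix i j assume "i < dim_row B" "j < dim_col B"
    then have ij: "i < n" "j < n" using c by auto
    then show "transpose_mat B $$ (i, j) = B $$ (i, j)"
      using c B[OF ij] B[OF ij(2,1)] R(3)[OF ij] by (simp add: insert_commute)
  qed (use c in auto)
  moreover have "B $$ (i, j) \<in> {0, 1}" if "i < n" "j < n" for i j
    using B[OF that] R(2)[OF that] by auto
  moreover have "B $$ (i, i) = 0" if "i < n" for i
    using B[OF that that] R(4)[OF that] dist by (auto simp: doubleton_eq_iff)
  ultimately show ?thesis using c deg by (simp add: regular_adjacency_def flip: B_def)
qed

text \<open>A switch alters only four pairs, and at these the entries before the switch are
  prescribed by the hypotheses.\<close>

lemma switch_inj:
  assumes A: "A \<in> regular_adjacency d n" "A' \<in> regular_adjacency d n"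
    and eq: "switch u v x y A = switch u v x y A'"
    and lt: "u < n" "v < n" "x < n" "y < n"
    and e: "A $$ (u, v) = 1" "A $$ (x, y) = 1" "A $$ (u, x) \<noteq> 1" "A $$ (v, y) \<noteq> 1"
    and e': "A' $$ (u, v) = 1" "A' $$ (x, y) = 1" "A' $$ (u, x) \<noteq> 1" "A' $$ (v, y) \<noteq> 1"
  shows "A = A'"
proof (rule eq_matI)
  note R = regular_adjacencyD[OF A(1)] and R' = regular_adjacencyD[OF A(2)]
  show "dim_row A = dim_row A'" "dim_col A = dim_col A'" using R R' by auto
  fix i j assume "i < dim_row A'" "j < dim_col A'"
  then have ij: "i < n" "j < n" using R' by auto
  have zero: "A $$ (u, x) = 0" "A $$ (v, y) = 0" "A' $$ (u, x) = 0" "A' $$ (v, y) = 0"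
    using e e' R(2)[OF lt(1,3)] R(2)[OF lt(2,4)] R'(2)[OF lt(1,3)] R'(2)[OF lt(2,4)] by auto
  have eq': "switch u v x y A $$ (i, j) = switch u v x y A' $$ (i, j)" using eq by simp
  have "{i, j} = {u, v} \<or> {i, j} = {x, y} \<or> {i, j} = {u, x} \<or> {i, j} = {v, y} \<or> A $$ (i, j) = A' $$ (i, j)"
  proof (cases "{i, j} = {u, v} \<or> {i, j} = {x, y} \<or> {i, j} = {u, x} \<or> {i, j} = {v, y}")
    case False
    have "dim_row A = n" "dim_row A' = n" using R(1) R'(1) by auto
    with eq' False ij show ?thesis by (simp add: switch_def)
  qed blast
  moreover have "A $$ (i, j) = A' $$ (i, j)"
    if ab: "a < n" "b < n" "A $$ (a, b) = A' $$ (a, b)" and eq: "{i, j} = {a, b}" for a b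
  proof -
    have "i = a \<and> j = b \<or> i = b \<and> j = a" using eq by (simp add: doubleton_eq_iff)
    then show ?thesis
      using ab(3) R(3)[OF ab(1,2)] R'(3)[OF ab(1,2)] by (elim disjE conjE) simp_all
  qed
  moreover have "A $$ (u, v) = A' $$ (u, v)" "A $$ (x, y) = A' $$ (x, y)"
    "A $$ (u, x) = A' $$ (u, x)" "A $$ (v, y) = A' $$ (v, y)" using e e' zero by simp_all
  ultimately show "A $$ (i, j) = A' $$ (i, j)"
    using lt by blast
qed

text \<open>Switching the edges \<open>uv\<close>, \<open>xy\<close> to \<open>ux\<close>, \<open>vy\<close> turns a triangle \<open>uwv\<close> and a further edge \<open>xy\<close>
  into the path \<open>x-u-w-v-y\<close>. There are about \<open>n * d\<close> choices of \<open>xy\<close>, but only \<open>n * d ^ 4\<close> such paths.\<close>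

lemma sum_card_triangles_aux:
  "(\<Sum>A\<in>regular_adjacency d n. card (triangles A)) * (n * d - 2 * (d * (d + 2))) \<le>
     card (regular_adjacency d n) * (n * d ^ 4)"
proof -
  let ?R = "regular_adjacency d n"
  define Q where "Q A u v = {(x, y). x < n \<and> y < n \<and> A $$ (x, y) = 1 \<and> x \<noteq> u \<and> x \<noteq> v \<and> y \<noteq> u \<and> y \<noteq> v \<and>
    A $$ (u, x) \<noteq> 1 \<and> A $$ (v, y) \<noteq> 1}" for A :: "real mat" and u v
  define D where "D = (SIGMA A:?R. SIGMA (u, w, v):triangles A. Q A u v)"
  define P where "P = (SIGMA A:?R. SIGMA u:{..<n}. SIGMA w:nbrs A u. SIGMA v:nbrs A w. nbrs A u \<times> nbrs A v)"
  define \<Phi> where "\<Phi> = (\<lambda>(A, (u, w, v), (x, y)). (switch u v x y A, u, w :: nat, v, x, y))"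
  have finR: "finite ?R" by (rule finite_regular_adjacency)
  have fin_nb: "finite (nbrs A i)" for A i by (simp add: nbrs_def)
  have fin_tri: "finite (triangles A)" for A
    by (rule finite_subset[of _ "{..<dim_row A} \<times> {..<dim_row A} \<times> {..<dim_row A}"]) (auto simp: triangles_def)
  have finQ: "finite (Q A u v)" for A u v
    by (rule finite_subset[of _ "{..<n} \<times> {..<n}"]) (auto simp: Q_def)
  have cardP: "card P = card ?R * (n * d ^ 4)"
  proof -
    have "card P = (\<Sum>A\<in>?R. \<Sum>u<n. \<Sum>w\<in>nbrs A u. \<Sum>v\<in>nbrs A w. card (nbrs A u) * card (nbrs A v))"
      unfolding P_def using finR fin_nb by (simp add: card_SigmaI card_cartesian_product)
    also have "\<dots> = (\<Sum>A\<in>?R. n * d ^ 4)"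
    proof (rule sum.cong[OF refl])
      fix A assume A: "A \<in> ?R"
      have lt: "j < n" if "j \<in> nbrs A i" for i j
        using that regular_adjacencyD(1)[OF A] by (auto simp: nbrs_def)
      have "(\<Sum>u<n. \<Sum>w\<in>nbrs A u. \<Sum>v\<in>nbrs A w. card (nbrs A u) * card (nbrs A v)) =
        (\<Sum>u<n. \<Sum>w\<in>nbrs A u. \<Sum>v\<in>nbrs A w. d * d)"
        using regular_adjacencyD(5)[OF A] lt by (intro sum.cong refl) auto
      also have "\<dots> = (\<Sum>u<n. \<Sum>w\<in>nbrs A u. d * (d * d))"
        using regular_adjacencyD(5)[OF A] lt by (intro sum.cong refl) auto
      also have "\<dots> = n * d ^ 4"
        using regular_adjacencyD(5)[OF A] by (simp add: power4_eq_xxxx algebra_simps)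
      finally show "(\<Sum>u<n. \<Sum>w\<in>nbrs A u. \<Sum>v\<in>nbrs A w. card (nbrs A u) * card (nbrs A v)) = n * d ^ 4" .
    qed
    finally show ?thesis by simp
  qed
  have finP: "finite P" unfolding P_def by (intro finite_SigmaI finR fin_nb) auto
  \<comment> \<open>Of the n * d oriented edges xy only those with x in {u, v} or adjacent to u, or
    with y in {u, v} or adjacent to v, are unusable: at most (d + 2) * d of each kind.\<close>
  have cardQ: "n * d - 2 * (d * (d + 2)) \<le> card (Q A u v)"
    if A: "A \<in> ?R" and t: "(u, w, v) \<in> triangles A" for A u w v
  proof -
    note R = regular_adjacencyD[OF A]
    have dimA: "dim_row A = n" using R by auto
    have uv: "u < n" "v < n" using t by (auto simp: triangles_def dimA)
    define Ed where "Ed = (SIGMA x:{..<n}. nbrs A x)"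
    define X where "X = (SIGMA x:{u, v} \<union> nbrs A u. nbrs A x)"
    define Y where "Y = (\<lambda>(y, x). (x, y)) ` (SIGMA y:{u, v} \<union> nbrs A v. nbrs A y)"
    have lt: "j < n" if "j \<in> nbrs A i" for i j using that by (auto simp: nbrs_def dimA)
    have c2: "card (SIGMA x:{u, v} \<union> nbrs A i. nbrs A x) \<le> d * (d + 2)" if "i < n" for i
    proof -
      have "card (SIGMA x:{u, v} \<union> nbrs A i. nbrs A x) = (\<Sum>x\<in>{u, v} \<union> nbrs A i. card (nbrs A x))"
        using fin_nb by (intro card_SigmaI) auto
      also have "\<dots> = (\<Sum>x\<in>{u, v} \<union> nbrs A i. d)"
        using R(5) lt uv by (intro sum.cong refl) auto
      also have "\<dots> = card ({u, v} \<union> nbrs A i) * d" by simp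
      also have "\<dots> \<le> (2 + d) * d"
      proof (rule mult_right_mono)
        have "card ({u, v} \<union> nbrs A i) \<le> card {u, v} + card (nbrs A i)" by (rule card_Un_le)
        also have "\<dots> \<le> 2 + d" using R(5)[OF that] by (simp add: card_insert_if)
        finally show "card ({u, v} \<union> nbrs A i) \<le> 2 + d" .
      qed simp
      finally show ?thesis by (simp add: algebra_simps)
    qed
    have X: "card X \<le> d * (d + 2)" unfolding X_def using c2 uv by blast
    have Y: "card Y \<le> d * (d + 2)" unfolding Y_def
      by (rule order_trans[OF card_image_le c2[OF uv(2)]]) (use fin_nb in auto)
    have finXY: "finite X" "finite Y" unfolding X_def Y_def using fin_nb by auto
    have "card Ed = n * d" unfolding Ed_def using fin_nb R(5) by (subst card_SigmaI) auto
    have sub: "Ed \<subseteq> Q A u v \<union> X \<union> Y"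
    proof
      fix p assume "p \<in> Ed"
      then obtain x y where p: "p = (x, y)" "x < n" "y \<in> nbrs A x" by (auto simp: Ed_def)
      then have y: "y < n" "A $$ (x, y) = 1" "A $$ (y, x) = 1" "x \<in> nbrs A y"
        using R(3)[of x y] by (auto simp: nbrs_def dimA)
      show "p \<in> Q A u v \<union> X \<union> Y"
      proof (cases "x \<in> {u, v} \<union> nbrs A u \<or> y \<in> {u, v} \<union> nbrs A v")
        case True
        then show ?thesis
        proof
          assume "x \<in> {u, v} \<union> nbrs A u"
          then have "p \<in> X" using p by (auto simp: X_def)
          then show ?thesis by simp
        next
          assume "y \<in> {u, v} \<union> nbrs A v"
          then have "(y, x) \<in> (SIGMA y:{u, v} \<union> nbrs A v. nbrs A y)" using y by auto
          then have "p \<in> Y" unfolding Y_def p(1) by (rule image_eqI[rotated]) simp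
          then show ?thesis by simp
        qed
      next
        case False
        then have "p \<in> Q A u v" using p y by (auto simp: Q_def nbrs_def dimA)
        then show ?thesis by simp
      qed
    qed
    have "card Ed \<le> card (Q A u v \<union> X \<union> Y)" by (rule card_mono[OF _ sub]) (use finQ finXY in auto)
    also have "\<dots> \<le> card (Q A u v) + card X + card Y"
      using card_Un_le[of "Q A u v \<union> X" Y] card_Un_le[of "Q A u v" X] by linarith
    finally show ?thesis using X Y \<open>card Ed = n * d\<close> by linarith
  qed
  have "(\<Sum>A\<in>?R. card (triangles A)) * (n * d - 2 * (d * (d + 2))) \<le> card D"
  proof -
    have "card D = (\<Sum>A\<in>?R. \<Sum>t\<in>triangles A. card (case t of (u, w, v) \<Rightarrow> Q A u v))"
      unfolding D_def using finR fin_tri finQ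
      by (subst card_SigmaI) (auto intro!: sum.cong card_SigmaI finite_SigmaI split: prod.splits)
    also have "\<dots> \<ge> (\<Sum>A\<in>?R. \<Sum>t\<in>triangles A. n * d - 2 * (d * (d + 2)))"
      by (intro sum_mono) (use cardQ in \<open>auto split: prod.splits\<close>)
    finally show ?thesis by (simp add: sum_distrib_right)
  qed
  \<comment> \<open>The five vertices are kept in the image, so injectivity reduces to that of the
    switch at fixed vertices.\<close>
  also have "card D \<le> card P"
  proof (rule card_inj_on_le[of \<Phi>])
    show "finite P" by (rule finP)
    show "inj_on \<Phi> D"
    proof (rule inj_onI)
      fix p q assume p: "p \<in> D" and q: "q \<in> D" and eq: "\<Phi> p = \<Phi> q"
      obtain A u w v x y where p': "p = (A, (u, w, v), (x, y))" by (metis surj_pair)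
      obtain A' where q': "q = (A', (u, w, v), (x, y))"
        using eq by (cases q) (auto simp: p' \<Phi>_def split: prod.splits)
      have A: "A \<in> ?R" "A' \<in> ?R" using p q by (auto simp: p' q' D_def)
      have d: "dim_row A = n" "dim_row A' = n" using regular_adjacencyD(1) A by blast+
      have "A = A'"
        by (rule switch_inj[of A d n A' u v x y])
          (use p q eq A d in \<open>auto simp: p' q' \<Phi>_def D_def Q_def triangles_def\<close>)
      then show "p = q" by (simp add: p' q')
    qed
    show "\<Phi> ` D \<subseteq> P"
    proof
      fix q assume "q \<in> \<Phi> ` D"
      then obtain A u w v x y where q: "q = (switch u v x y A, u, w, v, x, y)" and A: "A \<in> ?R"
        and t: "(u, w, v) \<in> triangles A" and xy: "(x, y) \<in> Q A u v"
        by (auto simp: \<Phi>_def D_def)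
      note [[linarith_neq_limit = 0]]
      note R = regular_adjacencyD[OF A]
      have dimA: "dim_row A = n" using R by auto
      have lt: "u < n" "w < n" "v < n" "x < n" "y < n"
        and e: "A $$ (u, w) = 1" "A $$ (w, v) = 1" "A $$ (u, v) = 1" "A $$ (x, y) = 1"
        and ne: "x \<noteq> u" "x \<noteq> v" "y \<noteq> u" "y \<noteq> v" "A $$ (u, x) \<noteq> 1" "A $$ (v, y) \<noteq> 1"
        using t xy by (auto simp: triangles_def Q_def dimA)
      have ne2: "u \<noteq> v" "u \<noteq> w" "w \<noteq> v" "x \<noteq> y"
        using e R(4) lt by (metis zero_neq_one)+
      have "switch u v x y A \<in> ?R"
        by (rule switch_regular[OF A]) (use lt ne ne2 e in auto)
      moreover have "w \<in> nbrs (switch u v x y A) u" "v \<in> nbrs (switch u v x y A) w"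
        "x \<in> nbrs (switch u v x y A) u" "y \<in> nbrs (switch u v x y A) v"
        unfolding nbrs_def switch_def using dimA lt ne ne2 e by (auto simp: doubleton_eq_iff)
      ultimately show "q \<in> P" using q lt by (auto simp: P_def)
    qed
  qed
  finally show ?thesis using cardP by simp
qed

text \<open>For n \<ge> 4 * (d + 2) the unusable edges are at most half of all, so the average
  number of triangles is bounded independently of n.\<close>

lemma sum_card_triangles_le:
  assumes "n \<ge> 4 * (d + 2)" "d > 0"
  shows "(\<Sum>A\<in>regular_adjacency d n. card (triangles A)) \<le> 2 * d ^ 3 * card (regular_adjacency d n)"
proof -
  let ?s = "\<Sum>A\<in>regular_adjacency d n. card (triangles A)"
  let ?r = "card (regular_adjacency d n)"
  have "4 * (d + 2) * d \<le> n * d" using assms by (intro mult_right_mono) auto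
  then have "n * d \<le> 2 * (n * d - 2 * (d * (d + 2)))" by (simp add: algebra_simps)
  then have "?s * (n * d) \<le> ?s * (2 * (n * d - 2 * (d * (d + 2))))" by (intro mult_left_mono) auto
  also have "\<dots> \<le> 2 * (?r * (n * d ^ 4))"
    using sum_card_triangles_aux[of d n] by simp
  also have "\<dots> = (2 * d ^ 3 * ?r) * (n * d)" by (simp add: power4_eq_xxxx power3_eq_cube algebra_simps)
  finally show ?thesis using assms by simp
qed

section \<open>Measurability of localization\<close>

text \<open>Test vectors indexed by the countable type \<open>rat list\<close>, padded with zeros,
  so that quantifiers over them preserve measurability.\<close>

definition ratvec :: "rat list \<Rightarrow> nat \<Rightarrow> real" where
  "ratvec r i = (if i < length r then of_rat (r ! i) else 0)"

lemma ratvec_dense: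
  "\<exists>R. \<forall>i<n. (\<lambda>k. ratvec (R k) i) \<longlonglongrightarrow> f i"
proof -
  have "\<exists>q. \<bar>real_of_rat q - f i\<bar> < 1 / real (Suc k)" for k i
  proof -
    have "f i < f i + 1 / real (Suc k)" by simp
    from of_rat_dense[OF this] obtain q where "f i < real_of_rat q" "real_of_rat q < f i + 1 / real (Suc k)"
      by blast
    then have "\<bar>real_of_rat q - f i\<bar> < 1 / real (Suc k)" unfolding abs_less_iff by linarith
    then show ?thesis by blast
  qed
  then obtain Q where Q: "\<And>k i. \<bar>real_of_rat (Q k i) - f i\<bar> < 1 / real (Suc k)"
    by (rule that[OF someI_ex])
  have "(\<lambda>k. ratvec (map (Q k) [0..<n]) i) \<longlonglongrightarrow> f i" if "i < n" for i
  proof -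
    have "(\<lambda>k. real_of_rat (Q k i) - f i) \<longlonglongrightarrow> 0"
      by (rule Lim_null_comparison[OF _ LIMSEQ_Suc[OF lim_1_over_n]])
         (use Q less_imp_le in \<open>auto intro!: always_eventually\<close>)
    then have "(\<lambda>k. real_of_rat (Q k i)) \<longlonglongrightarrow> f i" by (simp add: LIM_zero_iff)
    then show ?thesis using that by (simp add: ratvec_def)
  qed
  then show ?thesis by (intro exI[of _ "\<lambda>k. map (Q k) [0..<n]"]) auto
qed

lemma ratvec_map_abs: "ratvec (map abs r) i = \<bar>ratvec r i\<bar>"
  unfolding ratvec_def by (auto simp: abs_if of_rat_minus)

lemma rayleigh_max_scale:
  assumes "rayleigh_max n x f" shows "rayleigh_max n x (\<lambda>i. a * f i)"
  unfolding rayleigh_max_def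
proof
  fix g
  have "a\<^sup>2 * (qform {..<n} x g * sqn {..<n} f) \<le> a\<^sup>2 * (qform {..<n} x f * sqn {..<n} g)"
    using assms unfolding rayleigh_max_def by (intro mult_left_mono) auto
  then show "qform {..<n} x g * sqn {..<n} (\<lambda>i. a * f i) \<le> qform {..<n} x (\<lambda>i. a * f i) * sqn {..<n} g"
    by (simp add: qform_scale sqn_scale algebra_simps)
qed

text \<open>A real maximizer is approximated by rational vectors that are nearly normalized and
  nearly maximal, with slack 1 / (m + 1); conversely compactness gives a limit of such vectors. The
  strict inequalities survive the limit only because of the gap 1 / (k + 1), which is chosen before
  m; finiteness of \<I> provides one gap for all its members.\<close>

lemma ex_bad_maximizer_iff:
  assumes \<I>: "finite \<I>" "\<And>I. I \<in> \<I> \<Longrightarrow> I \<subseteq> {..<n}"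
  shows "(\<exists>f. rayleigh_max n x f \<and> sqn {..<n} f > 0 \<and>
      (\<forall>I\<in>\<I>. sqrt (sqn I f) < c * sqrt (sqn {..<n} f))) \<longleftrightarrow>
    (\<exists>k::nat. \<forall>m::nat. \<exists>r::rat list. \<bar>sqn {..<n} (ratvec r) - 1\<bar> < 1 / real (Suc m) \<and>
      (\<forall>s::rat list. qform {..<n} x (ratvec s) * sqn {..<n} (ratvec r) \<le>
         (qform {..<n} x (ratvec r) + 1 / real (Suc m)) * sqn {..<n} (ratvec s)) \<and>
      (\<forall>I\<in>\<I>. sqrt (sqn I (ratvec r)) < c - 1 / real (Suc k) + 1 / real (Suc m)))"
    (is "?L \<longleftrightarrow> (\<exists>k. \<forall>m. \<exists>r. ?A m r \<and> ?B m r \<and> ?C k m r)")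
proof
  assume ?L
  then obtain f where f: "rayleigh_max n x f" "sqn {..<n} f > 0"
    "\<And>I. I \<in> \<I> \<Longrightarrow> sqrt (sqn I f) < c * sqrt (sqn {..<n} f)" by blast
  define a where "a = 1 / sqrt (sqn {..<n} f)"
  define g where "g = (\<lambda>i. a * f i)"
  have a: "a > 0" "a\<^sup>2 = 1 / sqn {..<n} f" using f(2) by (auto simp: a_def power_divide)
  have g1: "sqn {..<n} g = 1" using f(2) by (simp add: g_def sqn_scale a)
  have gm: "rayleigh_max n x g" unfolding g_def by (rule rayleigh_max_scale[OF f(1)])
  have gI: "sqrt (sqn I g) < c" if "I \<in> \<I>" for I
  proof -
    have "sqrt (sqn I g) = a * sqrt (sqn I f)"
      using a(1) by (simp add: g_def sqn_scale real_sqrt_mult)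
    also have "\<dots> < a * (c * sqrt (sqn {..<n} f))" using f(3)[OF that] a(1) by simp
    also have "\<dots> = c" using f(2) by (simp add: a_def)
    finally show ?thesis .
  qed
  have "\<forall>\<^sub>F k in sequentially. \<forall>I\<in>\<I>. 1 / real (Suc k) < c - sqrt (sqn I g)"
  proof (intro eventually_ball_finite \<I>(1) ballI)
    fix I assume "I \<in> \<I>"
    then have "0 < c - sqrt (sqn I g)" using gI by simp
    with LIMSEQ_Suc[OF lim_1_over_n[where 'a=real]]
    show "\<forall>\<^sub>F k in sequentially. 1 / real (Suc k) < c - sqrt (sqn I g)"
      by (rule order_tendstoD)
  qed
  from eventually_happens'[OF sequentially_bot this]
  obtain k where k': "\<forall>I\<in>\<I>. 1 / real (Suc k) < c - sqrt (sqn I g)" by (rule exE)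
  have k: "sqrt (sqn I g) < c - 1 / real (Suc k)" if "I \<in> \<I>" for I
    using bspec[OF k' that] by linarith
  obtain R where R: "\<forall>i<n. (\<lambda>k. ratvec (R k) i) \<longlonglongrightarrow> g i"
    using ratvec_dense by blast
  define lam where "lam = qform {..<n} x g"
  have lam: "qform {..<n} x h \<le> lam * sqn {..<n} h" for h
    using gm g1 unfolding rayleigh_max_def lam_def by (metis mult.right_neutral)
  have tq: "(\<lambda>k. qform {..<n} x (ratvec (R k))) \<longlonglongrightarrow> lam"
    unfolding lam_def by (intro tendsto_qform) (use R in auto)
  have ts: "(\<lambda>k. sqn {..<n} (ratvec (R k))) \<longlonglongrightarrow> 1"
    unfolding g1[symmetric] by (intro tendsto_sqn) (use R in auto)
  have tI: "(\<lambda>k. sqrt (sqn I (ratvec (R k)))) \<longlonglongrightarrow> sqrt (sqn I g)" if "I \<in> \<I>" for I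
    by (intro tendsto_real_sqrt tendsto_sqn) (use R \<I>(2)[OF that] in auto)
  have "\<exists>r. ?A m r \<and> ?B m r \<and> ?C k m r" for m
  proof -
    have pos: "0 < 1 / real (Suc m)" by simp
    have "(\<lambda>k. \<bar>sqn {..<n} (ratvec (R k)) - 1\<bar>) \<longlonglongrightarrow> \<bar>1 - 1\<bar>" by (intro tendsto_intros ts)
    then have "(\<lambda>k. \<bar>sqn {..<n} (ratvec (R k)) - 1\<bar>) \<longlonglongrightarrow> 0" by simp
    then have e1: "\<forall>\<^sub>F j in sequentially. \<bar>sqn {..<n} (ratvec (R j)) - 1\<bar> < 1 / real (Suc m)"
      using pos by (rule order_tendstoD)
    have "(\<lambda>k. lam * sqn {..<n} (ratvec (R k)) - qform {..<n} x (ratvec (R k))) \<longlonglongrightarrow> lam * 1 - lam"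
      by (intro tendsto_intros ts tq)
    then have "(\<lambda>k. lam * sqn {..<n} (ratvec (R k)) - qform {..<n} x (ratvec (R k))) \<longlonglongrightarrow> 0" by simp
    then have e2: "\<forall>\<^sub>F j in sequentially. lam * sqn {..<n} (ratvec (R j)) - qform {..<n} x (ratvec (R j)) < 1 / real (Suc m)"
      using pos by (rule order_tendstoD)
    have e3: "\<forall>\<^sub>F j in sequentially. \<forall>I\<in>\<I>. sqrt (sqn I (ratvec (R j))) < c - 1 / real (Suc k) + 1 / real (Suc m)"
    proof (intro eventually_ball_finite \<I>(1) ballI)
      fix I assume I: "I \<in> \<I>"
      have "sqrt (sqn I g) < c - 1 / real (Suc k) + 1 / real (Suc m)" using k[OF I] pos by linarith
      with tI[OF I] show "\<forall>\<^sub>F j in sequentially. sqrt (sqn I (ratvec (R j))) < c - 1 / real (Suc k) + 1 / real (Suc m)"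
        by (rule order_tendstoD)
    qed
    obtain j where j: "\<bar>sqn {..<n} (ratvec (R j)) - 1\<bar> < 1 / real (Suc m)"
      "lam * sqn {..<n} (ratvec (R j)) - qform {..<n} x (ratvec (R j)) < 1 / real (Suc m)"
      "\<forall>I\<in>\<I>. sqrt (sqn I (ratvec (R j))) < c - 1 / real (Suc k) + 1 / real (Suc m)"
      using eventually_happens[OF eventually_conj[OF e1 eventually_conj[OF e2 e3]]] by auto
    have "?B m (R j)"
    proof
      fix s
      have "qform {..<n} x (ratvec s) * sqn {..<n} (ratvec (R j)) \<le>
          lam * sqn {..<n} (ratvec s) * sqn {..<n} (ratvec (R j))"
        by (intro mult_right_mono lam sqn_nonneg)
      also have "\<dots> = (lam * sqn {..<n} (ratvec (R j))) * sqn {..<n} (ratvec s)" by simp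
      also have "\<dots> \<le> (qform {..<n} x (ratvec (R j)) + 1 / real (Suc m)) * sqn {..<n} (ratvec s)"
        using j(2) by (intro mult_right_mono sqn_nonneg) linarith
      finally show "qform {..<n} x (ratvec s) * sqn {..<n} (ratvec (R j)) \<le>
         (qform {..<n} x (ratvec (R j)) + 1 / real (Suc m)) * sqn {..<n} (ratvec s)" .
    qed
    then show ?thesis using j(1,3) by blast
  qed
  then show "\<exists>k. \<forall>m. \<exists>r. ?A m r \<and> ?B m r \<and> ?C k m r" by blast
next
  assume "\<exists>k. \<forall>m. \<exists>r. ?A m r \<and> ?B m r \<and> ?C k m r"
  then obtain k where "\<forall>m. \<exists>r. ?A m r \<and> ?B m r \<and> ?C k m r" by (rule exE)
  then have "\<exists>r. \<forall>m. ?A m (r m) \<and> ?B m (r m) \<and> ?C k m (r m)" by (rule choice)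
  then obtain r where r: "\<forall>m. ?A m (r m) \<and> ?B m (r m) \<and> ?C k m (r m)" by (rule exE)
  have A: "?A m (r m)" and B: "?B m (r m)" and C: "?C k m (r m)" for m using r by blast+
  have "\<bar>ratvec (r m) i\<bar> \<le> 2" if "i < n" for m i
  proof -
    have "1 / real (Suc m) \<le> 1" by simp
    with A[of m] have "\<bar>sqn {..<n} (ratvec (r m)) - 1\<bar> < 1" by (rule order_less_le_trans)
    then have "sqn {..<n} (ratvec (r m)) \<le> 2\<^sup>2" by simp
    then have "sqrt (sqn {..<n} (ratvec (r m))) \<le> 2" by (rule real_le_lsqrt[OF _ , rotated]) auto
    then show ?thesis using abs_le_sqrt_sqn[of "{..<n}" i "ratvec (r m)"] that by simp
  qed
  then obtain q l where q: "strict_mono (q :: nat \<Rightarrow> nat)" and l: "\<forall>i<n. (\<lambda>m. ratvec (r (q m)) i) \<longlonglongrightarrow> l i"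
    using bounded_functions_convergent_subseq[of n "\<lambda>m. ratvec (r m)" 2] by blast
  have inv0: "(\<lambda>m. 1 / real (Suc (q m))) \<longlonglongrightarrow> 0"
    using LIMSEQ_subseq_LIMSEQ[OF LIMSEQ_Suc[OF lim_1_over_n[where 'a=real]] q] by (simp add: o_def)
  have tq: "(\<lambda>m. qform {..<n} x (ratvec (r (q m)))) \<longlonglongrightarrow> qform {..<n} x l"
    by (intro tendsto_qform) (use l in auto)
  have ts: "(\<lambda>m. sqn {..<n} (ratvec (r (q m)))) \<longlonglongrightarrow> sqn {..<n} l"
    by (intro tendsto_sqn) (use l in auto)
  have "(\<lambda>m. sqn {..<n} (ratvec (r (q m))) - 1) \<longlonglongrightarrow> 0"
    by (rule Lim_null_comparison[OF _ inv0]) (use A less_imp_le in \<open>auto intro!: always_eventually\<close>)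
  then have "(\<lambda>m. sqn {..<n} (ratvec (r (q m)))) \<longlonglongrightarrow> 1" by (simp add: LIM_zero_iff)
  with ts have l1: "sqn {..<n} l = 1" by (rule LIMSEQ_unique)
  have rat: "qform {..<n} x (ratvec s) \<le> qform {..<n} x l * sqn {..<n} (ratvec s)" for s
  proof -
    have t1: "(\<lambda>m. (qform {..<n} x (ratvec (r (q m))) + 1 / real (Suc (q m))) * sqn {..<n} (ratvec s))
        \<longlonglongrightarrow> (qform {..<n} x l + 0) * sqn {..<n} (ratvec s)"
      by (intro tendsto_intros tq inv0)
    have t2: "(\<lambda>m. qform {..<n} x (ratvec s) * sqn {..<n} (ratvec (r (q m)))) \<longlonglongrightarrow>
        qform {..<n} x (ratvec s) * 1" unfolding l1[symmetric] by (intro tendsto_intros ts)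
    have "qform {..<n} x (ratvec s) * 1 \<le> (qform {..<n} x l + 0) * sqn {..<n} (ratvec s)"
      by (rule LIMSEQ_le[OF t2 t1]) (use B in blast)
    then show ?thesis by simp
  qed
  have "rayleigh_max n x l"
  proof (rule rayleigh_max_unitI[OF l1])
    fix g assume g: "sqn {..<n} g = 1"
    obtain R where R: "\<forall>i<n. (\<lambda>k. ratvec (R k) i) \<longlonglongrightarrow> g i" using ratvec_dense by blast
    have "(\<lambda>k. qform {..<n} x (ratvec (R k))) \<longlonglongrightarrow> qform {..<n} x g"
      by (intro tendsto_qform) (use R in auto)
    moreover have "(\<lambda>k. qform {..<n} x l * sqn {..<n} (ratvec (R k))) \<longlonglongrightarrow> qform {..<n} x l * sqn {..<n} g"
      by (intro tendsto_intros tendsto_sqn) (use R in auto)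
    ultimately have "qform {..<n} x g \<le> qform {..<n} x l * sqn {..<n} g"
      by (rule LIMSEQ_le) (use rat in blast)
    then show "qform {..<n} x g \<le> qform {..<n} x l" using g by simp
  qed
  moreover have "sqrt (sqn I l) < c" if I: "I \<in> \<I>" for I
  proof -
    have "(\<lambda>m. sqrt (sqn I (ratvec (r (q m))))) \<longlonglongrightarrow> sqrt (sqn I l)"
      by (intro tendsto_real_sqrt tendsto_sqn) (use l \<I>(2)[OF I] in auto)
    moreover have "(\<lambda>m. c - 1 / real (Suc k) + 1 / real (Suc (q m))) \<longlonglongrightarrow> c - 1 / real (Suc k) + 0"
      by (intro tendsto_intros inv0)
    ultimately have "sqrt (sqn I l) \<le> c - 1 / real (Suc k) + 0"
      by (rule LIMSEQ_le) (use C I less_imp_le in blast)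
    then show ?thesis by (smt (verit) divide_pos_pos of_nat_0_less_iff zero_less_Suc)
  qed
  ultimately show ?L using l1 by (intro exI[of _ l]) auto
qed

text \<open>The complement is described by the preceding equivalence with countable quantifiers over
  conditions measurable in the entries.\<close>

lemma sets_maximizers_localized:
  assumes x: "\<And>i j. i < n \<Longrightarrow> j < n \<Longrightarrow> (\<lambda>\<omega>. x \<omega> i j) \<in> borel_measurable (N :: 'a measure)"
    and \<I>: "finite \<I>" "\<And>I. I \<in> \<I> \<Longrightarrow> I \<subseteq> {..<n}"
  shows "{\<omega> \<in> space N. \<forall>f. rayleigh_max n (x \<omega>) f \<and> sqn {..<n} f > 0 \<longrightarrow>
     (\<exists>I\<in>\<I>. c * sqrt (sqn {..<n} f) \<le> sqrt (sqn I f))} \<in> sets N"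
proof -
  have compl: "S - {\<omega> \<in> S. P \<omega>} = {\<omega> \<in> S. \<not> P \<omega>}" for S :: "'a set" and P by auto
  have q: "(\<lambda>\<omega>. qform {..<n} (x \<omega>) f) \<in> borel_measurable N" for f
    unfolding qform_def using x by (intro borel_measurable_sum borel_measurable_times) auto
  have "{\<omega> \<in> space N. \<exists>k::nat. \<forall>m::nat. \<exists>r::rat list. \<bar>sqn {..<n} (ratvec r) - 1\<bar> < 1 / real (Suc m) \<and>
      (\<forall>s::rat list. qform {..<n} (x \<omega>) (ratvec s) * sqn {..<n} (ratvec r) \<le>
         (qform {..<n} (x \<omega>) (ratvec r) + 1 / real (Suc m)) * sqn {..<n} (ratvec s)) \<and>
      (\<forall>I\<in>\<I>. sqrt (sqn I (ratvec r)) < c - 1 / real (Suc k) + 1 / real (Suc m))} \<in> sets N"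
    (is "?B \<in> _") using q by measurable
  then have a: "space N - ?B \<in> sets N" by (rule sets.compl_sets)
  have "space N - ?B = {\<omega> \<in> space N. \<not> (\<exists>f. rayleigh_max n (x \<omega>) f \<and> sqn {..<n} f > 0 \<and>
      (\<forall>I\<in>\<I>. sqrt (sqn I f) < c * sqrt (sqn {..<n} f)))}"
    by (simp only: compl ex_bad_maximizer_iff[OF \<I>])
  also have "\<dots> = {\<omega> \<in> space N. \<forall>f. rayleigh_max n (x \<omega>) f \<and> sqn {..<n} f > 0 \<longrightarrow>
     (\<exists>I\<in>\<I>. c * sqrt (sqn {..<n} f) \<le> sqrt (sqn I f))}"
    unfolding linorder_not_less[symmetric] by (intro Collect_cong) blast
  finally show ?thesis using a by (rule subst)
qed

section \<open>Independent weights on a fixed graph\<close>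

context prob_space
begin

text \<open>Chebyshev for the number of events that occur, whose mean m is the sum of their
  probabilities: only related pairs contribute to the variance, each at most
  \<open>prob (E i)\<close>, so the variance is at most D * m, while no event occurring is a
  deviation by m.\<close>

lemma prob_none_le_second_moment:
  assumes I: "finite I" and E: "\<And>i. i \<in> I \<Longrightarrow> E i \<in> events"
    and indep: "\<And>i j. i \<in> I \<Longrightarrow> j \<in> I \<Longrightarrow> \<not> R i j \<Longrightarrow> prob (E i \<inter> E j) = prob (E i) * prob (E j)"
    and R: "\<And>i. i \<in> I \<Longrightarrow> real (card {j \<in> I. R i j}) \<le> D"
    and pos: "(\<Sum>i\<in>I. prob (E i)) > 0"
  shows "prob {\<omega> \<in> space M. \<forall>i\<in>I. \<omega> \<notin> E i} \<le> D / (\<Sum>i\<in>I. prob (E i))"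
proof -
  define m where "m = (\<Sum>i\<in>I. prob (E i))"
  define X where "X \<omega> = (\<Sum>i\<in>I. indicator (E i) \<omega> :: real)" for \<omega>
  have int: "integrable M (indicator (E i) :: _ \<Rightarrow> real)" if "i \<in> I" for i
    using E[OF that] by (intro integrable_real_indicator) (auto simp: emeasure_eq_measure)
  have X2: "(X \<omega>)\<^sup>2 = (\<Sum>i\<in>I. \<Sum>j\<in>I. indicator (E i \<inter> E j) \<omega>)" for \<omega>
    unfolding X_def power2_eq_square sum_product by (simp add: indicator_inter_arith)
  have intX: "integrable M X" unfolding X_def using int by (intro Bochner_Integration.integrable_sum)
  have int2: "integrable M (indicator (E i \<inter> E j) :: _ \<Rightarrow> real)" if "i \<in> I" "j \<in> I" for i j
    using E that by (intro integrable_real_indicator sets.Int) (auto simp: emeasure_eq_measure)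
  have intX2: "integrable M (\<lambda>\<omega>. (X \<omega>)\<^sup>2)"
    unfolding X2 using int2 by (intro Bochner_Integration.integrable_sum)
  have ei: "expectation (indicator A) = prob A" if "A \<in> events" for A
    using sets.sets_into_space[OF that] by (simp add: Int_absorb2)
  have EX: "expectation X = m"
    unfolding X_def by (subst Bochner_Integration.integral_sum[OF int]) (simp_all add: m_def ei E)
  have "expectation (\<lambda>\<omega>. (X \<omega>)\<^sup>2) = (\<Sum>i\<in>I. \<Sum>j\<in>I. expectation (indicator (E i \<inter> E j)))"
    unfolding X2 using int2
    by (subst Bochner_Integration.integral_sum, intro Bochner_Integration.integrable_sum, blast,
        intro sum.cong refl Bochner_Integration.integral_sum, blast)
  also have "\<dots> = (\<Sum>i\<in>I. \<Sum>j\<in>I. prob (E i \<inter> E j))"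
    using E by (intro sum.cong refl ei) auto
  also have "\<dots> \<le> (\<Sum>i\<in>I. \<Sum>j\<in>I. prob (E i) * prob (E j) + (if R i j then prob (E i) else 0))"
  proof (intro sum_mono)
    fix i j assume ij: "i \<in> I" "j \<in> I"
    have "prob (E i \<inter> E j) \<le> prob (E i)" using E ij by (intro finite_measure_mono) auto
    then show "prob (E i \<inter> E j) \<le> prob (E i) * prob (E j) + (if R i j then prob (E i) else 0)"
      using indep[OF ij] by (auto intro: order_trans add_increasing)
  qed
  also have "\<dots> = m\<^sup>2 + (\<Sum>i\<in>I. real (card {j \<in> I. R i j}) * prob (E i))"
  proof -
    have "(\<Sum>i\<in>I. \<Sum>j\<in>I. prob (E i) * prob (E j)) = m\<^sup>2"
      by (simp add: m_def power2_eq_square sum_product)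
    moreover have "(\<Sum>j\<in>I. if R i j then prob (E i) else 0) = real (card {j \<in> I. R i j}) * prob (E i)" for i
      using I by (simp add: sum.If_cases Int_def)
    ultimately show ?thesis by (simp add: sum.distrib)
  qed
  also have "(\<Sum>i\<in>I. real (card {j \<in> I. R i j}) * prob (E i)) \<le> (\<Sum>i\<in>I. D * prob (E i))"
    using R by (intro sum_mono mult_right_mono) auto
  also have "(\<Sum>i\<in>I. D * prob (E i)) = D * m" by (simp add: m_def sum_distrib_left)
  finally have var: "variance X \<le> D * m"
    using variance_eq[OF intX intX2] EX by simp
  have mpos: "m > 0" using pos by (simp add: m_def)
  have "prob {\<omega> \<in> space M. \<forall>i\<in>I. \<omega> \<notin> E i} \<le> prob {\<omega> \<in> space M. m \<le> \<bar>X \<omega> - expectation X\<bar>}"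
  proof (rule finite_measure_mono)
    show "{\<omega> \<in> space M. \<forall>i\<in>I. \<omega> \<notin> E i} \<subseteq> {\<omega> \<in> space M. m \<le> \<bar>X \<omega> - expectation X\<bar>}"
      unfolding EX using mpos by (auto simp: X_def indicator_def)
    show "{\<omega> \<in> space M. m \<le> \<bar>X \<omega> - expectation X\<bar>} \<in> events"
      using borel_measurable_integrable[OF intX] by measurable
  qed
  also have "\<dots> \<le> variance X / m\<^sup>2"
    using borel_measurable_integrable[OF intX] intX2 mpos by (intro Chebyshev_inequality)
  also have "\<dots> \<le> D * m / m\<^sup>2" using var by (intro divide_right_mono) auto
  also have "\<dots> = D / m" using mpos by (simp add: power2_eq_square)
  finally show ?thesis by (simp add: m_def)
qed

lemma prob_card_ge_le:
  assumes I: "finite I" and E: "\<And>i. i \<in> I \<Longrightarrow> E i \<in> events" and t: "t > 0"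
  shows "prob {\<omega> \<in> space M. t \<le> real (card {i \<in> I. \<omega> \<in> E i})} \<le> (\<Sum>i\<in>I. prob (E i)) / t"
proof -
  define X where "X \<omega> = (\<Sum>i\<in>I. indicator (E i) \<omega> :: real)" for \<omega>
  have card: "real (card {i \<in> I. \<omega> \<in> E i}) = X \<omega>" for \<omega>
    unfolding X_def using I by (simp add: indicator_def sum.If_cases Int_def)
  have int: "integrable M (indicator (E i) :: _ \<Rightarrow> real)" if "i \<in> I" for i
    using E[OF that] by (intro integrable_real_indicator) (auto simp: emeasure_eq_measure)
  have intX: "integrable M X" unfolding X_def using int by (intro Bochner_Integration.integrable_sum)
  have ei: "expectation (indicator A) = prob A" if "A \<in> events" for A
    using sets.sets_into_space[OF that] by (simp add: Int_absorb2)
  have EX: "expectation X = (\<Sum>i\<in>I. prob (E i))"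
    unfolding X_def by (subst Bochner_Integration.integral_sum[OF int]) (simp_all add: ei E)
  have X0: "0 \<le> X \<omega>" for \<omega> by (simp add: X_def sum_nonneg)
  have "prob {\<omega> \<in> space M. t \<le> X \<omega>} \<le> expectation X / t"
    using intX t by (intro integral_Markov_inequality_measure[where A = "{}" and c = t])
      (auto simp: X0)
  then show ?thesis by (simp add: card EX)
qed

end

section \<open>Quadratic forms of a weighted graph and the tails of its weights\<close>

lemma nat_floor_bounds:
  fixes z :: real assumes "0 \<le> z"
  shows "real (nat \<lfloor>z\<rfloor>) \<le> z" "z < real (nat \<lfloor>z\<rfloor>) + 1"
  using assms by linarith+

text \<open>Weights are indexed with the smaller vertex first, matching the independent family above
  the diagonal.\<close>

definition sort_pair :: "nat \<Rightarrow> nat \<Rightarrow> nat \<times> nat" where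
  "sort_pair i j = (min i j, max i j)"

definition wmat :: "(nat \<Rightarrow> nat \<Rightarrow> bool) \<Rightarrow> (nat \<times> nat \<Rightarrow> real) \<Rightarrow> nat \<Rightarrow> nat \<Rightarrow> real" where
  "wmat adj v i j = (if adj i j then v (sort_pair i j) else 0)"

definition edge_pairs :: "(nat \<Rightarrow> nat \<Rightarrow> bool) \<Rightarrow> nat set \<Rightarrow> (nat \<times> nat) set" where
  "edge_pairs adj S = {(i, j). i < j \<and> i \<in> S \<and> j \<in> S \<and> adj i j}"

text \<open>Rational test vectors suffice by density, and make this event measurable in the weights.\<close>

definition high :: "(nat \<Rightarrow> nat \<Rightarrow> bool) \<Rightarrow> nat set \<Rightarrow> real \<Rightarrow> (nat \<times> nat \<Rightarrow> real) \<Rightarrow> bool" where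
  "high adj S y v \<longleftrightarrow> (\<exists>r::rat list. y * sqn S (ratvec r) < qform S (wmat adj v) (ratvec r))"

lemma not_high_qform_le:
  assumes "finite S" "S \<subseteq> {..<n}" "\<not> high adj S y v"
  shows "qform S (wmat adj v) f \<le> y * sqn S f"
proof -
  obtain R where R: "\<forall>i<n. (\<lambda>k. ratvec (R k) i) \<longlonglongrightarrow> f i" using ratvec_dense by blast
  have "(\<lambda>k. qform S (wmat adj v) (ratvec (R k))) \<longlonglongrightarrow> qform S (wmat adj v) f"
    by (intro tendsto_qform) (use R assms(2) in auto)
  moreover have "(\<lambda>k. y * sqn S (ratvec (R k))) \<longlonglongrightarrow> y * sqn S f"
    by (intro tendsto_intros tendsto_sqn) (use R assms(2) in auto)
  ultimately show ?thesis
    by (rule LIMSEQ_le) (use assms(3) in \<open>auto simp: high_def not_less\<close>)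
qed

lemma finite_edge_pairs: "finite S \<Longrightarrow> finite (edge_pairs adj S)"
  by (rule finite_subset[of _ "S \<times> S"]) (auto simp: edge_pairs_def)

lemma card_edge_pairs_le:
  assumes "finite S" shows "card (edge_pairs adj S) \<le> card S * card S"
proof -
  have "card (edge_pairs adj S) \<le> card (S \<times> S)"
    using assms by (intro card_mono) (auto simp: edge_pairs_def)
  then show ?thesis by (simp add: card_cartesian_product)
qed

lemma sort_pair_in_edge_pairs:
  assumes "\<And>i j. adj i j \<Longrightarrow> adj j i" "\<And>i. \<not> adj i i" "adj i j" "i \<in> S" "j \<in> S"
  shows "sort_pair i j \<in> edge_pairs adj S"
proof -
  have "i \<noteq> j" using assms by auto
  then show ?thesis using assms unfolding sort_pair_def edge_pairs_def by (cases "i < j") auto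
qed

lemma high_cong:
  assumes "\<And>i j. adj i j \<Longrightarrow> adj j i" "\<And>i. \<not> adj i i" "\<And>p. p \<in> edge_pairs adj S \<Longrightarrow> v p = w p"
  shows "high adj S y v \<longleftrightarrow> high adj S y w"
proof -
  have "qform S (wmat adj v) f = qform S (wmat adj w) f" for f
    unfolding qform_def wmat_def
    using sort_pair_in_edge_pairs[of adj _ _ S] assms by (intro sum.cong refl) (auto intro!: arg_cong2[where f = times])
  then show ?thesis by (simp add: high_def)
qed

text \<open>Replacing the test vector by its absolute values makes all products f i * f j
  nonnegative, so weights may be raised entrywise and their signs ignored. This is what allows
  transfer from a two-sided upper tail to a one-sided lower tail.\<close>

lemma high_mono:
  assumes adj: "\<And>i j. adj i j \<Longrightarrow> adj j i" "\<And>i. \<not> adj i i"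
    and le: "\<And>p. p \<in> edge_pairs adj S \<Longrightarrow> \<bar>v p\<bar> \<le> u p" "\<And>p. p \<in> edge_pairs adj S \<Longrightarrow> s * u p \<le> w p"
    and s: "0 < s" and high: "high adj S y v"
  shows "high adj S (s * y) w"
proof -
  obtain r :: "rat list" where r: "y * sqn S (ratvec r) < qform S (wmat adj v) (ratvec r)"
    using high by (auto simp: high_def)
  define f where "f = ratvec (map abs r)"
  have f: "f i = \<bar>ratvec r i\<bar>" for i by (simp add: f_def ratvec_map_abs)
  have "s * qform S (wmat adj v) (ratvec r) \<le> qform S (wmat adj w) f"
    unfolding qform_def sum_distrib_left
  proof (intro sum_mono)
    fix i j assume ij: "i \<in> S" "j \<in> S"
    show "s * (wmat adj v i j * ratvec r i * ratvec r j) \<le> wmat adj w i j * f i * f j"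
    proof (cases "adj i j")
      case True
      then have p: "sort_pair i j \<in> edge_pairs adj S" using sort_pair_in_edge_pairs adj ij by blast
      have "s * (v (sort_pair i j) * ratvec r i * ratvec r j) \<le> s * \<bar>v (sort_pair i j) * ratvec r i * ratvec r j\<bar>"
        using s by (intro mult_left_mono) auto
      also have "\<dots> = (s * \<bar>v (sort_pair i j)\<bar>) * (f i * f j)" by (simp add: abs_mult f)
      also have "\<dots> \<le> w (sort_pair i j) * (f i * f j)"
        using le(1)[OF p] le(2)[OF p] s
        by (intro mult_right_mono) (auto simp: f intro: order_trans[OF mult_left_mono])
      finally show ?thesis using True by (simp add: wmat_def mult.assoc)
    qed (simp add: wmat_def)
  qed
  moreover have "s * (y * sqn S (ratvec r)) < s * qform S (wmat adj v) (ratvec r)"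
    using r s by simp
  moreover have "sqn S f = sqn S (ratvec r)" by (simp add: sqn_def f)
  ultimately show ?thesis
    unfolding high_def by (intro exI[of _ "map abs r"]) (simp add: f_def[symmetric] mult.assoc)
qed

text \<open>The graph is deterministic; randomness of the graph enters only by averaging at the end.
  The upper tail is two-sided, as weights of either sign can contribute; the lower tail concerns
  large positive weights, which suffice to produce large eigenvalues.\<close>

locale weighted_graph = prob_space M
  for M :: "'a measure" +
  fixes n d :: nat and adj :: "nat \<Rightarrow> nat \<Rightarrow> bool" and V :: "nat \<times> nat \<Rightarrow> 'a \<Rightarrow> real"
    and \<alpha> C c :: real
  assumes adj_sym: "adj i j \<Longrightarrow> adj j i" and adj_irrefl: "\<not> adj i i"
    and adj_less: "adj i j \<Longrightarrow> i < n"
    and degree: "i < n \<Longrightarrow> card {j. adj i j} = d" and d_pos: "d > 0"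
    and V_indep: "indep_vars (\<lambda>_. borel) V {(i, j). i < j \<and> j < n}"
    and upper: "\<And>p z. p \<in> {(i, j). i < j \<and> j < n} \<Longrightarrow> 0 \<le> z \<Longrightarrow>
      prob {\<omega> \<in> space M. z \<le> \<bar>V p \<omega>\<bar> powr \<alpha>} \<le> C * exp (- z)"
    and lower: "\<And>p t. p \<in> {(i, j). i < j \<and> j < n} \<Longrightarrow> 1 \<le> t \<Longrightarrow>
      c * exp (- (t powr \<alpha>)) \<le> prob {\<omega> \<in> space M. t \<le> V p \<omega>}"
    and \<alpha>_pos: "\<alpha> > 0" and C_ge: "C \<ge> 1" and c_pos: "c > 0" and c_le: "c \<le> 1"
begin

definition "pairs = {(i, j). i < j \<and> j < n}"

definition "Z p \<omega> = \<bar>V p \<omega>\<bar> powr \<alpha>"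

lemma finite_pairs: "finite pairs"
  by (rule finite_subset[of _ "{..<n} \<times> {..<n}"]) (auto simp: pairs_def)

lemma V_meas [measurable]: "p \<in> pairs \<Longrightarrow> V p \<in> borel_measurable M"
  using V_indep unfolding indep_vars_def pairs_def by auto

lemma Z_meas [measurable]: "p \<in> pairs \<Longrightarrow> Z p \<in> borel_measurable M"
  unfolding Z_def using V_meas by measurable

lemma edge_pairs_subset: "S \<subseteq> {..<n} \<Longrightarrow> edge_pairs adj S \<subseteq> pairs"
  by (auto simp: edge_pairs_def pairs_def)

lemma sort_pair_in_pairs: "adj i j \<Longrightarrow> sort_pair i j \<in> pairs"
  using edge_pairs_subset[of "{..<n}"] sort_pair_in_edge_pairs[of adj i j "{..<n}"] adj_sym adj_irrefl adj_less
  by blast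

lemma high_event: "{\<omega> \<in> space M. high adj S y (\<lambda>p. V p \<omega>)} \<in> events"
proof -
  have "(\<lambda>\<omega>. wmat adj (\<lambda>p. V p \<omega>) i j) \<in> borel_measurable M" for i j
    unfolding wmat_def using V_meas[OF sort_pair_in_pairs] by (cases "adj i j") auto
  then have "(\<lambda>\<omega>. qform S (wmat adj (\<lambda>p. V p \<omega>)) f) \<in> borel_measurable M" for f
    unfolding qform_def by (intro borel_measurable_sum borel_measurable_times) auto
  then show ?thesis unfolding high_def by measurable
qed

lemma prob_joint:
  assumes "E \<subseteq> pairs" "\<And>e. e \<in> E \<Longrightarrow> B e \<in> sets borel"
  shows "prob {\<omega> \<in> space M. \<forall>e\<in>E. V e \<omega> \<in> B e} = (\<Prod>e\<in>E. prob {\<omega> \<in> space M. V e \<omega> \<in> B e})"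
proof (cases "E = {}")
  case True then show ?thesis by (simp add: prob_space)
next
  case False
  have fin: "finite E" using assms(1) finite_pairs finite_subset by blast
  have "indep_vars (\<lambda>_. borel) V E"
    using V_indep assms(1) unfolding pairs_def by (rule indep_vars_subset)
  then have "prob (\<Inter>e\<in>E. V e -` B e \<inter> space M) = (\<Prod>e\<in>E. prob (V e -` B e \<inter> space M))"
    using False fin assms(2) by (rule indep_varsD_finite)
  moreover have "(\<Inter>e\<in>E. V e -` B e \<inter> space M) = {\<omega> \<in> space M. \<forall>e\<in>E. V e \<omega> \<in> B e}"
    using False by auto
  moreover have "V e -` B e \<inter> space M = {\<omega> \<in> space M. V e \<omega> \<in> B e}" for e by auto
  ultimately show ?thesis by simp
qed

lemma prob_joint_upper:
  fixes k :: "nat \<times> nat \<Rightarrow> nat"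
  assumes "E \<subseteq> pairs"
  shows "prob {\<omega> \<in> space M. \<forall>e\<in>E. real (k e) \<le> Z e \<omega>} \<le> C ^ card E * exp (- real (\<Sum>e\<in>E. k e))"
proof -
  have fin: "finite E" using assms(1) finite_pairs finite_subset by blast
  have m: "{v. real (k e) \<le> \<bar>v\<bar> powr \<alpha>} \<in> sets borel" for e by measurable
  have "prob {\<omega> \<in> space M. \<forall>e\<in>E. real (k e) \<le> Z e \<omega>} =
    (\<Prod>e\<in>E. prob {\<omega> \<in> space M. real (k e) \<le> \<bar>V e \<omega>\<bar> powr \<alpha>})"
    using prob_joint[OF assms, of "\<lambda>e. {v. real (k e) \<le> \<bar>v\<bar> powr \<alpha>}"] m by (simp add: Z_def)
  also have "\<dots> \<le> (\<Prod>e\<in>E. C * exp (- real (k e)))"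
    using assms by (intro prod_mono) (auto simp: pairs_def intro!: upper)
  also have "\<dots> = C ^ card E * exp (- real (\<Sum>e\<in>E. k e))"
    using fin by (simp add: prod.distrib exp_sum sum_negf[symmetric])
  finally show ?thesis .
qed

lemma prob_joint_lower:
  assumes "E \<subseteq> pairs" "\<And>e. e \<in> E \<Longrightarrow> 1 \<le> t e"
  shows "c ^ card E * exp (- (\<Sum>e\<in>E. t e powr \<alpha>)) \<le> prob {\<omega> \<in> space M. \<forall>e\<in>E. t e \<le> V e \<omega>}"
proof -
  have fin: "finite E" using assms(1) finite_pairs finite_subset by blast
  have "c ^ card E * exp (- (\<Sum>e\<in>E. t e powr \<alpha>)) = (\<Prod>e\<in>E. c * exp (- (t e powr \<alpha>)))"
    using fin by (simp add: prod.distrib exp_sum sum_negf[symmetric])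
  also have "\<dots> \<le> (\<Prod>e\<in>E. prob {\<omega> \<in> space M. t e \<le> V e \<omega>})"
    using assms c_pos by (intro prod_mono) (auto simp: pairs_def intro!: lower)
  also have "\<dots> = prob {\<omega> \<in> space M. \<forall>e\<in>E. t e \<le> V e \<omega>}"
    using prob_joint[OF assms(1), of "\<lambda>e. {t e..}"] by simp
  finally show ?thesis .
qed

text \<open>Each \<open>Z e\<close> is rounded down to an integer, which loses at most 1 per edge;
  this is the m in the threshold T + m. Then a union bound over at most (T + 1)^m integer profiles
  applies, each having probability at most C^m * exp (- T).\<close>

lemma prob_cost_ge:
  assumes E: "E \<subseteq> pairs" and m: "card E \<le> m"
  shows "prob {\<omega> \<in> space M. real (T + m) \<le> (\<Sum>e\<in>E. Z e \<omega>)} \<le> (real T + 1) ^ m * C ^ m * exp (- real T)"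
proof -
  have fin: "finite E" using E finite_pairs finite_subset by blast
  define K where "K = {k \<in> E \<rightarrow>\<^sub>E {..T}. T \<le> (\<Sum>e\<in>E. k e)}"
  define B where "B k = {\<omega> \<in> space M. \<forall>e\<in>E. real (k e) \<le> Z e \<omega>}" for k :: "nat \<times> nat \<Rightarrow> nat"
  have Zm: "Z e \<in> borel_measurable M" if "e \<in> E" for e using Z_meas E that by blast
  have Bm: "B k \<in> events" for k
    unfolding B_def
  proof (rule sets.sets_Collect_finite_All[OF _ fin])
    fix e assume "e \<in> E"
    then show "{\<omega> \<in> space M. real (k e) \<le> Z e \<omega>} \<in> events"
      by (intro borel_measurable_le borel_measurable_const Zm)
  qed
  have finK: "finite K"
    unfolding K_def by (rule finite_subset[of _ "E \<rightarrow>\<^sub>E {..T}"]) (auto intro!: finite_PiE fin)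
  have sub: "{\<omega> \<in> space M. real (T + m) \<le> (\<Sum>e\<in>E. Z e \<omega>)} \<subseteq> (\<Union>k\<in>K. B k)"
  proof
    fix \<omega> assume w: "\<omega> \<in> {\<omega> \<in> space M. real (T + m) \<le> (\<Sum>e\<in>E. Z e \<omega>)}"
    \<comment> \<open>The cap at T leaves finitely many profiles; if it is reached anywhere, that
      single coordinate already makes the sum at least T.\<close>
    define k where "k = (\<lambda>e\<in>E. min T (nat \<lfloor>Z e \<omega>\<rfloor>))"
    have Z0: "0 \<le> Z e \<omega>" for e by (simp add: Z_def)
    have "T \<le> (\<Sum>e\<in>E. k e)"
    proof (cases "\<exists>e\<in>E. T \<le> nat \<lfloor>Z e \<omega>\<rfloor>")
      case True
      then obtain e where "e \<in> E" "k e = T" by (auto simp: k_def)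
      then show ?thesis using member_le_sum[of e E k] fin by auto
    next
      case False
      then have "Z e \<omega> - 1 \<le> real (k e)" if "e \<in> E" for e
        using that nat_floor_bounds[OF Z0[of e]] by (auto simp: k_def not_le min_def)
      then have "(\<Sum>e\<in>E. Z e \<omega> - 1) \<le> (\<Sum>e\<in>E. real (k e))" by (rule sum_mono)
      then have "real T \<le> real (\<Sum>e\<in>E. k e)" using w m by (simp add: sum_subtractf)
      then show ?thesis by linarith
    qed
    moreover have "k \<in> E \<rightarrow>\<^sub>E {..T}" by (auto simp: k_def)
    moreover have "real (k e) \<le> Z e \<omega>" if "e \<in> E" for e
      using that nat_floor_bounds[OF Z0[of e]] by (auto simp: k_def min_def)
    ultimately show "\<omega> \<in> (\<Union>k\<in>K. B k)" using w by (auto simp: K_def B_def)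
  qed
  have "prob {\<omega> \<in> space M. real (T + m) \<le> (\<Sum>e\<in>E. Z e \<omega>)} \<le> prob (\<Union>k\<in>K. B k)"
    by (rule finite_measure_mono[OF sub]) (use Bm finK in auto)
  also have "\<dots> \<le> (\<Sum>k\<in>K. prob (B k))"
    using finK Bm by (intro finite_measure_subadditive_finite) auto
  also have "\<dots> \<le> (\<Sum>k\<in>K. C ^ card E * exp (- real T))"
  proof (rule sum_mono)
    fix k assume k: "k \<in> K"
    have "prob (B k) \<le> C ^ card E * exp (- real (\<Sum>e\<in>E. k e))"
      unfolding B_def by (rule prob_joint_upper[OF E])
    also have "\<dots> \<le> C ^ card E * exp (- real T)"
      using k C_ge by (intro mult_left_mono) (auto simp: K_def simp del: of_nat_sum)
    finally show "prob (B k) \<le> C ^ card E * exp (- real T)" .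
  qed
  also have "\<dots> = real (card K) * (C ^ card E * exp (- real T))" by simp
  also have "\<dots> \<le> (real T + 1) ^ m * (C ^ m * exp (- real T))"
  proof (intro mult_mono)
    have "card K \<le> card (E \<rightarrow>\<^sub>E {..T})" unfolding K_def using fin by (intro card_mono finite_PiE) auto
    also have "\<dots> = (T + 1) ^ card E" using fin by (simp add: card_PiE)
    also have "\<dots> \<le> (T + 1) ^ m" using m by (intro power_increasing) auto
    finally have "real (card K) \<le> real ((T + 1) ^ m)" by linarith
    then show "real (card K) \<le> (real T + 1) ^ m" by (simp add: add.commute)
    show "C ^ card E \<le> C ^ m" using m C_ge by (intro power_increasing) auto
  qed (use C_ge in auto)
  finally show ?thesis by (simp add: mult.assoc)
qed

end

section \<open>Mass of a maximizer on blocks with a large eigenvalue\<close>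

lemma qform_restrict:
  assumes "finite U" "S \<subseteq> U"
  shows "qform U x (\<lambda>i. if i \<in> S then f i else 0) = qform S x f"
proof -
  have "qform U x (\<lambda>i. if i \<in> S then f i else 0) =
      (\<Sum>i\<in>U. if i \<in> S then \<Sum>j\<in>U. if j \<in> S then x i j * f i * f j else 0 else 0)"
    unfolding qform_def by (intro sum.cong refl) (auto intro!: sum.cong)
  then show ?thesis using assms by (simp add: qform_def sum.If_cases Int_absorb1)
qed

lemma sqn_restrict:
  assumes "finite U" "S \<subseteq> U"
  shows "sqn U (\<lambda>i. if i \<in> S then f i else 0) = sqn S f"
proof -
  have "sqn U (\<lambda>i. if i \<in> S then f i else 0) = (\<Sum>i\<in>U. if i \<in> S then (f i)\<^sup>2 else 0)"
    unfolding sqn_def by (intro sum.cong refl) auto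
  then show ?thesis using assms by (simp add: sqn_def sum.If_cases Int_absorb1)
qed

text \<open>The number lam is the top eigenvalue; testing maximality with vectors extended by zero
  bounds the form on every set of vertices.\<close>

lemma rayleigh_quotient:
  assumes "rayleigh_max n x f" "sqn {..<n} f > 0"
  obtains lam where "qform {..<n} x f = lam * sqn {..<n} f"
    and "\<And>S g. S \<subseteq> {..<n} \<Longrightarrow> qform S x g \<le> lam * sqn S g"
proof
  show "qform {..<n} x f = qform {..<n} x f / sqn {..<n} f * sqn {..<n} f" using assms by simp
  show "qform S x g \<le> qform {..<n} x f / sqn {..<n} f * sqn S g" if "S \<subseteq> {..<n}" for S g
  proof -
    have "qform {..<n} x (\<lambda>i. if i \<in> S then g i else 0) * sqn {..<n} f \<le>
        qform {..<n} x f * sqn {..<n} (\<lambda>i. if i \<in> S then g i else 0)"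
      using assms(1) unfolding rayleigh_max_def by blast
    then have "qform S x g * sqn {..<n} f \<le> qform {..<n} x f * sqn S g"
      using that by (simp only: qform_restrict[OF finite_lessThan] sqn_restrict[OF finite_lessThan])
    then show ?thesis using assms(2) by (simp add: field_simps)
  qed
qed

lemma high_le_quotient:
  assumes "high adj S y v" "\<And>g. qform S (wmat adj v) g \<le> lam * sqn S g"
  shows "y < lam"
proof -
  obtain r :: "rat list" where r: "y * sqn S (ratvec r) < qform S (wmat adj v) (ratvec r)"
    using assms(1) by (auto simp: high_def)
  then have "y * sqn S (ratvec r) < lam * sqn S (ratvec r)" using assms(2) by (rule order_less_le_trans)
  then show ?thesis using sqn_nonneg[of S "ratvec r"] by (simp add: mult_less_cancel_right)
qed

text \<open>Since (1 - \<epsilon>)^2 \<le> 1 - \<epsilon>, it suffices to bound squared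
  masses.\<close>

lemma localized_from_mass:
  fixes \<epsilon> a b :: real
  assumes "0 < \<epsilon>" "\<epsilon> < 1" "0 \<le> a" "(1 - \<epsilon>) * a \<le> b"
  shows "(1 - \<epsilon>) * sqrt a \<le> sqrt b"
proof -
  have "(1 - \<epsilon>) * sqrt a = sqrt ((1 - \<epsilon>)\<^sup>2 * a)" using assms by (simp add: real_sqrt_mult)
  also have "\<dots> \<le> sqrt ((1 - \<epsilon>) * a)"
    using assms by (intro real_sqrt_le_mono mult_right_mono) (auto simp: power2_eq_square mult_left_le)
  also have "\<dots> \<le> sqrt b" using assms(4) by (rule real_sqrt_le_mono)
  finally show ?thesis .
qed

context weighted_graph
begin

abbreviation cost :: "(nat \<times> nat \<Rightarrow> real) \<Rightarrow> nat set \<Rightarrow> real" where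
  "cost v S \<equiv> (\<Sum>e\<in>edge_pairs adj S. \<bar>v e\<bar> powr \<alpha>)"

lemma degree_within: "i < n \<Longrightarrow> finite S \<Longrightarrow> card {j \<in> S. adj i j} \<le> d"
proof -
  assume i: "i < n" and "finite S"
  have "finite {j. adj i j}"
    by (rule finite_subset[of _ "{..<n}"]) (auto dest: adj_sym adj_less)
  then have "card {j \<in> S. adj i j} \<le> card {j. adj i j}" by (intro card_mono) auto
  then show ?thesis using degree[OF i] by simp
qed

lemma degree_lessThan: "i \<in> {..<n} \<Longrightarrow> card {j \<in> {..<n}. adj i j} \<le> d"
  by (rule degree_within) auto

text \<open>Each vertex prepended to the list brings an edge of cost at least h. These edges are
  distinct because the new vertex is an endpoint; they form a spanning tree with one edge less than
  vertices.\<close>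

lemma grow_cost:
  assumes "grow {..<n} B xs" "\<And>i j. B i j \<Longrightarrow> adj i j \<and> h \<le> \<bar>v (sort_pair i j)\<bar> powr \<alpha>" "0 \<le> h"
  shows "real (length xs - 1) * h \<le> cost v (set xs)"
  using assms(1)
proof (induction xs)
  case (Cons u xs)
  show ?case
  proof (cases "xs = []")
    case True
    then show ?thesis by (simp add: sum_nonneg)
  next
    case False
    then obtain y where g: "grow {..<n} B xs" and u: "u \<notin> set xs" and y: "y \<in> set xs" "B y u"
      using Cons.prems by (auto simp: grow_Cons)
    let ?p = "sort_pair y u"
    have p: "?p \<in> edge_pairs adj (set (u # xs))"
      using sort_pair_in_edge_pairs[of adj y u "set (u # xs)"] adj_sym adj_irrefl assms(2)[OF y(2)] y(1) by auto
    have new: "?p \<notin> edge_pairs adj (set xs)"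
      using u by (auto simp: sort_pair_def edge_pairs_def min_def max_def split: if_splits)
    have "insert ?p (edge_pairs adj (set xs)) \<subseteq> edge_pairs adj (set (u # xs))"
      using p by (auto simp: edge_pairs_def)
    then have "(\<Sum>e\<in>insert ?p (edge_pairs adj (set xs)). \<bar>v e\<bar> powr \<alpha>) \<le> cost v (set (u # xs))"
      by (intro sum_mono2 finite_edge_pairs) auto
    moreover have "(\<Sum>e\<in>insert ?p (edge_pairs adj (set xs)). \<bar>v e\<bar> powr \<alpha>) =
        \<bar>v ?p\<bar> powr \<alpha> + cost v (set xs)"
      using new finite_edge_pairs[of "set xs" adj] by simp
    moreover have "real (length (u # xs) - 1) * h = real (length xs - 1) * h + h"
      using False by (cases xs) (auto simp: algebra_simps)
    ultimately show ?thesis using Cons.IH[OF g] assms(2)[OF y(2)] by simp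
  qed
qed simp

text \<open>A growing list of K + 1 vertices along heavy edges would cost at least K * h \<ge> T.
  Hence the cost bound has to cover lists one vertex longer than the blocks.\<close>

lemma block_partition:
  assumes cost: "\<And>xs. xs \<in> growing_lists {..<n} adj (Suc K) \<Longrightarrow> cost v (set xs) < T"
    and h: "0 \<le> h" "T \<le> real K * h"
  obtains P where "\<And>S. S \<in> P \<Longrightarrow> \<exists>xs\<in>growing_lists {..<n} adj K. set xs = S"
    and "\<Union>P = {..<n}" and "disjoint P"
    and "\<And>S i j. S \<in> P \<Longrightarrow> i \<in> S \<Longrightarrow> adj i j \<Longrightarrow> h \<le> \<bar>v (sort_pair i j)\<bar> powr \<alpha> \<Longrightarrow> j \<in> S"
proof -
  define B where "B i j \<longleftrightarrow> adj i j \<and> h \<le> \<bar>v (sort_pair i j)\<bar> powr \<alpha>" for i j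
  have Bsym: "B y x" if "B x y" for x y
    using that adj_sym by (auto simp: B_def sort_pair_def min.commute max.commute)
  have adjB: "grow {..<n} adj xs" if "grow {..<n} B xs" for xs
    by (rule grow_mono[OF that]) (auto simp: B_def)
  have "length xs \<noteq> Suc K" if "grow {..<n} B xs" for xs
  proof
    assume l: "length xs = Suc K"
    have "T \<le> real (length xs - 1) * h" using h l by simp
    also have "\<dots> \<le> cost v (set xs)" by (rule grow_cost[OF that _ h(1)]) (auto simp: B_def)
    also have "\<dots> < T" using adjB[OF that] l by (intro cost) (simp add: growing_lists_def)
    finally show False by simp
  qed
  note short = this
  show thesis
  proof (rule grow_partition[OF finite_lessThan Bsym short])
    fix P assume P: "\<And>S. S \<in> P \<Longrightarrow> \<exists>xs. grow {..<n} B xs \<and> length xs \<le> K \<and> set xs = S"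
      "\<Union>P = {..<n}" "disjoint P"
      "\<And>S y u. S \<in> P \<Longrightarrow> y \<in> S \<Longrightarrow> u \<in> {..<n} \<Longrightarrow> B y u \<Longrightarrow> u \<in> S"
    show thesis
    proof (rule that[of P])
      fix S assume "S \<in> P"
      from P(1)[OF this] obtain xs where "grow {..<n} B xs" "length xs \<le> K" "set xs = S" by blast
      then show "\<exists>xs\<in>growing_lists {..<n} adj K. set xs = S"
        using adjB by (intro bexI[of _ xs]) (auto simp: growing_lists_def)
    next
      show "j \<in> S" if "S \<in> P" "i \<in> S" "adj i j" "h \<le> \<bar>v (sort_pair i j)\<bar> powr \<alpha>" for S i j
        using P(4)[OF that(1,2), of j] that adj_less[OF adj_sym[OF that(3)]] by (simp add: B_def)
    qed (fact P(2,3))+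
  qed
qed

text \<open>An energy balance. The top eigenvalue lam exceeds y because one list is high at y.
  Blocks not high at z contribute at most z times their mass, the others at most lam times theirs,
  and entries between blocks are light. Mass outside the high blocks thus loses lam - z > y - z,
  against an error of at most \<epsilon> * (y - z).\<close>

lemma high_blocks_localize:
  assumes cost: "\<And>xs. xs \<in> growing_lists {..<n} adj (Suc K) \<Longrightarrow> cost v (set xs) < T"
    and h: "0 \<le> h" "T \<le> real K * h"
    and xs0: "xs0 \<in> growing_lists {..<n} adj K" "high adj (set xs0) y v"
    and y: "z < y" and small: "real d * h powr (1 / \<alpha>) \<le> \<epsilon> * (y - z)"
    and \<epsilon>: "0 < \<epsilon>" "\<epsilon> < 1"
    and f: "rayleigh_max n (wmat adj v) f" "sqn {..<n} f > 0"
  shows "(1 - \<epsilon>) * sqrt (sqn {..<n} f) \<le>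
    sqrt (sqn (\<Union>xs\<in>{xs \<in> growing_lists {..<n} adj K. high adj (set xs) z v}. set xs) f)"
proof -
  define x where "x = wmat adj v"
  define N where "N = sqn {..<n} f"
  define I where "I = (\<Union>xs\<in>{xs \<in> growing_lists {..<n} adj K. high adj (set xs) z v}. set xs)"
  define \<delta> where "\<delta> = h powr (1 / \<alpha>)"
  have N: "N > 0" using f by (simp add: N_def)
  obtain P where P: "\<And>S. S \<in> P \<Longrightarrow> \<exists>xs\<in>growing_lists {..<n} adj K. set xs = S"
    "\<Union>P = {..<n}" "disjoint P"
    "\<And>S i j. S \<in> P \<Longrightarrow> i \<in> S \<Longrightarrow> adj i j \<Longrightarrow> h \<le> \<bar>v (sort_pair i j)\<bar> powr \<alpha> \<Longrightarrow> j \<in> S"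
    using block_partition[OF cost h] by blast
  obtain lam where lam: "qform {..<n} x f = lam * N"
    and lam_le: "\<And>S g. S \<subseteq> {..<n} \<Longrightarrow> qform S x g \<le> lam * sqn S g"
    using rayleigh_quotient[OF f] unfolding x_def N_def by blast
  have "set xs0 \<subseteq> {..<n}" using xs0(1) grow_subset by (auto simp: growing_lists_def)
  then have ylam: "y < lam" using high_le_quotient[OF xs0(2)] lam_le by (simp add: x_def)
  define xin where "xin i j = (if \<exists>S\<in>P. i \<in> S \<and> j \<in> S then x i j else 0)" for i j
  define xout where "xout i j = (if \<exists>S\<in>P. i \<in> S \<and> j \<in> S then 0 else x i j)" for i j
  have split: "qform {..<n} x f = qform {..<n} xin f + qform {..<n} xout f"
  proof -
    have "x i j = xin i j + xout i j" for i j
      unfolding xin_def xout_def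
      by (cases "\<exists>S\<in>P. i \<in> S \<and> j \<in> S") (simp_all only: if_True if_False add_0_right add_0_left)
    then show ?thesis unfolding qform_def sum.distrib[symmetric] distrib_right[symmetric] by simp
  qed
  \<comment> \<open>Blocks are closed under heavy edges, so an edge between two blocks has cost
    below h.\<close>
  have out: "qform {..<n} xout f \<le> d * \<delta> * N"
    unfolding N_def
  proof (rule qform_le_degree[of "{..<n}" adj])
    fix i j assume ij: "i \<in> {..<n}" "j \<in> {..<n}"
    then obtain S where S: "S \<in> P" "i \<in> S" using P(2) by blast
    show "\<bar>xout i j\<bar> \<le> (if adj i j then \<delta> else 0)"
    proof (cases "adj i j \<and> j \<notin> S")
      case True
      then have "\<bar>v (sort_pair i j)\<bar> powr \<alpha> \<le> h" using P(4)[OF S] by force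
      then have "(\<bar>v (sort_pair i j)\<bar> powr \<alpha>) powr (1 / \<alpha>) \<le> \<delta>"
        unfolding \<delta>_def using \<alpha>_pos by (intro powr_mono2) auto
      then have "\<bar>v (sort_pair i j)\<bar> \<le> \<delta>" using \<alpha>_pos by (simp add: powr_powr)
      moreover have "0 \<le> \<delta>" by (simp add: \<delta>_def)
      ultimately show ?thesis using True by (simp add: xout_def x_def wmat_def)
    next
      case False
      moreover have "0 \<le> \<delta>" by (simp add: \<delta>_def)
      ultimately show ?thesis using S by (auto simp: xout_def x_def wmat_def)
    qed
  next
    show "0 \<le> \<delta>" by (simp add: \<delta>_def)
    show "card {j \<in> {..<n}. adj i j} \<le> d" if "i \<in> {..<n}" for i using that by (rule degree_lessThan)
  qed (auto intro: adj_sym)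
  have sub: "S \<subseteq> {..<n}" if "S \<in> P" for S using P(2) that by blast
  have finP: "finite P" by (rule finite_subset[of _ "Pow {..<n}"]) (use sub in auto)
  have "qform {..<n} xin f = (\<Sum>S\<in>P. qform S xin f)"
  proof (rule qform_partition[OF finite_lessThan P(2,3)])
    fix S i j assume S: "S \<in> P" "i \<in> S" and "xin i j \<noteq> 0"
    then obtain S' where S': "S' \<in> P" "i \<in> S'" "j \<in> S'" by (auto simp: xin_def split: if_splits)
    then have "S' = S" using P(3) S unfolding disjoint_def by blast
    then show "j \<in> S" using S' by simp
  qed
  also have "\<dots> = (\<Sum>S\<in>P. qform S x f)"
    unfolding qform_def by (intro sum.cong refl) (auto simp: xin_def)
  also have "\<dots> \<le> (\<Sum>S\<in>P. z * sqn S f + (lam - z) * (if high adj S z v then sqn S f else 0))"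
  proof (rule sum_mono)
    fix S assume S: "S \<in> P"
    show "qform S x f \<le> z * sqn S f + (lam - z) * (if high adj S z v then sqn S f else 0)"
    proof (cases "high adj S z v")
      case True
      then show ?thesis using lam_le[OF sub[OF S], of f] by (simp add: algebra_simps)
    next
      case False
      then show ?thesis
        using not_high_qform_le[OF _ sub[OF S] False, of f] finite_subset[OF sub[OF S]] by (simp add: x_def)
    qed
  qed
  also have "\<dots> = z * N + (lam - z) * (\<Sum>S\<in>P. if high adj S z v then sqn S f else 0)"
    using sqn_partition[OF finite_lessThan P(2,3), of f]
    by (simp add: N_def sum.distrib sum_distrib_left)
  also have "(\<Sum>S\<in>P. if high adj S z v then sqn S f else 0) \<le> sqn I f"
  proof -
    let ?P = "{S \<in> P. high adj S z v}"
    have I: "\<Union>?P \<subseteq> I" unfolding I_def using P(1) by blast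
    have "I \<subseteq> {..<n}" unfolding I_def growing_lists_def using grow_subset by fastforce
    then have finI: "finite I" using finite_subset by blast
    have "(\<Sum>S\<in>P. if high adj S z v then sqn S f else 0) = (\<Sum>S\<in>?P. sqn S f)"
      using finP by (simp add: sum.If_cases Int_def)
    also have "\<dots> = sqn (\<Union>?P) f"
    proof (rule sqn_partition[symmetric])
      show "finite (\<Union>?P)" by (rule finite_subset[OF I finI])
      show "disjoint ?P" using P(3) by (auto simp: disjoint_def)
    qed simp
    also have "\<dots> \<le> sqn I f" by (rule sqn_mono[OF finI I])
    finally show ?thesis .
  qed
  finally have "qform {..<n} xin f \<le> z * N + (lam - z) * sqn I f"
    using ylam y by (simp add: mult_left_mono)
  then have "lam * N \<le> z * N + (lam - z) * sqn I f + d * \<delta> * N"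
    using split out lam by linarith
  also have "d * \<delta> * N \<le> \<epsilon> * (y - z) * N"
    using small N by (intro mult_right_mono) (auto simp: \<delta>_def)
  also have "\<dots> \<le> \<epsilon> * (lam - z) * N"
    using ylam \<epsilon> N by (intro mult_right_mono mult_left_mono) auto
  finally have "(lam - z) * ((1 - \<epsilon>) * N) \<le> (lam - z) * sqn I f" by (simp add: algebra_simps)
  then have le: "(1 - \<epsilon>) * N \<le> sqn I f" using ylam y by (simp add: mult_le_cancel_left_pos)
  show ?thesis
    using localized_from_mass[OF \<epsilon> less_imp_le[OF N] le] by (simp only: N_def I_def)
qed

text \<open>A total cost below T caps every weight at \<open>T powr (1 / \<alpha>)\<close>, and the
  degree bound caps the form. This a priori bound shows that the expected number of high lists
  eventually drops as y grows.\<close>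

lemma high_cost_ge:
  assumes S: "S \<subseteq> {..<n}" and high: "high adj S y v" and y: "d * T powr (1 / \<alpha>) \<le> y" and T: "0 \<le> T"
  shows "T \<le> cost v S"
proof (rule ccontr)
  assume "\<not> T \<le> cost v S"
  then have less: "cost v S < T" by simp
  have fin: "finite S" using S finite_subset by blast
  have bound: "\<bar>v e\<bar> \<le> T powr (1 / \<alpha>)" if "e \<in> edge_pairs adj S" for e
  proof -
    have "\<bar>v e\<bar> powr \<alpha> \<le> cost v S"
      using finite_edge_pairs[OF fin] that by (intro member_le_sum) auto
    then have "(\<bar>v e\<bar> powr \<alpha>) powr (1 / \<alpha>) \<le> T powr (1 / \<alpha>)"
      using less \<alpha>_pos by (intro powr_mono2) auto
    then show ?thesis using \<alpha>_pos by (simp add: powr_powr)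
  qed
  obtain r :: "rat list" where r: "y * sqn S (ratvec r) < qform S (wmat adj v) (ratvec r)"
    using high by (auto simp: high_def)
  have "qform S (wmat adj v) (ratvec r) \<le> d * T powr (1 / \<alpha>) * sqn S (ratvec r)"
  proof (rule qform_le_degree[OF fin, of adj])
    show "\<bar>wmat adj v i j\<bar> \<le> (if adj i j then T powr (1 / \<alpha>) else 0)" if "i \<in> S" "j \<in> S" for i j
      using bound[OF sort_pair_in_edge_pairs[of adj i j S]] adj_sym adj_irrefl that by (simp add: wmat_def)
    show "card {j \<in> S. adj i j} \<le> d" if "i \<in> S" for i using degree_within fin S that by auto
  qed (auto intro: adj_sym)
  also have "\<dots> \<le> y * sqn S (ratvec r)" using y by (intro mult_right_mono sqn_nonneg)
  finally show False using r by simp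
qed

lemma cost_meas: "S \<subseteq> {..<n} \<Longrightarrow> (\<lambda>\<omega>. cost (\<lambda>p. V p \<omega>) S) \<in> borel_measurable M"
  using edge_pairs_subset[of S] Z_meas[unfolded Z_def[abs_def]] by (intro borel_measurable_sum) auto

text \<open>The event is covered by the level sets \<open>|V e| ^ \<alpha> \<ge> k e\<close> with \<open>k e = \<lfloor>|V e| ^ \<alpha>\<rfloor>\<close>. On such a level set
  every entry may be raised to \<open>s * (k e + 1) ^ (1 / \<alpha>)\<close>, which multiplies the quadratic form by at least \<open>s\<close> and
  costs a factor \<open>exp ((s ^ \<alpha> - 1) * T)\<close> in probability.\<close>

lemma prob_high_le_scaled:
  assumes S: "S \<subseteq> {..<n}" and s: "1 \<le> s" and m: "card (edge_pairs adj S) \<le> m"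
  shows "prob {\<omega> \<in> space M. high adj S y (\<lambda>p. V p \<omega>)} \<le>
    prob {\<omega> \<in> space M. real T \<le> cost (\<lambda>p. V p \<omega>) S} +
    (real T + 1) ^ m * (C / c) ^ m * exp (s powr \<alpha> * m + (s powr \<alpha> - 1) * T) *
      prob {\<omega> \<in> space M. high adj S (s * y) (\<lambda>p. V p \<omega>)}"
proof -
  define E where "E = edge_pairs adj S"
  have fin: "finite E" unfolding E_def using S finite_subset by (intro finite_edge_pairs) blast
  have E: "E \<subseteq> pairs" unfolding E_def by (rule edge_pairs_subset[OF S])
  have cm: "card E \<le> m" using m by (simp add: E_def)
  \<comment> \<open>Only profiles compatible with some high configuration are kept: that
    configuration is the one to which the raised weights are compared by
    \<open>high_mono\<close>.\<close>
  define K where "K = {k \<in> E \<rightarrow>\<^sub>E {..T}. (\<Sum>e\<in>E. k e) \<le> T \<and>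
    (\<exists>\<omega>\<in>space M. high adj S y (\<lambda>p. V p \<omega>) \<and> (\<forall>e\<in>E. Z e \<omega> \<le> real (k e) + 1))}"
  define B where "B k = {\<omega> \<in> space M. \<forall>e\<in>E. real (k e) \<le> Z e \<omega>}" for k :: "nat \<times> nat \<Rightarrow> nat"
  define A where "A = {\<omega> \<in> space M. real T \<le> cost (\<lambda>p. V p \<omega>) S}"
  define q where "q = prob {\<omega> \<in> space M. high adj S (s * y) (\<lambda>p. V p \<omega>)}"
  define a where "a = s powr \<alpha>"
  have a1: "1 \<le> a" unfolding a_def using s \<alpha>_pos by (simp add: ge_one_powr_ge_zero)
  have finK: "finite K" unfolding K_def by (rule finite_subset[of _ "E \<rightarrow>\<^sub>E {..T}"]) (auto intro!: finite_PiE fin)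
  have Zm: "Z e \<in> borel_measurable M" if "e \<in> E" for e using Z_meas E that by blast
  have Bm: "B k \<in> events" for k
    unfolding B_def
  proof (rule sets.sets_Collect_finite_All[OF _ fin])
    fix e assume "e \<in> E"
    then show "{\<omega> \<in> space M. real (k e) \<le> Z e \<omega>} \<in> events"
      by (intro borel_measurable_le borel_measurable_const Zm)
  qed
  have Am: "A \<in> events" unfolding A_def using cost_meas[OF S] by measurable
  have cost_eq: "cost (\<lambda>p. V p \<omega>) S = (\<Sum>e\<in>E. Z e \<omega>)" for \<omega> by (simp add: E_def Z_def)
  have sub: "{\<omega> \<in> space M. high adj S y (\<lambda>p. V p \<omega>)} \<subseteq> A \<union> (\<Union>k\<in>K. B k)"
  proof
    fix \<omega> assume w: "\<omega> \<in> {\<omega> \<in> space M. high adj S y (\<lambda>p. V p \<omega>)}"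
    show "\<omega> \<in> A \<union> (\<Union>k\<in>K. B k)"
    proof (cases "\<omega> \<in> A")
      case False
      define k where "k = (\<lambda>e\<in>E. nat \<lfloor>Z e \<omega>\<rfloor>)"
      have Z0: "0 \<le> Z e \<omega>" for e by (simp add: Z_def)
      have kle: "real (k e) \<le> Z e \<omega>" "Z e \<omega> \<le> real (k e) + 1" if "e \<in> E" for e
        using that nat_floor_bounds[OF Z0[of e]] by (auto simp: k_def)
      have "real (\<Sum>e\<in>E. k e) \<le> (\<Sum>e\<in>E. Z e \<omega>)" using kle by (simp add: sum_mono)
      also have "\<dots> < real T" using False w by (simp add: A_def cost_eq)
      finally have sum: "(\<Sum>e\<in>E. k e) \<le> T" by linarith
      have "k e \<le> T" if "e \<in> E" for e using member_le_sum[of e E k] fin that sum by simp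
      then have "k \<in> E \<rightarrow>\<^sub>E {..T}" by (auto simp: k_def)
      then have "k \<in> K" unfolding K_def using sum w kle by blast
      moreover have "\<omega> \<in> B k" using w kle by (auto simp: B_def)
      ultimately show ?thesis by blast
    qed simp
  qed
  have q0: "0 \<le> q" by (simp add: q_def)
  have each: "prob (B k) \<le> (C / c) ^ m * exp (a * m + (a - 1) * T) * q" if k: "k \<in> K" for k
  proof -
    define \<sigma> where "\<sigma> = real (\<Sum>e\<in>E. k e)"
    \<comment> \<open>The added 1 undoes the rounding and also ensures \<open>1 \<le> u e\<close>,
      the range in which \<open>lower\<close> applies.\<close>
    define u where "u e = (real (k e) + 1) powr (1 / \<alpha>)" for e
    obtain \<omega>0 where w0: "\<omega>0 \<in> space M" "high adj S y (\<lambda>p. V p \<omega>0)" "\<And>e. e \<in> E \<Longrightarrow> Z e \<omega>0 \<le> real (k e) + 1"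
      using k by (auto simp: K_def)
    have vu: "\<bar>V e \<omega>0\<bar> \<le> u e" if "e \<in> E" for e
    proof -
      have "(\<bar>V e \<omega>0\<bar> powr \<alpha>) powr (1 / \<alpha>) \<le> u e"
        unfolding u_def using w0(3)[OF that] \<alpha>_pos by (intro powr_mono2) (auto simp: Z_def)
      then show ?thesis using \<alpha>_pos by (simp add: powr_powr)
    qed
    have u1: "1 \<le> u e" for e unfolding u_def using \<alpha>_pos by (intro ge_one_powr_ge_zero) auto
    have ua: "(s * u e) powr \<alpha> = a * (real (k e) + 1)" for e
      unfolding u_def a_def using s \<alpha>_pos by (simp add: powr_mult powr_powr)
    have "c ^ card E * exp (- (a * (\<sigma> + card E))) = c ^ card E * exp (- (\<Sum>e\<in>E. (s * u e) powr \<alpha>))"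
      unfolding ua \<sigma>_def by (simp add: sum_distrib_left[symmetric] sum.distrib)
    also have "\<dots> \<le> prob {\<omega> \<in> space M. \<forall>e\<in>E. s * u e \<le> V e \<omega>}"
    proof (rule prob_joint_lower[OF E])
      show "1 \<le> s * u e" for e using mult_mono[OF s u1[of e]] s by simp
    qed
    also have "\<dots> \<le> q"
      unfolding q_def
    proof (rule finite_measure_mono[OF _ high_event], rule subsetI)
      fix \<omega> assume w: "\<omega> \<in> {\<omega> \<in> space M. \<forall>e\<in>E. s * u e \<le> V e \<omega>}"
      have "high adj S (s * y) (\<lambda>p. V p \<omega>)"
        by (rule high_mono[where u = u, OF adj_sym adj_irrefl _ _ _ w0(2)])
           (use vu w s in \<open>auto simp: E_def\<close>)
      then show "\<omega> \<in> {\<omega> \<in> space M. high adj S (s * y) (\<lambda>p. V p \<omega>)}" using w by simp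
    qed
    finally have low: "c ^ card E * exp (- (a * (\<sigma> + card E))) \<le> q" .
    have "\<sigma> \<le> T" using k by (simp add: \<sigma>_def K_def flip: of_nat_sum)
    have "prob (B k) \<le> C ^ card E * exp (- \<sigma>)"
      unfolding B_def \<sigma>_def by (rule prob_joint_upper[OF E])
    \<comment> \<open>The exponent a * (\<sigma> + card E) paid by the raised weights is split off.
      What remains grows with \<sigma> only at the rate a - 1, which is small when s is close to
      1.\<close>
    also have "\<dots> = (C / c) ^ card E * exp (a * card E + (a - 1) * \<sigma>) * (c ^ card E * exp (- (a * (\<sigma> + card E))))"
      using c_pos by (simp add: power_divide algebra_simps flip: exp_add)
    also have "\<dots> \<le> (C / c) ^ card E * exp (a * card E + (a - 1) * \<sigma>) * q"
      using low C_ge c_pos by (intro mult_left_mono) auto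
    also have "\<dots> \<le> (C / c) ^ m * exp (a * m + (a - 1) * T) * q"
    proof (intro mult_right_mono mult_mono)
      show "(C / c) ^ card E \<le> (C / c) ^ m"
        using C_ge c_pos c_le cm by (intro power_increasing) (auto simp: field_simps)
      show "exp (a * card E + (a - 1) * \<sigma>) \<le> exp (a * m + (a - 1) * T)"
        using a1 cm \<open>\<sigma> \<le> T\<close> by (simp add: add_mono mult_left_mono)
    qed (use C_ge c_pos q0 in auto)
    finally show ?thesis .
  qed
  have "prob {\<omega> \<in> space M. high adj S y (\<lambda>p. V p \<omega>)} \<le> prob (A \<union> (\<Union>k\<in>K. B k))"
    using Am Bm finK by (intro finite_measure_mono[OF sub]) auto
  also have "\<dots> \<le> prob A + prob (\<Union>k\<in>K. B k)"
    using Am Bm finK by (intro measure_Un_le) auto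
  also have "prob (\<Union>k\<in>K. B k) \<le> (\<Sum>k\<in>K. prob (B k))"
    using finK Bm by (intro finite_measure_subadditive_finite) auto
  also have "\<dots> \<le> (\<Sum>k\<in>K. (C / c) ^ m * exp (a * m + (a - 1) * T) * q)"
    by (rule sum_mono[OF each])
  also have "\<dots> = real (card K) * ((C / c) ^ m * exp (a * m + (a - 1) * T) * q)" by simp
  also have "\<dots> \<le> (real T + 1) ^ m * ((C / c) ^ m * exp (a * m + (a - 1) * T) * q)"
  proof (rule mult_right_mono)
    have "card K \<le> card (E \<rightarrow>\<^sub>E {..T})" unfolding K_def using fin by (intro card_mono finite_PiE) auto
    also have "\<dots> = (T + 1) ^ card E" using fin by (simp add: card_PiE)
    also have "\<dots> \<le> (T + 1) ^ m" using cm by (intro power_increasing) auto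
    finally have "real (card K) \<le> real ((T + 1) ^ m)" by linarith
    then show "real (card K) \<le> (real T + 1) ^ m" by (simp add: add.commute)
    show "0 \<le> (C / c) ^ m * exp (a * m + (a - 1) * T) * q" using C_ge c_pos q0 by simp
  qed
  finally show ?thesis by (simp add: A_def q_def a_def mult.assoc)
qed

section \<open>First and second moments of the number of high lists\<close>

text \<open>\<open>high\<close> depends only on weights of edges inside the vertex set, and disjoint
  vertex sets span disjoint families of edges.\<close>

lemma prob_high_indep:
  assumes S: "S \<subseteq> {..<n}" and T: "T \<subseteq> {..<n}" and disj: "S \<inter> T = {}"
  shows "prob ({\<omega> \<in> space M. high adj S y (\<lambda>p. V p \<omega>)} \<inter> {\<omega> \<in> space M. high adj T z (\<lambda>p. V p \<omega>)}) =
    prob {\<omega> \<in> space M. high adj S y (\<lambda>p. V p \<omega>)} * prob {\<omega> \<in> space M. high adj T z (\<lambda>p. V p \<omega>)}"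
proof -
  let ?PM = "\<lambda>S. PiM (edge_pairs adj S) (\<lambda>_. borel :: real measure)"
  let ?H = "\<lambda>S y. {v \<in> space (?PM S). high adj S y v}"
  let ?X = "\<lambda>S \<omega>. \<lambda>i\<in>edge_pairs adj S. V i \<omega>"
  have sets: "?H S y \<in> sets (?PM S)" for S y
  proof -
    have "(\<lambda>v. qform S (wmat adj v) f) \<in> borel_measurable (?PM S)" for f
      unfolding qform_def
    proof (intro borel_measurable_sum borel_measurable_times borel_measurable_const)
      fix i j assume ij: "i \<in> S" "j \<in> S"
      show "(\<lambda>v. wmat adj v i j) \<in> borel_measurable (?PM S)"
      proof (cases "adj i j")
        case True
        then have "sort_pair i j \<in> edge_pairs adj S"
          using sort_pair_in_edge_pairs[of adj i j S] adj_sym adj_irrefl ij by blast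
        then show ?thesis using True by (simp add: wmat_def)
      qed (simp add: wmat_def)
    qed
    then show ?thesis unfolding high_def by measurable
  qed
  have eq: "?X S -` ?H S y \<inter> space M = {\<omega> \<in> space M. high adj S y (\<lambda>p. V p \<omega>)}" for S y
  proof -
    have "?X S \<omega> \<in> ?H S y \<longleftrightarrow> high adj S y (\<lambda>p. V p \<omega>)" for \<omega>
      using high_cong[of adj S "?X S \<omega>" "\<lambda>p. V p \<omega>" y] adj_sym adj_irrefl
      by (auto simp: space_PiM)
    then show ?thesis by auto
  qed
  have "edge_pairs adj S \<inter> edge_pairs adj T = {}" using disj by (auto simp: edge_pairs_def)
  then have "indep_var (?PM S) (?X S) (?PM T) (?X T)"
    using V_indep edge_pairs_subset[OF S] edge_pairs_subset[OF T]
    unfolding pairs_def by (intro indep_var_restrict)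
  from indep_varD[OF this sets sets, of y z]
  have "prob ((\<lambda>x. (?X S x, ?X T x)) -` (?H S y \<times> ?H T z) \<inter> space M) =
    prob (?X S -` ?H S y \<inter> space M) * prob (?X T -` ?H T z \<inter> space M)" .
  moreover have "(\<lambda>x. (?X S x, ?X T x)) -` (?H S y \<times> ?H T z) \<inter> space M =
    (?X S -` ?H S y \<inter> space M) \<inter> (?X T -` ?H T z \<inter> space M)" by auto
  ultimately show ?thesis by (simp only: eq)
qed

lemma growing_list_subset: "xs \<in> growing_lists {..<n} adj K \<Longrightarrow> set xs \<subseteq> {..<n}"
  by (auto simp: growing_lists_def dest: grow_subset)

lemma card_growing_containing:
  "v < n \<Longrightarrow> card {xs \<in> growing_lists {..<n} adj K. v \<in> set xs} \<le> K * (K * d) ^ K"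
  by (rule card_growing_lists_containing[OF finite_lessThan adj_sym degree_lessThan _ d_pos]) auto

lemma card_growing: "card (growing_lists {..<n} adj K) \<le> n * (K * (K * d) ^ K)"
  using card_growing_lists[OF finite_lessThan adj_sym degree_lessThan d_pos] by simp

lemma finite_growing: "finite (growing_lists {..<n} adj K)"
  by (rule finite_growing_lists) simp

lemma card_growing_meeting:
  assumes "S \<subseteq> {..<n}" "finite S"
  shows "card {xs \<in> growing_lists {..<n} adj K. S \<inter> set xs \<noteq> {}} \<le> card S * (K * (K * d) ^ K)"
proof -
  have "{xs \<in> growing_lists {..<n} adj K. S \<inter> set xs \<noteq> {}} \<subseteq>
      (\<Union>v\<in>S. {xs \<in> growing_lists {..<n} adj K. v \<in> set xs})" by auto
  then have "card {xs \<in> growing_lists {..<n} adj K. S \<inter> set xs \<noteq> {}} \<le>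
      card (\<Union>v\<in>S. {xs \<in> growing_lists {..<n} adj K. v \<in> set xs})"
    by (intro card_mono) (use assms finite_growing in auto)
  also have "\<dots> \<le> (\<Sum>v\<in>S. K * (K * d) ^ K)"
    by (rule order_trans[OF card_UN_le[OF assms(2)] sum_mono])
       (use card_growing_containing assms(1) in auto)
  finally show ?thesis by simp
qed

text \<open>Lists are counted, not sets: a vertex set contributes once per growing
  enumeration.\<close>

definition expected_high :: "nat \<Rightarrow> real \<Rightarrow> real" where
  "expected_high K y = (\<Sum>xs\<in>growing_lists {..<n} adj K. prob {\<omega> \<in> space M. high adj (set xs) y (\<lambda>p. V p \<omega>)})"

text \<open>Two lists are related when they share a vertex; a list has at most K vertices, each
  lying in at most K * (K * d)^K lists, so the numerator does not involve n.\<close>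

lemma prob_no_high_le:
  assumes "expected_high K y > 0"
  shows "prob {\<omega> \<in> space M. \<forall>xs\<in>growing_lists {..<n} adj K. \<not> high adj (set xs) y (\<lambda>p. V p \<omega>)} \<le>
    real (K * (K * (K * d) ^ K)) / expected_high K y"
proof -
  let ?G = "growing_lists {..<n} adj K"
  let ?E = "\<lambda>xs. {\<omega> \<in> space M. high adj (set xs) y (\<lambda>p. V p \<omega>)}"
  have "prob {\<omega> \<in> space M. \<forall>xs\<in>?G. \<omega> \<notin> ?E xs} \<le> real (K * (K * (K * d) ^ K)) / (\<Sum>xs\<in>?G. prob (?E xs))"
  proof (rule prob_none_le_second_moment[where R = "\<lambda>xs ys. set xs \<inter> set ys \<noteq> {}"])
    show "finite ?G" by (rule finite_growing)
    show "?E xs \<in> events" for xs by (rule high_event)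
    show "prob (?E xs \<inter> ?E ys) = prob (?E xs) * prob (?E ys)"
      if "xs \<in> ?G" "ys \<in> ?G" "\<not> set xs \<inter> set ys \<noteq> {}" for xs ys
      using that by (intro prob_high_indep growing_list_subset) auto
    show "real (card {ys \<in> ?G. set xs \<inter> set ys \<noteq> {}}) \<le> real (K * (K * (K * d) ^ K))" if "xs \<in> ?G" for xs
    proof -
      have "card {ys \<in> ?G. set xs \<inter> set ys \<noteq> {}} \<le> card (set xs) * (K * (K * d) ^ K)"
        using growing_list_subset[OF that] by (intro card_growing_meeting) auto
      also have "\<dots> \<le> K * (K * (K * d) ^ K)"
        using that card_length[of xs] by (intro mult_right_mono) (auto simp: growing_lists_def)
      finally show ?thesis by linarith
    qed
    show "(\<Sum>xs\<in>?G. prob (?E xs)) > 0" using assms by (simp add: expected_high_def)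
  qed
  moreover have "{\<omega> \<in> space M. \<forall>xs\<in>?G. \<omega> \<notin> ?E xs} =
    {\<omega> \<in> space M. \<forall>xs\<in>?G. \<not> high adj (set xs) y (\<lambda>p. V p \<omega>)}" by auto
  ultimately show ?thesis by (simp add: expected_high_def)
qed

text \<open>Single edges suffice: at each vertex one incident edge is chosen, and the all-ones
  vector on its two endpoints has Rayleigh quotient equal to its weight.\<close>

lemma expected_high_ge:
  assumes K: "K \<ge> 2" and y: "y > 0"
  shows "n * (c * exp (- (y powr \<alpha> + 1))) \<le> expected_high K y"
proof -
  \<comment> \<open>Adding 1 to the cost makes t > y, as \<open>high\<close> is strict, and t \<ge>
    1, as \<open>lower\<close> requires; the price is a factor exp (-1).\<close>
  define t where "t = (y powr \<alpha> + 1) powr (1 / \<alpha>)"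
  have "y = (y powr \<alpha>) powr (1 / \<alpha>)" using y \<alpha>_pos by (simp add: powr_powr)
  also have "\<dots> < t" unfolding t_def using y \<alpha>_pos by (intro powr_less_mono2) auto
  finally have yt: "y < t" .
  have t1: "1 \<le> t" unfolding t_def using \<alpha>_pos by (intro ge_one_powr_ge_zero) auto
  have ta: "t powr \<alpha> = y powr \<alpha> + 1" unfolding t_def using \<alpha>_pos by (simp add: powr_powr add_nonneg_eq_0_iff)
  have "\<exists>j. adj i j" if "i < n" for i
  proof (rule ccontr)
    assume "\<nexists>j. adj i j"
    then show False using degree[OF that] d_pos by simp
  qed
  then obtain nb where nb: "\<And>i. i < n \<Longrightarrow> adj i (nb i)" by metis
  \<comment> \<open>The second entry recovers i, so \<open>ls\<close> is injective even when two
    vertices choose the same edge.\<close>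
  define ls where "ls i = [nb i, i]" for i
  have inj: "inj_on ls {..<n}" by (auto simp: ls_def inj_on_def)
  have sub: "ls ` {..<n} \<subseteq> growing_lists {..<n} adj K"
  proof
    fix xs assume "xs \<in> ls ` {..<n}"
    then obtain i where i: "i < n" "xs = [nb i, i]" by (auto simp: ls_def)
    have "nb i < n" "nb i \<noteq> i" using nb[OF i(1)] adj_less adj_sym adj_irrefl by metis+
    then show "xs \<in> growing_lists {..<n} adj K"
      using i nb[OF i(1)] K by (auto simp: growing_lists_def)
  qed
  have each: "c * exp (- (y powr \<alpha> + 1)) \<le> prob {\<omega> \<in> space M. high adj (set (ls i)) y (\<lambda>p. V p \<omega>)}" if i: "i < n" for i
  proof -
    let ?p = "sort_pair i (nb i)"
    have p: "?p \<in> pairs" by (rule sort_pair_in_pairs[OF nb[OF i]])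
    have ne: "nb i \<noteq> i" using nb[OF i] adj_irrefl by metis
    have "c * exp (- (t powr \<alpha>)) \<le> prob {\<omega> \<in> space M. t \<le> V ?p \<omega>}"
      using p t1 by (intro lower) (auto simp: pairs_def)
    also have "\<dots> \<le> prob {\<omega> \<in> space M. high adj (set (ls i)) y (\<lambda>p. V p \<omega>)}"
    proof (rule finite_measure_mono[OF _ high_event], rule subsetI)
      fix \<omega> assume w: "\<omega> \<in> {\<omega> \<in> space M. t \<le> V ?p \<omega>}"
      define r where "r = replicate n (1 :: rat)"
      have r1: "ratvec r i = 1" "ratvec r (nb i) = 1"
        using i adj_less[OF adj_sym[OF nb[OF i]]] by (auto simp: r_def ratvec_def)
      have S: "set (ls i) = {i, nb i}" by (auto simp: ls_def)
      have "sqn (set (ls i)) (ratvec r) = 2" using ne r1 by (simp add: S sqn_def)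
      moreover have "qform (set (ls i)) (wmat adj (\<lambda>p. V p \<omega>)) (ratvec r) = 2 * V ?p \<omega>"
        using ne r1 nb[OF i] adj_sym[OF nb[OF i]] adj_irrefl
        by (simp add: S qform_def wmat_def sort_pair_def min.commute max.commute)
      ultimately have "high adj (set (ls i)) y (\<lambda>p. V p \<omega>)"
        unfolding high_def using w yt by (intro exI[of _ r]) simp
      then show "\<omega> \<in> {\<omega> \<in> space M. high adj (set (ls i)) y (\<lambda>p. V p \<omega>)}" using w by simp
    qed
    finally show ?thesis by (simp add: ta)
  qed
  have "n * (c * exp (- (y powr \<alpha> + 1))) = (\<Sum>i<n. c * exp (- (y powr \<alpha> + 1)))" by simp
  also have "\<dots> \<le> (\<Sum>i<n. prob {\<omega> \<in> space M. high adj (set (ls i)) y (\<lambda>p. V p \<omega>)})"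
    using each by (intro sum_mono) auto
  also have "\<dots> = (\<Sum>xs\<in>ls ` {..<n}. prob {\<omega> \<in> space M. high adj (set xs) y (\<lambda>p. V p \<omega>)})"
    by (simp add: sum.reindex[OF inj])
  also have "\<dots> \<le> expected_high K y"
    unfolding expected_high_def using sub finite_growing by (intro sum_mono2) auto
  finally show ?thesis .
qed

lemma prob_cost_growing_le:
  "(\<Sum>xs\<in>growing_lists {..<n} adj K. prob {\<omega> \<in> space M. real (T + K * K) \<le> cost (\<lambda>p. V p \<omega>) (set xs)}) \<le>
    n * (K * (K * d) ^ K) * ((real T + 1) ^ (K * K) * C ^ (K * K) * exp (- real T))"
proof -
  let ?q = "(real T + 1) ^ (K * K) * C ^ (K * K) * exp (- real T)"
  have "(\<Sum>xs\<in>growing_lists {..<n} adj K. prob {\<omega> \<in> space M. real (T + K * K) \<le> cost (\<lambda>p. V p \<omega>) (set xs)}) \<le>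
    (\<Sum>xs\<in>growing_lists {..<n} adj K. ?q)"
  proof (rule sum_mono)
    fix xs assume xs: "xs \<in> growing_lists {..<n} adj K"
    have "card (edge_pairs adj (set xs)) \<le> card (set xs) * card (set xs)"
      by (rule card_edge_pairs_le) simp
    also have "\<dots> \<le> K * K" using xs card_length[of xs] by (intro mult_mono) (auto simp: growing_lists_def)
    finally show "prob {\<omega> \<in> space M. real (T + K * K) \<le> cost (\<lambda>p. V p \<omega>) (set xs)} \<le> ?q"
      using prob_cost_ge[OF edge_pairs_subset[OF growing_list_subset[OF xs]], of "K * K" T]
      by (simp add: Z_def)
  qed
  also have "\<dots> = real (card (growing_lists {..<n} adj K)) * ?q" by simp
  also have "\<dots> \<le> real (n * (K * (K * d) ^ K)) * ?q"
    using C_ge card_growing[of K] by (intro mult_right_mono) (auto simp del: of_nat_mult of_nat_power)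
  finally show ?thesis by simp
qed

end

section \<open>Choice of the parameters\<close>

text \<open>\<open>K\<close> bounds the size of the components formed by the edges with \<open>|V e| ^ \<alpha> \<ge> h\<close>, \<open>T\<close> is (up to
  \<open>(K + 1) ^ 2\<close>) the largest total weight \<open>\<Sum>e. |V e| ^ \<alpha>\<close> of such a component. In \<open>few_vertices_params\<close> the
  threshold for the top eigenvalue is sought among \<open>y0 * s ^ i\<close>; \<open>q\<close> and \<open>R\<close> are the error terms
  of the comparison of neighbouring thresholds, and \<open>\<delta>\<close> is a small power of \<open>n\<close>. In
  \<open>disjoint_edges_params\<close> the edges with \<open>|V e| ^ \<alpha> \<ge> \<theta>\<close> are selected, \<open>y\<close> bounds the top eigenvalue
  from below, and \<open>a\<close>, \<open>\<rho>\<close> bound the eigenvalues of components with and without a selected edge.\<close>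

definition few_vertices_params ::
  "real \<Rightarrow> nat \<Rightarrow> real \<Rightarrow> real \<Rightarrow> real \<Rightarrow> nat \<Rightarrow> nat \<Rightarrow> nat \<Rightarrow> real \<Rightarrow> real \<Rightarrow> real \<Rightarrow> real \<Rightarrow> real \<Rightarrow> real \<Rightarrow> bool" where
  "few_vertices_params \<alpha> d C c \<epsilon> n K T s y0 h \<delta> q R \<longleftrightarrow>
    1 < s \<and> 2 \<le> K \<and> 0 < y0 \<and> 0 \<le> h \<and>
    real (T + Suc K * Suc K) \<le> real K * h \<and>
    real d * h powr (1 / \<alpha>) \<le> \<epsilon> * (1 - 1 / s) * y0 \<and>
    1 < \<delta> \<and> \<delta> \<le> real n * (c * exp (- (y0 powr \<alpha> + 1))) \<and>
    real (n * (Suc K * (Suc K * d) ^ Suc K)) *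
      ((real T + 1) ^ (Suc K * Suc K) * C ^ (Suc K * Suc K) * exp (- real T)) \<le> q \<and> q \<le> 1 \<and>
    (real (T + Suc K * Suc K) + 1) ^ (Suc K * Suc K) * (C / c) ^ (Suc K * Suc K) *
      exp (s powr \<alpha> * real (Suc K * Suc K) + (s powr \<alpha> - 1) * real (T + Suc K * Suc K)) \<le> R"

definition disjoint_edges_params ::
  "real \<Rightarrow> nat \<Rightarrow> real \<Rightarrow> nat \<Rightarrow> nat \<Rightarrow> real \<Rightarrow> real \<Rightarrow> real \<Rightarrow> real \<Rightarrow> real \<Rightarrow> bool" where
  "disjoint_edges_params \<alpha> d \<epsilon> K T h \<theta> y a \<rho> \<longleftrightarrow>
    0 \<le> h \<and> real (T + Suc K * Suc K) \<le> real K * h \<and> h \<le> \<theta> \<and>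
    real (T + Suc K * Suc K) \<le> 2 * \<theta> \<and> \<theta> \<le> real (T + Suc K * Suc K) \<and> 0 < y \<and>
    a = real (T + Suc K * Suc K) powr (1 / \<alpha>) \<and>
    \<rho> = sqrt (\<theta> powr (2 / \<alpha> - 1) * real (T + Suc K * Suc K)) \<and> \<rho> < a \<and>
    (a - y + d * (real (T + Suc K * Suc K) - \<theta>) powr (1 / \<alpha>) + d * h powr (1 / \<alpha>)) / a +
      (a - y + d * h powr (1 / \<alpha>)) / (a - \<rho>) \<le> \<epsilon>"

text \<open>The rate \<gamma> is shared equally among the m + 1 factors.\<close>

lemma eventually_poly_le_exp:
  fixes A b \<gamma> :: real
  assumes "0 < \<gamma>"
  shows "\<forall>\<^sub>F L in at_top. A * (3 * L + b) ^ m \<le> exp (\<gamma> * L)"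
proof -
  define \<kappa> where "\<kappa> = \<gamma> / (real m + 1)"
  define B where "B = \<bar>A\<bar> + 1"
  have \<kappa>: "\<kappa> > 0" using assms by (simp add: \<kappa>_def)
  have B: "B > 0" "A \<le> B" by (auto simp: B_def)
  have "\<forall>\<^sub>F L in at_top. 3 * L + b \<le> exp (\<kappa> * L)" using \<kappa> by real_asymp
  moreover have "\<forall>\<^sub>F L in at_top. 3 * L + b \<ge> 0" by real_asymp
  moreover have "\<forall>\<^sub>F L in at_top. B \<le> exp (\<kappa> * L)" using \<kappa> by real_asymp
  ultimately show ?thesis
  proof eventually_elim
    case (elim L)
    have "A * (3 * L + b) ^ m \<le> B * (3 * L + b) ^ m" using elim B by (intro mult_right_mono) auto
    also have "\<dots> \<le> exp (\<kappa> * L) * exp (\<kappa> * L) ^ m"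
      using elim B by (intro mult_mono power_mono) auto
    also have "\<dots> = exp ((real m + 1) * \<kappa> * L)"
      by (simp add: exp_of_nat_mult[symmetric] exp_add[symmetric] algebra_simps)
    also have "(real m + 1) * \<kappa> = \<gamma>" by (simp add: \<kappa>_def)
    finally show ?case .
  qed
qed

lemma eventually_sequentially_ln:
  assumes "\<forall>\<^sub>F L in at_top. P L"
  shows "\<exists>N. \<forall>n\<ge>N. P (ln (real n))"
proof -
  have "filterlim (\<lambda>n. ln (real n)) at_top sequentially"
    by (rule filterlim_compose[OF ln_at_top filterlim_real_sequentially])
  from eventually_compose_filterlim[OF assms this] show ?thesis by (simp add: eventually_sequentially)
qed

text \<open>The summands come from an excessive total cost, from the second moment bound at the
  threshold, and from Markov's inequality for the number of high lists.\<close>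

lemma few_vertices_failure_le:
  fixes \<epsilon> D K :: real assumes "0 < \<epsilon>" "0 \<le> D" "0 \<le> K"
  shows "\<forall>\<^sub>F L in at_top. exp (- L) + D * exp (- (\<epsilon> * L / 4)) + 3 * K * exp (- (\<epsilon> * L / 2)) \<le> exp (- (L powr (1/2)))"
proof -
  have *: "\<forall>\<^sub>F L in at_top. B * exp (- (\<gamma> * L)) \<le> exp (- (L powr (1/2))) / 3" if "\<gamma> > 0" for B \<gamma> :: real
  proof -
    have "\<forall>\<^sub>F L in at_top. (\<bar>B\<bar> + 1) * exp (- (\<gamma> * L)) \<le> exp (- (L powr (1/2))) / 3"
    proof -
      have "\<bar>B\<bar> + 1 > 0" by simp
      then show ?thesis using that by real_asymp
    qed
    then show ?thesis
    proof eventually_elim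
      case (elim L)
      have "B * exp (- (\<gamma> * L)) \<le> (\<bar>B\<bar> + 1) * exp (- (\<gamma> * L))" by (intro mult_right_mono) auto
      then show ?case using elim by linarith
    qed
  qed
  have "\<forall>\<^sub>F L :: real in at_top. exp (- L) \<le> exp (- (L powr (1/2))) / 3" by real_asymp
  moreover note *[of "\<epsilon> / 4" D] *[of "\<epsilon> / 2" "3 * K"]
  ultimately show ?thesis using assms(1)
    by (simp, elim eventually_rev_mp, intro always_eventually) (simp add: field_simps)
qed

text \<open>The last quotient decides the exponents. Its numerator has order L^(-1/16), as 1 - u L
  has order L^(-1/4); its denominator has order L^(-1/32), the relative size of the deficit
  L^(31/32).\<close>

lemma disjoint_edges_error_tendsto_0:
  fixes p \<gamma> \<epsilon> d :: real
  assumes "0 < p" "0 < \<gamma>" "0 < \<epsilon>" "0 < d"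
  defines "u \<equiv> \<lambda>L. ((L - 2 * L powr (1/2)) / (L + 2 * L powr (3/4))) powr p"
  shows "((\<lambda>L. (1 - u L + d * ((\<epsilon> / 2 * L powr (31/32) + 2 * L powr (3/4)) / L) powr p + d * L powr (-1/16)) +
     (1 - u L + d * L powr (-1/16)) / (1 - ((L - \<epsilon> / 2 * L powr (31/32)) / L) powr \<gamma>)) \<longlongrightarrow> 0) at_top"
  using assms(1-4) unfolding u_def by real_asymp

text \<open>In order: some list costs too much, no edge exceeds y, a heavy edge lies in a triangle,
  too many edges are selected. The second term decays slowest, and its factor 2 in the exponent
  leaves room for the required bound.\<close>

lemma disjoint_edges_failure_le:
  fixes \<epsilon> A B E :: real
  assumes "0 < \<epsilon>" "0 < A" "0 < B" "0 < E"
  shows "\<forall>\<^sub>F L in at_top. exp (- (L powr (3/4)) + (3 + L powr (1/8) + 2 * (L powr (1/8) + 2)\<^sup>2) * (2 * ln L)) +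
     A * exp (- (2 * L powr (1/2))) + B * exp (- (L / (L powr (1/8) + 1))) + E * exp (- (\<epsilon> / 2 * L powr (31/32)))
     \<le> exp (- (L powr (1/2)))"
proof -
  have 1: "\<forall>\<^sub>F L :: real in at_top. exp (- (L powr (3/4)) + (3 + L powr (1/8) + 2 * (L powr (1/8) + 2)\<^sup>2) * (2 * ln L)) \<le> exp (- (L powr (1/2))) / 4"
    by real_asymp
  have 2: "\<forall>\<^sub>F L in at_top. A * exp (- (2 * L powr (1/2))) \<le> exp (- (L powr (1/2))) / 4"
    using assms by real_asymp
  have 3: "\<forall>\<^sub>F L in at_top. B * exp (- (L / (L powr (1/8) + 1))) \<le> exp (- (L powr (1/2))) / 4"
    using assms by real_asymp
  have 4: "\<forall>\<^sub>F L in at_top. E * exp (- (\<epsilon> / 2 * L powr (31/32))) \<le> exp (- (L powr (1/2))) / 4"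
    using assms by real_asymp
  from 1 2 3 4 show ?thesis by eventually_elim linarith
qed


lemma ex_few_vertices_params:
  fixes \<alpha> C c \<epsilon> :: real and d :: nat
  assumes \<alpha>: "0 < \<alpha>" and d: "0 < d" and C: "1 \<le> C" and c: "0 < c" "c \<le> 1" and \<epsilon>: "0 < \<epsilon>" "\<epsilon> < 1"
  shows "\<exists>N. \<forall>n\<ge>N. \<exists>K T s y0 h \<delta> q R. few_vertices_params \<alpha> d C c \<epsilon> n K T s y0 h \<delta> q R \<and>
    q + real (K * (K * (K * d) ^ K)) / \<delta> + (1 + R * (1 + R * \<delta>)) * real K / real n powr \<epsilon>
      \<le> exp (- (ln (real n) powr (1/2)))"
    (is "\<exists>N. \<forall>n\<ge>N. \<exists>K T s y0 h \<delta> q R. ?P n K T s y0 h \<delta> q R")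
proof -
  \<comment> \<open>As T is about 3 * L, raising the weights costs about exp (\<epsilon> / 48 * 3 *
    L) = exp (\<epsilon> / 16 * L). An equal amount absorbs the polynomial factors, so R is at most
    exp (\<epsilon> / 8 * L).\<close>
  define s where "s = (1 + \<epsilon> / 48) powr (1 / \<alpha>)"
  have s1: "1 < s" unfolding s_def using \<alpha> \<epsilon> by (intro gr_one_powr) auto
  have sa: "s powr \<alpha> = 1 + \<epsilon> / 48" unfolding s_def using \<alpha> \<epsilon> by (simp add: powr_powr)
  \<comment> \<open>The largest ratio h^(1 / \<alpha>) / y0 allowed by the smallness condition.
    Since \<open>y0 powr \<alpha>\<close> will be L / 4, it is attained by h = \<beta> * L.\<close>
  define r where "r = \<epsilon> * (1 - 1 / s) / d"
  have r: "0 < r" unfolding r_def using \<epsilon> s1 d by simp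
  define \<beta> where "\<beta> = r powr \<alpha> / 4"
  have \<beta>: "0 < \<beta>" using r by (simp add: \<beta>_def)
  \<comment> \<open>Then K * h \<ge> 4 * L, which exceeds T + m for large L; the 2 makes room for
    single edges.\<close>
  define K where "K = max 2 (nat \<lceil>4 / \<beta>\<rceil>)"
  have K2: "2 \<le> K" by (simp add: K_def)
  have "4 / \<beta> \<le> real K" unfolding K_def by linarith
  then have K4: "4 \<le> real K * \<beta>" using \<beta> by (simp add: field_simps)
  define m where "m = Suc K * Suc K"
  define b where "b = Suc K * (Suc K * d) ^ Suc K"
  define D where "D = real (K * (K * (K * d) ^ K))"
  define A where "A = (C / c) ^ m * exp ((1 + \<epsilon> / 48) * m + \<epsilon> / 48 * (1 + m))"
  have "\<forall>\<^sub>F L in at_top. exp (- L) + D * exp (- (\<epsilon> * L / 4)) + 3 * real K * exp (- (\<epsilon> * L / 2)) \<le> exp (- (L powr (1/2)))"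
    using \<epsilon> by (intro few_vertices_failure_le) (auto simp: D_def)
  moreover have "\<forall>\<^sub>F L in at_top. A * (3 * L + (2 + real m)) ^ m \<le> exp (\<epsilon> / 16 * L)"
    using \<epsilon> by (intro eventually_poly_le_exp) auto
  moreover have "\<forall>\<^sub>F L in at_top. (real b * C ^ m) * (3 * L + 2) ^ m \<le> exp (1 * L)"
    by (intro eventually_poly_le_exp) auto
  moreover have "\<forall>\<^sub>F L in at_top. exp 1 / c \<le> exp (L / 2)" using c by real_asymp
  moreover have "\<forall>\<^sub>F L in at_top. L \<ge> real m + 1" by (rule eventually_ge_at_top)
  moreover have "\<forall>\<^sub>F L :: real in at_top. L \<ge> 1" by (rule eventually_ge_at_top)
  ultimately have "\<forall>\<^sub>F L in at_top. \<forall>n. L = ln (real n) \<longrightarrow>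
    (\<exists>K T s y0 h \<delta> q R. ?P n K T s y0 h \<delta> q R)"
  proof eventually_elim
    case (elim L)
    show ?case
    proof (intro allI impI)
      fix n assume Ln: "L = ln (real n)"
      have n: "real n = exp L" using elim(6) Ln by (cases "n = 0") auto
      \<comment> \<open>One L pays for the factor n in the number of lists, one for the polynomial
        factors, and one remains as the failure probability exp (- L).\<close>
      define T where "T = nat \<lceil>3 * L\<rceil>"
      have T: "3 * L \<le> real T" "real T \<le> 3 * L + 1" unfolding T_def using elim(6) by linarith+
      \<comment> \<open>At this level about exp (3 * L / 4) edges are expected; exp (L / 2) absorbs
        the constants, and exp (L / 4) \<ge> \<delta> remains because \<epsilon> < 1.\<close>
      define y0 where "y0 = (L / 4) powr (1 / \<alpha>)"
      define h where "h = \<beta> * L"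
      \<comment> \<open>Two comparison steps of factor R \<le> exp (\<epsilon> * L / 8) then give R
        * R * \<delta> \<le> n^(\<epsilon> / 2), so Markov's inequality at level n^\<epsilon> still
        gains n^(- \<epsilon> / 2).\<close>
      define \<delta> where "\<delta> = exp (\<epsilon> * L / 4)"
      define q where "q = real (n * b) * ((real T + 1) ^ m * C ^ m * exp (- real T))"
      define R where "R = (real (T + m) + 1) ^ m * (C / c) ^ m *
        exp (s powr \<alpha> * real m + (s powr \<alpha> - 1) * real (T + m))"
      have L: "L > 0" using elim(6) by simp
      have ya: "y0 powr \<alpha> = L / 4" unfolding y0_def using \<alpha> L by (simp add: powr_powr)
      have h1: "real (T + m) \<le> real K * h"
      proof -
        have "real (T + m) \<le> 4 * L" using T elim(5) by simp
        also have "\<dots> \<le> (real K * \<beta>) * L" using K4 L by (intro mult_right_mono) auto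
        finally show ?thesis by (simp add: h_def)
      qed
      have h2: "real d * h powr (1 / \<alpha>) \<le> \<epsilon> * (1 - 1 / s) * y0"
      proof -
        have "h = r powr \<alpha> * (L / 4)" by (simp add: h_def \<beta>_def)
        then have "h powr (1 / \<alpha>) = (r powr \<alpha> * (L / 4)) powr (1 / \<alpha>)" by (rule arg_cong)
        also have "\<dots> = (r powr \<alpha>) powr (1 / \<alpha>) * (L / 4) powr (1 / \<alpha>)"
          using r L by (simp add: powr_mult del: times_divide_eq_right)
        also have "\<dots> = r * y0" using r \<alpha> by (simp add: powr_powr y0_def)
        finally have "h powr (1 / \<alpha>) = r * y0" .
        then show ?thesis using d by (simp add: r_def)
      qed
      have d1: "1 < \<delta>" using \<epsilon> L by (simp add: \<delta>_def)
      have d2: "\<delta> \<le> real n * (c * exp (- (y0 powr \<alpha> + 1)))"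
      proof -
        have "exp (\<epsilon> * L / 4) \<le> exp (L / 4)" using \<epsilon> L by (simp add: mult_left_le_one_le)
        also have "exp (L / 4) = exp (L - L / 4 - 1) * (exp 1 / exp (L / 2))"
          by (simp add: exp_diff[symmetric] exp_add[symmetric])
        also have "\<dots> \<le> exp (L - L / 4 - 1) * c"
        proof (rule mult_left_mono)
          show "exp 1 / exp (L / 2) \<le> c" using elim(4) c by (simp add: field_simps)
        qed simp
        also have "exp (L - L / 4 - 1) = exp L * exp (- (L / 4 + 1))" by (simp add: exp_add[symmetric])
        also have "exp L * exp (- (L / 4 + 1)) * c = real n * (c * exp (- (y0 powr \<alpha> + 1)))"
          by (simp add: n ya)
        finally show ?thesis by (simp add: \<delta>_def)
      qed
      have q1: "q \<le> exp (- L)"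
      proof -
        have "q = exp L * (real b * C ^ m * (real T + 1) ^ m) * exp (- real T)"
          by (simp add: q_def n algebra_simps)
        also have "\<dots> \<le> exp L * exp L * exp (- (3 * L))"
        proof (intro mult_mono mult_left_mono)
          have "real b * C ^ m * (real T + 1) ^ m \<le> real b * C ^ m * (3 * L + 2) ^ m"
            using T C by (intro mult_left_mono power_mono) auto
          then show "real b * C ^ m * (real T + 1) ^ m \<le> exp L" using elim(3) by simp
        qed (use T C in auto)
        also have "\<dots> = exp (- L)" by (simp add: exp_add[symmetric])
        finally show ?thesis .
      qed
      then have q2: "q \<le> 1" using L by (meson exp_le_one_iff neg_le_0_iff_le order.trans less_imp_le)
      have R1: "R \<le> exp (\<epsilon> / 8 * L)"
      proof -
        have "exp (s powr \<alpha> * real m + (s powr \<alpha> - 1) * real (T + m)) \<le>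
            exp ((1 + \<epsilon> / 48) * m + \<epsilon> / 48 * (1 + m)) * exp (\<epsilon> / 16 * L)"
        proof -
          have "\<epsilon> / 48 * real (T + m) \<le> \<epsilon> / 48 * (3 * L + 1 + m)" using T \<epsilon> by (intro mult_left_mono) auto
          also have "\<dots> = \<epsilon> / 16 * L + \<epsilon> / 48 * (1 + m)" by (simp add: field_simps)
          finally show ?thesis unfolding sa exp_add[symmetric] exp_le_cancel_iff by (simp del: of_nat_add)
        qed
        moreover have "(real (T + m) + 1) ^ m \<le> (3 * L + (2 + real m)) ^ m" using T by (intro power_mono) auto
        ultimately have "R \<le> (3 * L + (2 + real m)) ^ m * (C / c) ^ m *
            (exp ((1 + \<epsilon> / 48) * m + \<epsilon> / 48 * (1 + m)) * exp (\<epsilon> / 16 * L))"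
          unfolding R_def using C c L by (intro mult_mono) auto
        also have "\<dots> = A * (3 * L + (2 + real m)) ^ m * exp (\<epsilon> / 16 * L)" by (simp add: A_def algebra_simps)
        also have "\<dots> \<le> exp (\<epsilon> / 16 * L) * exp (\<epsilon> / 16 * L)" using elim(2) by (intro mult_right_mono) auto
        also have "\<dots> = exp (\<epsilon> / 8 * L)" by (simp add: exp_add[symmetric])
        finally show ?thesis .
      qed
      have R0: "0 \<le> R" unfolding R_def using C c by (intro mult_nonneg_nonneg) auto
      have total: "q + D / \<delta> + (1 + R * (1 + R * \<delta>)) * real K / real n powr \<epsilon> \<le> exp (- (L powr (1/2)))"
      proof -
        have "1 + R * (1 + R * \<delta>) \<le> 3 * exp (\<epsilon> / 2 * L)"
        proof -
          have "R \<le> exp (\<epsilon> / 2 * L)"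
            by (rule order.trans[OF R1]) (use \<epsilon> L in \<open>simp add: mult_right_mono\<close>)
          moreover have "R * R * \<delta> \<le> exp (\<epsilon> / 8 * L) * exp (\<epsilon> / 8 * L) * \<delta>"
            using R0 R1 by (intro mult_mono) (auto simp: \<delta>_def)
          moreover have "exp (\<epsilon> / 8 * L) * exp (\<epsilon> / 8 * L) * \<delta> = exp (\<epsilon> / 2 * L)"
            by (simp add: \<delta>_def exp_add[symmetric])
          moreover have "1 \<le> exp (\<epsilon> / 2 * L)" using \<epsilon> L by simp
          moreover have "1 + R * (1 + R * \<delta>) = 1 + R + R * R * \<delta>" by (simp add: algebra_simps)
          ultimately show ?thesis by linarith
        qed
        then have "(1 + R * (1 + R * \<delta>)) * real K / exp (\<epsilon> * L) \<le> 3 * exp (\<epsilon> / 2 * L) * real K / exp (\<epsilon> * L)"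
          by (intro divide_right_mono mult_right_mono) auto
        also have "3 * exp (\<epsilon> / 2 * L) * real K / exp (\<epsilon> * L) = 3 * real K * exp (- (\<epsilon> * L / 2))"
        proof -
          have "exp (\<epsilon> / 2 * L) / exp (\<epsilon> * L) = exp (- (\<epsilon> * L / 2))"
            by (simp add: exp_diff[symmetric])
          then show ?thesis by (simp add: field_simps)
        qed
        finally have "(1 + R * (1 + R * \<delta>)) * real K / exp (\<epsilon> * L) \<le> 3 * real K * exp (- (\<epsilon> * L / 2))" .
        moreover have "real n powr \<epsilon> = exp (\<epsilon> * L)" using n by (simp add: powr_def)
        ultimately have "(1 + R * (1 + R * \<delta>)) * real K / real n powr \<epsilon> \<le> 3 * real K * exp (- (\<epsilon> * L / 2))" by simp
        moreover have "D / \<delta> = D * exp (- (\<epsilon> * L / 4))" by (simp add: \<delta>_def exp_minus field_simps)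
        ultimately show ?thesis using q1 elim(1) by linarith
      qed
      have "?P n K T s y0 h \<delta> q R"
        unfolding few_vertices_params_def m_def[symmetric] b_def[symmetric] D_def[symmetric] Ln[symmetric]
        using s1 K2 h1 h2 d1 d2 q2 total L \<beta> by (auto simp: y0_def h_def q_def R_def)
      then show "\<exists>K T s y0 h \<delta> q R. ?P n K T s y0 h \<delta> q R" by blast
    qed
  qed
  from eventually_sequentially_ln[OF this] show ?thesis by blast
qed

lemma ex_disjoint_edges_params:
  fixes \<alpha> C c \<epsilon> :: real and d :: nat
  assumes \<alpha>: "0 < \<alpha>" "\<alpha> < 2" and d: "0 < d" and C: "1 \<le> C" and c: "0 < c" "c \<le> 1" and \<epsilon>: "0 < \<epsilon>" "\<epsilon> < 1"
  shows "\<exists>N. \<forall>n\<ge>N. \<exists>K T h \<theta> y a \<rho>. disjoint_edges_params \<alpha> d \<epsilon> K T h \<theta> y a \<rho> \<and>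
    real (n * (Suc K * (Suc K * d) ^ Suc K)) *
      ((real T + 1) ^ (Suc K * Suc K) * C ^ (Suc K * Suc K) * exp (- real T)) +
    real (2 * (2 * (2 * d) ^ 2)) / (real n * (c * exp (- (y powr \<alpha> + 1)))) +
    real (2 * d ^ 3) * (C * exp (- h)) +
    real (n * d) * (C * exp (- \<theta>)) / exp (\<epsilon> * ln (real n) powr (31/32))
      \<le> exp (- (ln (real n) powr (1/2)))"
    (is "\<exists>N. \<forall>n\<ge>N. \<exists>K T h \<theta> y a \<rho>. ?P n K T h \<theta> y a \<rho>")
proof -
  define p where "p = 1 / \<alpha>"
  \<comment> \<open>With S = T + (K + 1)^2 the ratio \<rho> / a equals (\<theta> / S)^\<gamma>;
    positivity of \<gamma> is the condition \<alpha> < 2.\<close>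
  define \<gamma> where "\<gamma> = 1 / \<alpha> - 1 / 2"
  have p: "1 / 2 < p" "0 < p" using \<alpha> by (auto simp: p_def field_simps)
  have \<gamma>: "0 < \<gamma>" using p by (simp add: \<gamma>_def p_def)
  define u where "u L = ((L - 2 * L powr (1/2)) / (L + 2 * L powr (3/4))) powr p" for L
  define lim where "lim L = (1 - u L + d * ((\<epsilon> / 2 * L powr (31/32) + 2 * L powr (3/4)) / L) powr p + d * L powr (-1/16)) +
     (1 - u L + d * L powr (-1/16)) / (1 - ((L - \<epsilon> / 2 * L powr (31/32)) / L) powr \<gamma>)" for L
  define A where "A = real (2 * (2 * (2 * d) ^ 2)) * exp 1 / c"
  define B where "B = real (2 * d ^ 3) * C"
  have "((\<lambda>L. lim L) \<longlongrightarrow> 0) at_top"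
    unfolding lim_def u_def by (rule disjoint_edges_error_tendsto_0) (use p \<gamma> \<epsilon> d in auto)
  then have "\<forall>\<^sub>F L in at_top. lim L < \<epsilon>" using \<epsilon> by (intro order_tendstoD)
  moreover have "\<forall>\<^sub>F L in at_top. exp (- (L powr (3/4)) + (3 + L powr (1/8) + 2 * (L powr (1/8) + 2)\<^sup>2) * (2 * ln L)) +
     A * exp (- (2 * L powr (1/2))) + B * exp (- (L / (L powr (1/8) + 1))) + (d * C) * exp (- (\<epsilon> / 2 * L powr (31/32)))
     \<le> exp (- (L powr (1/2)))"
    using \<epsilon> C c d by (intro disjoint_edges_failure_le) (auto simp: A_def B_def)
  moreover have "\<forall>\<^sub>F L :: real in at_top. L + L powr (3/4) + 1 + (L powr (1/8) + 2)\<^sup>2 \<le> L + 2 * L powr (3/4)" by real_asymp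
  moreover have "\<forall>\<^sub>F L in at_top. (L + 2 * L powr (3/4)) / L powr (1/8) \<le> L - \<epsilon> / 2 * L powr (31/32)" using \<epsilon> by real_asymp
  moreover have "\<forall>\<^sub>F L in at_top. L + 2 * L powr (3/4) \<le> 2 * (L - \<epsilon> / 2 * L powr (31/32))" using \<epsilon> by real_asymp
  moreover have "\<forall>\<^sub>F L in at_top. (L powr (1/8) + 2) * d \<le> L\<^sup>2" using d by real_asymp
  moreover have "\<forall>\<^sub>F L :: real in at_top. L powr (1/8) + 2 \<le> L\<^sup>2" by real_asymp
  moreover have "\<forall>\<^sub>F L :: real in at_top. L + L powr (3/4) + 2 \<le> L\<^sup>2" by real_asymp
  moreover have "\<forall>\<^sub>F L in at_top. C \<le> L\<^sup>2" by real_asymp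
  moreover have "\<forall>\<^sub>F L :: real in at_top. 0 < L - 2 * L powr (1/2)" by real_asymp
  moreover have "\<forall>\<^sub>F L :: real in at_top. L \<ge> 1" by (rule eventually_ge_at_top)
  moreover have "\<forall>\<^sub>F L in at_top. 0 < L - \<epsilon> / 2 * L powr (31/32)" using \<epsilon> by real_asymp
  ultimately have "\<forall>\<^sub>F L in at_top. \<forall>n. L = ln (real n) \<longrightarrow> (\<exists>K T h \<theta> y a \<rho>. ?P n K T h \<theta> y a \<rho>)"
  proof eventually_elim
    case (elim L)
    show ?case
    proof (intro allI impI)
      fix n assume Ln: "L = ln (real n)"
      have L: "L \<ge> 1" "L > 0" using elim(11) by auto
      have n: "real n = exp L" using L Ln by (cases "n = 0") auto
      \<comment> \<open>K grows, so that h = S / K is of smaller order than L. It grows slowly, so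
        that the union bound over profiles, of exponent K^2 * ln L up to constants, stays below
        L^(3/4).\<close>
      define K where "K = nat \<lceil>L powr (1/8)\<rceil>"
      have K: "L powr (1/8) \<le> real K" "real K \<le> L powr (1/8) + 1"
        unfolding K_def using powr_ge_zero[of L "1/8"] by linarith+
      have K0: "0 < real K" using K(1) L by (smt (verit) powr_gt_zero)
      define m where "m = Suc K * Suc K"
      have m: "real m \<le> (L powr (1/8) + 2)\<^sup>2"
      proof -
        have "real m = (real K + 1)\<^sup>2" by (simp add: m_def power2_eq_square algebra_simps)
        also have "\<dots> \<le> (L powr (1/8) + 2)\<^sup>2" using K by (intro power_mono) auto
        finally show ?thesis .
      qed
      \<comment> \<open>The first L cancels the factor n in the number of lists; the excess L^(3/4)
        beats the union bound and is negligible against L^(31/32).\<close>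
      define T where "T = nat \<lceil>L + L powr (3/4)\<rceil>"
      have T: "L + L powr (3/4) \<le> real T" "real T \<le> L + L powr (3/4) + 1"
        unfolding T_def using L powr_ge_zero[of L "3/4"] by linarith+
      define S where "S = real (T + m)"
      have Sm: "S = real T + real m" by (simp add: S_def)
      have S: "L \<le> S" "S \<le> L + 2 * L powr (3/4)"
        using T m elim(3) powr_ge_zero[of L "3/4"] of_nat_0_le_iff[of m, where 'a=real] unfolding Sm by linarith+
      have S0: "S > 0" using S L by linarith
      define h where "h = S / real K"
      \<comment> \<open>The expected number of selected edges is at most d * C * exp (\<epsilon> / 2
        * L^(31/32)); the other half of the allowed exponent is spent in Markov's
        inequality.\<close>
      define \<theta> where "\<theta> = L - \<epsilon> / 2 * L powr (31/32)"
      \<comment> \<open>An expected number of order at least exp (2 * L^(1/2)) of edges exceeds y;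
        the second moment bound is its inverse up to constants.\<close>
      define y where "y = (L - 2 * L powr (1/2)) powr p"
      define a where "a = S powr p"
      define \<rho> where "\<rho> = sqrt (\<theta> powr (2 / \<alpha> - 1) * S)"
      have a0: "a > 0" using S0 by (simp add: a_def)
      have h0: "0 \<le> h" using S0 by (simp add: h_def)
      have Kh: "S = real K * h" using K0 by (simp add: h_def)
      have \<theta>0: "0 < \<theta>" using elim(12) by (simp add: \<theta>_def)
      have D0: "0 \<le> \<epsilon> / 2 * L powr (31/32)" using \<epsilon> by simp
      have h\<theta>: "h \<le> \<theta>"
      proof -
        have "h \<le> (L + 2 * L powr (3/4)) / L powr (1/8)"
          unfolding h_def using S K L S0 by (intro frac_le) auto
        then show ?thesis using elim(4) by (simp add: \<theta>_def)
      qed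
      have S\<theta>: "S \<le> 2 * \<theta>" using S(2) elim(5) by (simp add: \<theta>_def)
      have \<theta>S: "\<theta> \<le> S" using S(1) D0 by (simp add: \<theta>_def)
      have y0: "0 < y" using elim(10) by (simp add: y_def)
      have ya: "y powr \<alpha> = L - 2 * L powr (1/2)"
        using elim(10) \<alpha> by (simp add: y_def p_def powr_powr)
      have ua: "u L * a \<le> y"
      proof -
        have "u L \<le> ((L - 2 * L powr (1/2)) / S) powr p"
          unfolding u_def using S S0 L elim(10) p by (intro powr_mono2 divide_left_mono) auto
        also have "\<dots> = y / a" unfolding y_def a_def using elim(10) S0 by (simp add: powr_divide)
        finally show ?thesis using a0 by (simp add: field_simps)
      qed
      have hd: "h powr p \<le> L powr (-1/16) * a"
      proof -
        have "h powr p = (1 / real K) powr p * a" using S0 K0 by (simp add: h_def a_def powr_divide)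
        also have "(1 / real K) powr p \<le> (L powr (-1/8)) powr p"
        proof (rule powr_mono2)
          have "1 / real K \<le> 1 / L powr (1/8)" using K L K0 by (intro divide_left_mono) auto
          then show "1 / real K \<le> L powr (-1/8)" using L by (simp add: powr_minus_divide)
        qed (use p in auto)
        also have "(L powr (-1/8)) powr p = L powr (- p / 8)" by (simp add: powr_powr)
        \<comment> \<open>Here \<alpha> < 2 enters as p > 1/2, which makes the exponent independent
          of \<alpha>.\<close>
        also have "\<dots> \<le> L powr (-1/16)" using L p by (intro powr_mono) auto
        finally show ?thesis using a0 by (simp add: mult_right_mono)
      qed
      have \<eta>: "(S - \<theta>) powr p \<le> ((\<epsilon> / 2 * L powr (31/32) + 2 * L powr (3/4)) / L) powr p * a"
      proof -
        have "(S - \<theta>) powr p = ((S - \<theta>) / S) powr p * a"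
          using S0 \<theta>S by (simp add: a_def powr_divide)
        also have "((S - \<theta>) / S) powr p \<le> ((\<epsilon> / 2 * L powr (31/32) + 2 * L powr (3/4)) / L) powr p"
          using S L \<theta>S p S0 D0 by (intro powr_mono2 frac_le) (auto simp: \<theta>_def)
        finally show ?thesis using a0 by (simp add: mult_right_mono)
      qed
      define r where "r = ((L - \<epsilon> / 2 * L powr (31/32)) / L) powr \<gamma>"
      have \<rho>r: "\<rho> \<le> r * a"
      proof -
        have "\<rho> = (\<theta> powr (2 * \<gamma>) * S) powr (1/2)"
          unfolding \<rho>_def using S0 by (simp add: powr_half_sqrt \<gamma>_def)
        also have "\<dots> = \<theta> powr \<gamma> * S powr (1/2)" using S0 by (simp add: powr_mult powr_powr)
        also have "\<dots> = (\<theta> / S) powr \<gamma> * a"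
        proof -
          have "a = S powr \<gamma> * S powr (1/2)" by (simp add: a_def p_def \<gamma>_def powr_add[symmetric])
          then show ?thesis using S0 \<theta>0 by (simp add: powr_divide)
        qed
        also have "(\<theta> / S) powr \<gamma> \<le> r"
          unfolding r_def \<theta>_def[symmetric] using S L \<theta>0 \<gamma> S0
          by (intro powr_mono2 divide_left_mono) auto
        finally show ?thesis using a0 by (simp add: mult_right_mono)
      qed
      have r1: "r < 1"
      proof -
        have "(L - \<epsilon> / 2 * L powr (31/32)) / L < 1" using \<epsilon> L by (simp add: field_simps)
        moreover have "0 \<le> (L - \<epsilon> / 2 * L powr (31/32)) / L" using elim(12) L by simp
        ultimately have "r < 1 powr \<gamma>" unfolding r_def using \<gamma> by (intro powr_less_mono2) auto
        then show ?thesis by simp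
      qed
      have \<rho>a: "\<rho> < a"
      proof -
        have "r * a < 1 * a" using r1 a0 by (intro mult_strict_right_mono)
        then show ?thesis using \<rho>r by simp
      qed
      define e where "e = ((\<epsilon> / 2 * L powr (31/32) + 2 * L powr (3/4)) / L) powr p"
      define w where "w = L powr (-1/16)"
      have u1: "u L \<le> 1"
      proof -
        have "(L - 2 * L powr (1/2)) / (L + 2 * L powr (3/4)) \<le> 1"
        proof -
          have "0 < L + 2 * L powr (3/4)" using L powr_ge_zero[of L "3/4"] by linarith
          then show ?thesis
            using powr_ge_zero[of L "1/2"] powr_ge_zero[of L "3/4"] unfolding divide_le_eq_1 by linarith
        qed
        then have "u L \<le> 1 powr p"
          unfolding u_def using p L elim(10) by (intro powr_mono2) auto
        then show ?thesis by simp
      qed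
      have n1: "(a - y + d * (S - \<theta>) powr p + d * h powr p) / a \<le> 1 - u L + d * e + d * w"
      proof -
        have "d * (S - \<theta>) powr p \<le> d * (e * a)" "d * h powr p \<le> d * (w * a)"
          using \<eta> hd by (auto simp: e_def w_def intro!: mult_left_mono)
        then have "a - y + d * (S - \<theta>) powr p + d * h powr p \<le> (1 - u L + d * e + d * w) * a"
          using ua by (simp add: algebra_simps)
        then show ?thesis using a0 by (simp add: pos_divide_le_eq)
      qed
      have n2: "(a - y + d * h powr p) / (a - \<rho>) \<le> (1 - u L + d * w) / (1 - r)"
      proof -
        have "d * h powr p \<le> d * (w * a)" using hd by (auto simp: w_def intro!: mult_left_mono)
        then have 1: "a - y + d * h powr p \<le> (1 - u L + d * w) * a"
          using ua by (simp add: algebra_simps)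
        have 2: "(1 - r) * a \<le> a - \<rho>" using \<rho>r by (simp add: algebra_simps)
        have "(a - y + d * h powr p) / (a - \<rho>) \<le> ((1 - u L + d * w) * a) / ((1 - r) * a)"
          using 1 2 a0 r1 u1 by (intro frac_le) (auto simp: w_def)
        then show ?thesis using a0 by simp
      qed
      have num: "(a - y + d * (S - \<theta>) powr p + d * h powr p) / a + (a - y + d * h powr p) / (a - \<rho>) \<le> \<epsilon>"
        using n1 n2 elim(1) unfolding lim_def e_def[symmetric] w_def[symmetric] r_def[symmetric] by linarith
      have t1: "real (n * (Suc K * (Suc K * d) ^ Suc K)) * ((real T + 1) ^ m * C ^ m * exp (- real T)) \<le>
          exp (- (L powr (3/4)) + (3 + L powr (1/8) + 2 * (L powr (1/8) + 2)\<^sup>2) * (2 * ln L))"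
      proof -
        \<comment> \<open>A common bound for K + 1, (K + 1) * d, T + 1 and C, so that the union
          bound becomes a power of X.\<close>
        define X where "X = L\<^sup>2"
        have X1: "1 \<le> X" using L by (simp add: X_def)
        have b1: "real (Suc K) \<le> X" using K elim(7) by (simp add: X_def)
        have b2: "real (Suc K * d) \<le> X"
        proof -
          have "real (Suc K) * real d \<le> (L powr (1/8) + 2) * real d" using K by (intro mult_right_mono) auto
          then show ?thesis using elim(6) unfolding X_def of_nat_mult by (rule order.trans)
        qed
        have b3: "real T + 1 \<le> X" using T elim(8) by (simp add: X_def)
        have b4: "C \<le> X" using elim(9) by (simp add: X_def)
        have "real (n * (Suc K * (Suc K * d) ^ Suc K)) * ((real T + 1) ^ m * C ^ m * exp (- real T)) =
          exp L * exp (- real T) * (real (Suc K) * real (Suc K * d) ^ Suc K * ((real T + 1) ^ m * C ^ m))"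
          by (simp add: n algebra_simps)
        also have "\<dots> \<le> exp L * exp (- (L + L powr (3/4))) * (X * X ^ Suc K * (X ^ m * X ^ m))"
          using b1 b2 b3 b4 C T X1 by (intro mult_mono power_mono) (auto simp del: power_Suc of_nat_Suc)
        also have "X * X ^ Suc K * (X ^ m * X ^ m) = X ^ (1 + Suc K + (m + m))"
          by (simp only: power_add power_one_right)
        also have "1 + Suc K + (m + m) = 2 + K + 2 * m" by simp
        also have "X ^ (2 + K + 2 * m) = exp (real (2 + K + 2 * m) * (2 * ln L))"
        proof -
          have "X = exp (2 * ln L)" using L by (simp add: X_def exp_double)
          then show ?thesis by (simp only: exp_of_nat_mult)
        qed
        also have "\<dots> \<le> exp ((3 + L powr (1/8) + 2 * (L powr (1/8) + 2)\<^sup>2) * (2 * ln L))"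
          unfolding exp_le_cancel_iff using K m L by (intro mult_right_mono) auto
        finally show ?thesis by (simp add: exp_add[symmetric] algebra_simps)
      qed
      have t2: "real (2 * (2 * (2 * d) ^ 2)) / (real n * (c * exp (- (y powr \<alpha> + 1)))) = A * exp (- (2 * L powr (1/2)))"
      proof -
        have "real n * (c * exp (- (y powr \<alpha> + 1))) = c * exp (2 * L powr (1/2)) / exp 1"
          by (simp add: n ya exp_diff[symmetric] exp_add[symmetric] mult.left_commute[of _ c]) (simp add: exp_diff exp_add)
        moreover have "G / (c * exp t / exp 1) = G * exp 1 / c * exp (- t)" for G t :: real
          using c by (simp add: exp_minus field_simps)
        ultimately show ?thesis unfolding A_def by simp
      qed
      have t3: "real (2 * d ^ 3) * (C * exp (- h)) \<le> B * exp (- (L / (L powr (1/8) + 1)))"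
      proof -
        have "L / (L powr (1/8) + 1) \<le> h" unfolding h_def using S K K0 L by (intro frac_le) auto
        then have "B * exp (- h) \<le> B * exp (- (L / (L powr (1/8) + 1)))"
          using C by (intro mult_left_mono) (auto simp: B_def)
        then show ?thesis by (simp add: B_def)
      qed
      have t4: "real (n * d) * (C * exp (- \<theta>)) / exp (\<epsilon> * L powr (31/32)) = (d * C) * exp (- (\<epsilon> / 2 * L powr (31/32)))"
      proof -
        have "exp L * exp (- \<theta>) / exp (\<epsilon> * L powr (31/32)) = exp (- (\<epsilon> / 2 * L powr (31/32)))"
          by (simp add: exp_diff[symmetric] exp_add[symmetric] \<theta>_def)
        then show ?thesis by (simp add: n field_simps)
      qed
      have "?P n K T h \<theta> y a \<rho>"
        unfolding disjoint_edges_params_def m_def[symmetric] S_def[symmetric] p_def[symmetric] Ln[symmetric]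
        using h0 Kh h\<theta> S\<theta> \<theta>S y0 \<rho>a num t1 t2 t3 t4 elim(2) by (auto simp: a_def \<rho>_def)
      then show "\<exists>K T h \<theta> y a \<rho>. ?P n K T h \<theta> y a \<rho>" by blast
    qed
  qed
  from eventually_sequentially_ln[OF this] show ?thesis by blast
qed

section \<open>Localization on few vertices\<close>

context weighted_graph
begin

text \<open>The family \<I> of admissible supports is a parameter, so that small sets and covers by
  matchings are treated alike.\<close>

definition localized_event :: "nat set set \<Rightarrow> real \<Rightarrow> 'a set" where
  "localized_event \<I> \<epsilon> = {\<omega> \<in> space M. \<forall>f. rayleigh_max n (wmat adj (\<lambda>p. V p \<omega>)) f \<and> sqn {..<n} f > 0 \<longrightarrow>
     (\<exists>I\<in>\<I>. (1 - \<epsilon>) * sqrt (sqn {..<n} f) \<le> sqrt (sqn I f))}"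

lemma localized_event_sets:
  assumes "\<And>I. I \<in> \<I> \<Longrightarrow> I \<subseteq> {..<n}"
  shows "localized_event \<I> \<epsilon> \<in> events"
  unfolding localized_event_def
proof (rule sets_maximizers_localized)
  show "(\<lambda>\<omega>. wmat adj (\<lambda>p. V p \<omega>) i j) \<in> borel_measurable M" for i j
    unfolding wmat_def using V_meas[OF sort_pair_in_pairs] by (cases "adj i j") auto
  show "finite \<I>" by (rule finite_subset[of _ "Pow {..<n}"]) (use assms in auto)
qed (use assms in auto)

lemma prob_exists_cost_le:
  "prob {\<omega> \<in> space M. \<exists>xs\<in>growing_lists {..<n} adj K. real (T + K * K) \<le> cost (\<lambda>p. V p \<omega>) (set xs)} \<le>
    n * (K * (K * d) ^ K) * ((real T + 1) ^ (K * K) * C ^ (K * K) * exp (- real T))"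
proof -
  let ?G = "growing_lists {..<n} adj K"
  let ?E = "\<lambda>xs. {\<omega> \<in> space M. real (T + K * K) \<le> cost (\<lambda>p. V p \<omega>) (set xs)}"
  have m: "?E xs \<in> events" if "xs \<in> ?G" for xs
    by (intro borel_measurable_le borel_measurable_const cost_meas growing_list_subset[OF that])
  have "{\<omega> \<in> space M. \<exists>xs\<in>?G. real (T + K * K) \<le> cost (\<lambda>p. V p \<omega>) (set xs)} = (\<Union>xs\<in>?G. ?E xs)" by auto
  also have "prob \<dots> \<le> (\<Sum>xs\<in>?G. prob (?E xs))"
    using finite_growing m by (intro finite_measure_subadditive_finite) auto
  also note prob_cost_growing_le
  finally show ?thesis .
qed

lemma exists_cost_event:
  "{\<omega> \<in> space M. \<exists>xs\<in>growing_lists {..<n} adj K. t \<le> cost (\<lambda>p. V p \<omega>) (set xs)} \<in> events"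
  using finite_growing
  by (intro sets.sets_Collect_finite_Ex borel_measurable_le borel_measurable_const cost_meas growing_list_subset)

lemma no_high_event:
  "{\<omega> \<in> space M. \<forall>xs\<in>growing_lists {..<n} adj K. \<not> high adj (set xs) y (\<lambda>p. V p \<omega>)} \<in> events"
  using finite_growing by (intro sets.sets_Collect_finite_All sets.sets_Collect_neg high_event)

lemma growing_lists_mono: "K \<le> K' \<Longrightarrow> growing_lists U E K \<subseteq> growing_lists U E K'"
  by (auto simp: growing_lists_def)

text \<open>The three subtracted terms bound three failures: a list of excessive cost
  (\<open>F1\<close>), no list high at the threshold y (\<open>F2\<close>), too many lists high at z
  = y / s (\<open>F3\<close>). Outside them \<open>high_blocks_localize\<close> applies to every
  maximizer.\<close>

lemma prob_localized_few_vertices: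
  assumes \<epsilon>: "0 < \<epsilon>" "\<epsilon> < 1"
    and par: "few_vertices_params \<alpha> d C c \<epsilon> n K T s y0 h \<delta> q R"
  shows "1 - (q + K * (K * (K * d) ^ K) / \<delta> + (1 + R * (1 + R * \<delta>)) * K / n powr \<epsilon>) \<le>
    prob (localized_event {I. I \<subseteq> {..<n} \<and> real (card I) \<le> n powr \<epsilon>} \<epsilon>)"
proof -
  \<comment> \<open>Bounds the number of edges inside lists of length K + 1, one more than the block
    size, as these too must have small cost.\<close>
  define m where "m = Suc K * Suc K"
  have s: "1 < s" and K: "2 \<le> K" and y0: "0 < y0"
    and h: "0 \<le> h" "real (T + m) \<le> real K * h"
    and small: "real d * h powr (1 / \<alpha>) \<le> \<epsilon> * (1 - 1 / s) * y0"
    and \<delta>: "1 < \<delta>" "\<delta> \<le> n * (c * exp (- (y0 powr \<alpha> + 1)))"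
    and q: "n * (Suc K * (Suc K * d) ^ Suc K) * ((real T + 1) ^ m * C ^ m * exp (- real T)) \<le> q" "q \<le> 1"
    and R: "(real (T + m) + 1) ^ m * (C / c) ^ m * exp (s powr \<alpha> * m + (s powr \<alpha> - 1) * real (T + m)) \<le> R"
    using par unfolding few_vertices_params_def m_def by blast+
  let ?G = "growing_lists {..<n} adj K"
  let ?G' = "growing_lists {..<n} adj (Suc K)"
  let ?T = "real (T + m)"
  let ?EN = "expected_high K"
  have n: "n > 0"
  proof (rule ccontr)
    assume "\<not> n > 0"
    then show False using \<delta> by simp
  qed
  have "0 \<le> (real (T + m) + 1) ^ m * (C / c) ^ m * exp (s powr \<alpha> * m + (s powr \<alpha> - 1) * real (T + m))"
    using C_ge c_pos by (intro mult_nonneg_nonneg) auto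
  then have R0: "0 \<le> R" using R by (rule order.trans)
  have costsum: "(\<Sum>xs\<in>?G. prob {\<omega> \<in> space M. ?T \<le> cost (\<lambda>p. V p \<omega>) (set xs)}) \<le> q"
  proof -
    have "(\<Sum>xs\<in>?G. prob {\<omega> \<in> space M. ?T \<le> cost (\<lambda>p. V p \<omega>) (set xs)}) \<le>
      (\<Sum>xs\<in>?G'. prob {\<omega> \<in> space M. ?T \<le> cost (\<lambda>p. V p \<omega>) (set xs)})"
      using finite_growing growing_lists_mono[of K "Suc K"] by (intro sum_mono2) auto
    also have "\<dots> \<le> q"
      using prob_cost_growing_le[where K = "Suc K" and T = T] q(1) unfolding m_def by (rule order_trans)
    finally show ?thesis .
  qed
  \<comment> \<open>The 1 absorbs the sum of the cost probabilities, which is at most q \<le>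
    1.\<close>
  have scale: "?EN y \<le> 1 + R * ?EN (s * y)" for y
  proof -
    have "?EN y \<le> (\<Sum>xs\<in>?G. prob {\<omega> \<in> space M. ?T \<le> cost (\<lambda>p. V p \<omega>) (set xs)} +
        R * prob {\<omega> \<in> space M. high adj (set xs) (s * y) (\<lambda>p. V p \<omega>)})"
      unfolding expected_high_def
    proof (rule sum_mono)
      fix xs assume xs: "xs \<in> ?G"
      have "card (edge_pairs adj (set xs)) \<le> card (set xs) * card (set xs)"
        by (rule card_edge_pairs_le) simp
      also have "\<dots> \<le> m" unfolding m_def
        using xs card_length[of xs] by (intro mult_mono) (auto simp: growing_lists_def)
      finally have "prob {\<omega> \<in> space M. high adj (set xs) y (\<lambda>p. V p \<omega>)} \<le>
          prob {\<omega> \<in> space M. ?T \<le> cost (\<lambda>p. V p \<omega>) (set xs)} +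
          (?T + 1) ^ m * (C / c) ^ m * exp (s powr \<alpha> * m + (s powr \<alpha> - 1) * ?T) *
          prob {\<omega> \<in> space M. high adj (set xs) (s * y) (\<lambda>p. V p \<omega>)}"
        using s by (intro prob_high_le_scaled growing_list_subset[OF xs]) auto
      also have "\<dots> \<le> prob {\<omega> \<in> space M. ?T \<le> cost (\<lambda>p. V p \<omega>) (set xs)} +
          R * prob {\<omega> \<in> space M. high adj (set xs) (s * y) (\<lambda>p. V p \<omega>)}"
        using R by (intro add_left_mono mult_right_mono) auto
      finally show "prob {\<omega> \<in> space M. high adj (set xs) y (\<lambda>p. V p \<omega>)} \<le> \<dots>" .
    qed
    also have "\<dots> \<le> 1 + R * ?EN (s * y)"
      using costsum q(2) by (simp add: sum.distrib expected_high_def sum_distrib_left)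
    finally show ?thesis .
  qed
  have large: "?EN y \<le> 1" if y: "real d * ?T powr (1 / \<alpha>) \<le> y" for y
  proof -
    have "?EN y \<le> (\<Sum>xs\<in>?G. prob {\<omega> \<in> space M. ?T \<le> cost (\<lambda>p. V p \<omega>) (set xs)})"
      unfolding expected_high_def
    proof (rule sum_mono, rule finite_measure_mono)
      fix xs assume xs: "xs \<in> ?G"
      show "{\<omega> \<in> space M. high adj (set xs) y (\<lambda>p. V p \<omega>)} \<subseteq> {\<omega> \<in> space M. ?T \<le> cost (\<lambda>p. V p \<omega>) (set xs)}"
        using high_cost_ge[OF growing_list_subset[OF xs] _ y] by auto
      show "{\<omega> \<in> space M. ?T \<le> cost (\<lambda>p. V p \<omega>) (set xs)} \<in> events"
        by (intro borel_measurable_le borel_measurable_const cost_meas growing_list_subset[OF xs])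
    qed
    then show ?thesis using costsum q(2) by linarith
  qed
  have P0: "\<delta> \<le> ?EN (y0 * s ^ 0)" using expected_high_ge[OF K y0] \<delta>(2) by simp
  obtain j where j: "real d * ?T powr (1 / \<alpha>) / y0 < s ^ j" using real_arch_pow[OF s] by blast
  then have "real d * ?T powr (1 / \<alpha>) \<le> y0 * s ^ j" using y0 by (simp add: field_simps)
  then have "\<not> \<delta> \<le> ?EN (y0 * s ^ j)" using large \<delta>(1) by fastforce
  \<comment> \<open>The expected count is at least \<delta> at y0 and at most 1 < \<delta> at a
    remote level, hence drops below \<delta> between two consecutive levels.\<close>
  then obtain i where i: "\<delta> \<le> ?EN (y0 * s ^ i)" "\<not> \<delta> \<le> ?EN (y0 * s ^ Suc i)"
    using P0 by (induction j) auto
  define y where "y = y0 * s ^ i"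
  define z where "z = y / s"
  have y0y: "y0 \<le> y" unfolding y_def using y0 s one_le_power[of s i] by simp
  have yz: "z < y" unfolding z_def using y0 y0y s by (simp add: field_simps)
  have ENy: "\<delta> \<le> ?EN y" using i(1) by (simp add: y_def)
  \<comment> \<open>From this upper bound one level above y, two applications of
    \<open>scale\<close> lead down to y and to z.\<close>
  have "?EN (s * y) \<le> \<delta>" using i(2) by (simp add: y_def mult_ac)
  then have "?EN y \<le> 1 + R * \<delta>" using scale[of y] R0 mult_left_mono by fastforce
  moreover have "?EN z \<le> 1 + R * ?EN y" using scale[of z] s by (simp add: z_def)
  ultimately have ENz: "?EN z \<le> 1 + R * (1 + R * \<delta>)" using R0 by (smt (verit) mult_left_mono)
  define F1 where "F1 = {\<omega> \<in> space M. \<exists>xs\<in>?G'. ?T \<le> cost (\<lambda>p. V p \<omega>) (set xs)}"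
  define F2 where "F2 = {\<omega> \<in> space M. \<forall>xs\<in>?G. \<not> high adj (set xs) y (\<lambda>p. V p \<omega>)}"
  define H where "H xs = {\<omega> \<in> space M. high adj (set xs) z (\<lambda>p. V p \<omega>)}" for xs
  \<comment> \<open>Each list covers at most K vertices, whence the division by K.\<close>
  define F3 where "F3 = {\<omega> \<in> space M. n powr \<epsilon> / K \<le> real (card {xs \<in> ?G. \<omega> \<in> H xs})}"
  let ?\<I> = "{I. I \<subseteq> {..<n} \<and> real (card I) \<le> n powr \<epsilon>}"
  have F1: "prob F1 \<le> q"
    unfolding F1_def using prob_exists_cost_le[where K = "Suc K" and T = T] q(1) unfolding m_def by (rule order_trans)
  have "prob F2 \<le> K * (K * (K * d) ^ K) / ?EN y"
    unfolding F2_def by (rule prob_no_high_le) (use ENy \<delta> in linarith)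
  also have "\<dots> \<le> K * (K * (K * d) ^ K) / \<delta>" using ENy \<delta>(1) by (intro divide_left_mono) auto
  finally have F2: "prob F2 \<le> K * (K * (K * d) ^ K) / \<delta>" .
  have npos: "0 < n powr \<epsilon> / K" using n K by simp
  have "prob F3 \<le> ?EN z / (n powr \<epsilon> / K)"
    unfolding F3_def expected_high_def H_def[symmetric]
    using finite_growing high_event npos unfolding H_def by (rule prob_card_ge_le)
  also have "\<dots> \<le> (1 + R * (1 + R * \<delta>)) / (n powr \<epsilon> / K)"
    using ENz npos by (intro divide_right_mono) auto
  finally have F3: "prob F3 \<le> (1 + R * (1 + R * \<delta>)) * K / n powr \<epsilon>" by simp
  have ev1: "F1 \<in> events" unfolding F1_def by (rule exists_cost_event)
  have ev2: "F2 \<in> events" unfolding F2_def by (rule no_high_event)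
  have card_sum: "real (card {xs \<in> ?G. \<omega> \<in> H xs}) = (\<Sum>xs\<in>?G. indicator (H xs) \<omega>)" for \<omega>
    using finite_growing by (simp add: indicator_def sum.If_cases Int_def)
  have Hev: "H xs \<in> events" for xs unfolding H_def by (rule high_event)
  have ev3: "F3 \<in> events"
    unfolding F3_def card_sum
    by (intro borel_measurable_le borel_measurable_const borel_measurable_sum borel_measurable_indicator Hev)
  have sub: "space M - localized_event ?\<I> \<epsilon> \<subseteq> F1 \<union> F2 \<union> F3"
  proof
    fix \<omega> assume w: "\<omega> \<in> space M - localized_event ?\<I> \<epsilon>"
    show "\<omega> \<in> F1 \<union> F2 \<union> F3"
    proof (rule ccontr)
      assume no: "\<omega> \<notin> F1 \<union> F2 \<union> F3"
      define v where "v = (\<lambda>p. V p \<omega>)"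
      have c1: "cost v (set xs) < ?T" if "xs \<in> ?G'" for xs
        using no w that by (auto simp: F1_def v_def not_le)
      obtain xs0 where xs0: "xs0 \<in> ?G" "high adj (set xs0) y v"
        using no w by (auto simp: F2_def v_def)
      define A where "A = {xs \<in> ?G. high adj (set xs) z v}"
      define I where "I = (\<Union>xs\<in>A. set xs)"
      have Aeq: "A = {xs \<in> ?G. \<omega> \<in> H xs}" using w by (auto simp: A_def H_def v_def)
      have finA: "finite A" unfolding A_def using finite_growing by auto
      have "card I \<le> (\<Sum>xs\<in>A. K)"
        unfolding I_def
      proof (rule order_trans[OF card_UN_le[OF finA] sum_mono])
        fix xs assume "xs \<in> A"
        then show "card (set xs) \<le> K" using card_length[of xs] by (auto simp: A_def growing_lists_def)
      qed
      then have "real (card I) \<le> real (card A * K)" by (simp only: of_nat_le_iff sum_constant) simp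
      also have "\<dots> = real (card A) * K" by simp
      also have "\<dots> \<le> n powr \<epsilon> / K * K"
        using no w by (intro mult_right_mono) (auto simp: F3_def Aeq not_le)
      also have "\<dots> = n powr \<epsilon>" using K by simp
      finally have "I \<in> ?\<I>" using growing_list_subset by (auto simp: I_def A_def)
      moreover have "(1 - \<epsilon>) * sqrt (sqn {..<n} f) \<le> sqrt (sqn I f)"
        if f: "rayleigh_max n (wmat adj v) f" "sqn {..<n} f > 0" for f
        unfolding I_def A_def
      proof (rule high_blocks_localize[OF c1 h xs0 yz _ \<epsilon> f])
        have "real d * h powr (1 / \<alpha>) \<le> \<epsilon> * (1 - 1 / s) * y0" by (rule small)
        also have "\<dots> \<le> \<epsilon> * (1 - 1 / s) * y" using y0y \<epsilon> s by (intro mult_left_mono) auto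
        also have "\<dots> = \<epsilon> * (y - z)" by (simp add: z_def algebra_simps)
        finally show "real d * h powr (1 / \<alpha>) \<le> \<epsilon> * (y - z)" .
      qed
      ultimately have "\<omega> \<in> localized_event ?\<I> \<epsilon>"
        using w unfolding localized_event_def v_def by blast
      then show False using w by blast
    qed
  qed
  have lev: "localized_event ?\<I> \<epsilon> \<in> events" by (rule localized_event_sets) auto
  have "1 - prob (localized_event ?\<I> \<epsilon>) = prob (space M - localized_event ?\<I> \<epsilon>)"
    using prob_compl[OF lev] by simp
  also have "\<dots> \<le> prob (F1 \<union> F2 \<union> F3)" using ev1 ev2 ev3 by (intro finite_measure_mono[OF sub]) auto
  also have "\<dots> \<le> prob F1 + prob F2 + prob F3"
    using measure_Un_le[of "F1 \<union> F2" M F3] measure_Un_le[of F1 M F2] ev1 ev2 ev3 by auto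
  finally show ?thesis using F1 F2 F3 by linarith
qed

end

section \<open>Localization on disjoint edges\<close>

context weighted_graph
begin

lemma double_sum_edge_pairs:
  fixes g :: "nat \<times> nat \<Rightarrow> real"
  assumes "finite S"
  shows "(\<Sum>i\<in>S. \<Sum>j\<in>S. if adj i j then g (sort_pair i j) else 0) = 2 * (\<Sum>e\<in>edge_pairs adj S. g e)"
proof -
  let ?E = "edge_pairs adj S"
  have fin: "finite ?E" using assms by (rule finite_edge_pairs)
  have eq: "{p \<in> S \<times> S. adj (fst p) (snd p)} = ?E \<union> prod.swap ` ?E"
  proof (rule Set.set_eqI)
    fix p :: "nat \<times> nat"
    obtain i j where p: "p = (i, j)" by (cases p)
    have "i \<noteq> j" if "adj i j" using that adj_irrefl by metis
    then show "p \<in> {p \<in> S \<times> S. adj (fst p) (snd p)} \<longleftrightarrow> p \<in> ?E \<union> prod.swap ` ?E"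
      using adj_sym[of i j] adj_sym[of j i]
      by (cases "i < j") (auto simp: p edge_pairs_def image_iff)
  qed
  have "(\<Sum>i\<in>S. \<Sum>j\<in>S. if adj i j then g (sort_pair i j) else 0) =
      (\<Sum>p\<in>S \<times> S. if adj (fst p) (snd p) then g (sort_pair (fst p) (snd p)) else 0)"
    by (simp add: sum.cartesian_product case_prod_beta)
  also have "\<dots> = (\<Sum>p\<in>{p \<in> S \<times> S. adj (fst p) (snd p)}. g (sort_pair (fst p) (snd p)))"
    using assms by (intro sum.inter_filter[symmetric]) auto
  also have "\<dots> = (\<Sum>p\<in>?E. g (sort_pair (fst p) (snd p))) + (\<Sum>p\<in>prod.swap ` ?E. g (sort_pair (fst p) (snd p)))"
    unfolding eq using fin by (intro sum.union_disjoint) (auto simp: edge_pairs_def)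
  also have "(\<Sum>p\<in>?E. g (sort_pair (fst p) (snd p))) = (\<Sum>e\<in>?E. g e)"
    by (intro sum.cong refl) (auto simp: edge_pairs_def sort_pair_def)
  also have "(\<Sum>p\<in>prod.swap ` ?E. g (sort_pair (fst p) (snd p))) = (\<Sum>e\<in>?E. g e)"
  proof -
    have "inj_on prod.swap ?E" by simp
    then have "(\<Sum>p\<in>prod.swap ` ?E. g (sort_pair (fst p) (snd p))) =
        (\<Sum>e\<in>?E. g (sort_pair (fst (prod.swap e)) (snd (prod.swap e))))" by (simp add: sum.reindex)
    also have "\<dots> = (\<Sum>e\<in>?E. g e)"
      by (intro sum.cong refl) (auto simp: edge_pairs_def sort_pair_def)
    finally show ?thesis .
  qed
  finally show ?thesis by simp
qed

definition heavy :: "(nat \<times> nat \<Rightarrow> real) \<Rightarrow> real \<Rightarrow> nat \<Rightarrow> nat \<Rightarrow> bool" where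
  "heavy v h i j \<longleftrightarrow> adj i j \<and> h \<le> \<bar>v (sort_pair i j)\<bar> powr \<alpha>"

definition heavy_mat :: "(nat \<times> nat \<Rightarrow> real) \<Rightarrow> real \<Rightarrow> nat \<Rightarrow> nat \<Rightarrow> real" where
  "heavy_mat v h i j = (if heavy v h i j then v (sort_pair i j) else 0)"

lemma heavy_sym: "heavy v h i j \<Longrightarrow> heavy v h j i"
  using adj_sym by (auto simp: heavy_def sort_pair_def min.commute max.commute)

lemma abs_le_powr_root: "\<bar>w\<bar> powr \<alpha> \<le> t \<Longrightarrow> \<bar>w\<bar> \<le> t powr (1 / \<alpha>)"
proof -
  assume "\<bar>w\<bar> powr \<alpha> \<le> t"
  then have "(\<bar>w\<bar> powr \<alpha>) powr (1 / \<alpha>) \<le> t powr (1 / \<alpha>)"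
    using \<alpha>_pos by (intro powr_mono2) auto
  then show ?thesis using \<alpha>_pos by (simp add: powr_powr)
qed

text \<open>The square of a weight is (\<bar>v e\<bar>^\<alpha>)^(2 / \<alpha>), at most \<theta>^(2
  / \<alpha> - 1) times its cost because 2 / \<alpha> - 1 > 0. So the sum of squares is controlled
  by the largest and the total cost, and the triangle-free bound applies.\<close>

lemma heavy_qform_le:
  assumes \<alpha>: "\<alpha> < 2" and S: "finite S"
    and tf: "\<And>i j k. i \<in> S \<Longrightarrow> j \<in> S \<Longrightarrow> k \<in> S \<Longrightarrow> heavy v h i j \<Longrightarrow> heavy v h j k \<Longrightarrow> heavy v h i k \<Longrightarrow> False"
    and \<theta>: "\<And>e. e \<in> edge_pairs adj S \<Longrightarrow> \<bar>v e\<bar> powr \<alpha> \<le> \<theta>" and T: "cost v S \<le> T"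
  shows "qform S (heavy_mat v h) f \<le> sqrt (\<theta> powr (2 / \<alpha> - 1) * T) * sqn S f"
proof -
  have "(\<Sum>i\<in>S. \<Sum>j\<in>S. (heavy_mat v h i j)\<^sup>2) \<le> (\<Sum>i\<in>S. \<Sum>j\<in>S. if adj i j then (v (sort_pair i j))\<^sup>2 else 0)"
    by (intro sum_mono) (auto simp: heavy_mat_def heavy_def)
  also have "\<dots> = 2 * (\<Sum>e\<in>edge_pairs adj S. (v e)\<^sup>2)" by (rule double_sum_edge_pairs[OF S])
  also have "(\<Sum>e\<in>edge_pairs adj S. (v e)\<^sup>2) \<le> (\<Sum>e\<in>edge_pairs adj S. \<theta> powr (2 / \<alpha> - 1) * \<bar>v e\<bar> powr \<alpha>)"
  proof (rule sum_mono)
    fix e assume e: "e \<in> edge_pairs adj S"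
    show "(v e)\<^sup>2 \<le> \<theta> powr (2 / \<alpha> - 1) * \<bar>v e\<bar> powr \<alpha>"
    proof (cases "v e = 0")
      case False
      have "(v e)\<^sup>2 = \<bar>v e\<bar> powr 2" using False by (simp flip: powr_realpow)
      also have "\<dots> = (\<bar>v e\<bar> powr \<alpha>) powr (2 / \<alpha> - 1) * \<bar>v e\<bar> powr \<alpha>"
        using \<alpha>_pos False by (simp add: powr_powr field_simps flip: powr_add)
      also have "\<dots> \<le> \<theta> powr (2 / \<alpha> - 1) * \<bar>v e\<bar> powr \<alpha>"
        using \<theta>[OF e] \<alpha> \<alpha>_pos by (intro mult_right_mono powr_mono2) (auto simp: field_simps)
      finally show ?thesis .
    qed simp
  qed
  also have "\<dots> = \<theta> powr (2 / \<alpha> - 1) * cost v S" by (simp add: sum_distrib_left)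
  also have "\<dots> \<le> \<theta> powr (2 / \<alpha> - 1) * T" using T by (intro mult_left_mono) auto
  finally have "(\<Sum>i\<in>S. \<Sum>j\<in>S. (heavy_mat v h i j)\<^sup>2) / 2 \<le> \<theta> powr (2 / \<alpha> - 1) * T" by simp
  then have "sqrt ((\<Sum>i\<in>S. \<Sum>j\<in>S. (heavy_mat v h i j)\<^sup>2) / 2) \<le> sqrt (\<theta> powr (2 / \<alpha> - 1) * T)"
    by (rule real_sqrt_le_mono)
  moreover have "qform S (heavy_mat v h) f \<le> sqrt ((\<Sum>i\<in>S. \<Sum>j\<in>S. (heavy_mat v h i j)\<^sup>2) / 2) * sqn S f"
  proof (rule qform_le_triangle_free[of S "heavy v h", OF S])
    show "heavy v h j i" if "heavy v h i j" for i j using that by (rule heavy_sym)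
    show False if "i \<in> S" "j \<in> S" "k \<in> S" "heavy v h i j" "heavy v h j k" "heavy v h i k" for i j k
      using that by (rule tf)
    show "heavy_mat v h i j = 0" if "\<not> heavy v h i j" for i j using that by (simp add: heavy_mat_def)
  qed
  ultimately show ?thesis
    using sqn_nonneg[of S f] by (meson mult_right_mono order_trans)
qed

text \<open>The edge (p, q) contributes 2 * v (p, q) * f p * f q, hence at most
  \<open>T powr (1 / \<alpha>)\<close> times the mass at its endpoints. Every other edge must share
  the remaining cost T - \<theta>, and the degree bound handles these.\<close>

lemma heavy_qform_single_le:
  assumes S: "S \<subseteq> {..<n}" and pq: "p \<in> S" "q \<in> S" "p < q" "adj p q"
    and T: "cost v S \<le> T" and \<theta>: "\<theta> \<le> \<bar>v (p, q)\<bar> powr \<alpha>"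
  shows "qform S (heavy_mat v h) f \<le> T powr (1 / \<alpha>) * sqn {p, q} f + real d * (T - \<theta>) powr (1 / \<alpha>) * sqn S f"
proof -
  have fin: "finite S" using S finite_subset by blast
  define x0 where "x0 i j = (if sort_pair i j = (p, q) then heavy_mat v h i j else 0)" for i j
  define x1 where "x1 i j = (if sort_pair i j = (p, q) then 0 else heavy_mat v h i j)" for i j
  have fe: "finite (edge_pairs adj S)" using fin by (rule finite_edge_pairs)
  have pe: "(p, q) \<in> edge_pairs adj S" using pq by (simp add: edge_pairs_def)
  have "heavy_mat v h i j = x0 i j + x1 i j" for i j by (simp add: x0_def x1_def)
  then have split: "qform S (heavy_mat v h) f = qform S x0 f + qform S x1 f"
    unfolding qform_def sum.distrib[symmetric] distrib_right[symmetric] by simp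
  have "\<bar>v (p, q)\<bar> powr \<alpha> \<le> cost v S" using fe pe by (intro member_le_sum) auto
  then have vT: "\<bar>v (p, q)\<bar> \<le> T powr (1 / \<alpha>)" using T by (intro abs_le_powr_root) simp
  have "qform S x0 f = (\<Sum>i\<in>S. \<Sum>j\<in>S. if (i, j) = (p, q) \<or> (i, j) = (q, p) then heavy_mat v h p q * f p * f q else 0)"
    unfolding qform_def
  proof (intro sum.cong refl)
    fix i j
    have iff: "sort_pair i j = (p, q) \<longleftrightarrow> (i, j) = (p, q) \<or> (i, j) = (q, p)"
      using pq(3) by (auto simp: sort_pair_def min_def max_def)
    have "heavy_mat v h q p = heavy_mat v h p q"
      using heavy_sym by (auto simp: heavy_mat_def sort_pair_def min.commute max.commute)
    then show "x0 i j * f i * f j = (if (i, j) = (p, q) \<or> (i, j) = (q, p) then heavy_mat v h p q * f p * f q else 0)"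
      unfolding x0_def iff by auto
  qed
  also have "\<dots> = (\<Sum>a\<in>S \<times> S. if a \<in> {(p, q), (q, p)} then heavy_mat v h p q * f p * f q else 0)"
    unfolding sum.cartesian_product by (intro sum.cong refl) (auto simp: case_prod_beta prod_eq_iff)
  also have "\<dots> = (\<Sum>a\<in>{(p, q), (q, p)}. heavy_mat v h p q * f p * f q)"
    using fin pq by (subst sum.inter_restrict[symmetric]) (auto intro!: sum.cong)
  also have "\<dots> = 2 * (heavy_mat v h p q * (f p * f q))" using pq(3) by simp
  also have "\<dots> \<le> 2 * (T powr (1 / \<alpha>) * \<bar>f p * f q\<bar>)"
  proof -
    have "heavy_mat v h p q * (f p * f q) \<le> \<bar>heavy_mat v h p q\<bar> * \<bar>f p * f q\<bar>" by (metis abs_ge_self abs_mult)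
    also have "\<dots> \<le> T powr (1 / \<alpha>) * \<bar>f p * f q\<bar>"
      using vT pq(3) by (intro mult_right_mono) (auto simp: heavy_mat_def sort_pair_def)
    finally show ?thesis by simp
  qed
  also have "\<dots> = T powr (1 / \<alpha>) * (2 * \<bar>f p\<bar> * \<bar>f q\<bar>)" by (simp add: abs_mult)
  also have "\<dots> \<le> T powr (1 / \<alpha>) * sqn {p, q} f"
    using sum_squares_bound[of "\<bar>f p\<bar>" "\<bar>f q\<bar>"] pq(3) by (intro mult_left_mono) (auto simp: sqn_def)
  finally have 0: "qform S x0 f \<le> T powr (1 / \<alpha>) * sqn {p, q} f" .
  have 1: "qform S x1 f \<le> real d * (T - \<theta>) powr (1 / \<alpha>) * sqn S f"
  proof (rule qform_le_degree[OF fin, of adj])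
    fix i j assume ij: "i \<in> S" "j \<in> S"
    show "\<bar>x1 i j\<bar> \<le> (if adj i j then (T - \<theta>) powr (1 / \<alpha>) else 0)"
    proof (cases "adj i j \<and> sort_pair i j \<noteq> (p, q)")
      case True
      then have e: "sort_pair i j \<in> edge_pairs adj S"
        using sort_pair_in_edge_pairs[of adj i j S] adj_sym adj_irrefl ij by blast
      have "\<bar>v (p, q)\<bar> powr \<alpha> + \<bar>v (sort_pair i j)\<bar> powr \<alpha> = (\<Sum>e\<in>{(p, q), sort_pair i j}. \<bar>v e\<bar> powr \<alpha>)"
        using True by (subst sum.insert) auto
      also have "\<dots> \<le> cost v S" using fe pe e by (intro sum_mono2) auto
      finally have "\<bar>v (sort_pair i j)\<bar> powr \<alpha> \<le> T - \<theta>" using T \<theta> by linarith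
      then have "\<bar>v (sort_pair i j)\<bar> \<le> (T - \<theta>) powr (1 / \<alpha>)" by (rule abs_le_powr_root)
      then show ?thesis using True by (simp add: x1_def heavy_mat_def)
    next
      case False
      then show ?thesis by (auto simp: x1_def heavy_mat_def heavy_def)
    qed
  next
    show "card {j \<in> S. adj i j} \<le> d" if "i \<in> S" for i using that S fin by (intro degree_within) auto
  qed (auto intro: adj_sym)
  show ?thesis using split 0 1 by linarith
qed

text \<open>A component without selected edge has its top eigenvalue below \<open>\<rho>\<close>, which bounds its share \<open>mN\<close> of the mass; in
  the other components everything except the selected edge is negligible.\<close>

lemma heavy_edges_localize:
  fixes K :: nat
  assumes \<alpha>: "\<alpha> < 2"
    and cost: "\<And>xs. xs \<in> growing_lists {..<n} adj (Suc K) \<Longrightarrow> cost v (set xs) < T"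
    and h: "0 \<le> h" "T \<le> real K * h" and \<theta>: "h \<le> \<theta>" "T \<le> 2 * \<theta>" "\<theta> \<le> T" and T: "0 < T"
    and tri: "\<And>i j k. adj i j \<Longrightarrow> adj j k \<Longrightarrow> adj i k \<Longrightarrow> \<not> heavy v h i k"
    and S0: "S0 \<subseteq> {..<n}" "high adj S0 y v"
    and \<epsilon>: "0 < \<epsilon>" "\<epsilon> < 1"
    and a: "a = T powr (1 / \<alpha>)" and \<rho>: "\<rho> = sqrt (\<theta> powr (2 / \<alpha> - 1) * T)" "\<rho> < a"
    and num: "(a - y + d * (T - \<theta>) powr (1 / \<alpha>) + d * h powr (1 / \<alpha>)) / a + (a - y + d * h powr (1 / \<alpha>)) / (a - \<rho>) \<le> \<epsilon>"
    and f: "rayleigh_max n (wmat adj v) f" "sqn {..<n} f > 0"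
  defines "J \<equiv> {e \<in> edge_pairs adj {..<n}. \<theta> \<le> \<bar>v e\<bar> powr \<alpha>}"
  defines "J' \<equiv> (\<lambda>(i, j). {i, j}) ` J"
  shows "disjoint J'" and "(1 - \<epsilon>) * sqrt (sqn {..<n} f) \<le> sqrt (sqn (\<Union>J') f)"
proof -
  define N where "N = sqn {..<n} f"
  define x where "x = wmat adj v"
  define \<eta> where "\<eta> = d * (T - \<theta>) powr (1 / \<alpha>)"
  define \<delta> where "\<delta> = d * h powr (1 / \<alpha>)"
  have N: "N > 0" using f by (simp add: N_def)
  have a0: "a > 0" using T by (simp add: a)
  obtain P where P: "\<And>S. S \<in> P \<Longrightarrow> \<exists>xs\<in>growing_lists {..<n} adj K. set xs = S"
    "\<Union>P = {..<n}" "disjoint P"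
    "\<And>S i j. S \<in> P \<Longrightarrow> i \<in> S \<Longrightarrow> adj i j \<Longrightarrow> h \<le> \<bar>v (sort_pair i j)\<bar> powr \<alpha> \<Longrightarrow> j \<in> S"
    using block_partition[OF cost h] by blast
  have sub: "S \<subseteq> {..<n}" if "S \<in> P" for S using P(2) that by blast
  have fin: "finite S" if "S \<in> P" for S using sub[OF that] finite_subset by blast
  have costS: "cost v S < T" if S: "S \<in> P" for S
  proof -
    obtain xs where "xs \<in> growing_lists {..<n} adj K" "set xs = S" using P(1)[OF S] by blast
    then show ?thesis using cost[of xs] by (auto simp: growing_lists_def)
  qed
  have tf: False if "heavy v h i j" "heavy v h j k" "heavy v h i k" for i j k
    using tri[of i j k] that by (auto simp: heavy_def)
  have Jheavy: "i < j" "i < n" "j < n" "adj i j" "\<theta> \<le> \<bar>v (i, j)\<bar> powr \<alpha>" if "(i, j) \<in> J" for i j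
    using that by (auto simp: J_def edge_pairs_def)
  have Jblock: "j \<in> S" "i \<in> S" if J: "(i, j) \<in> J" and S: "S \<in> P" "i \<in> S \<or> j \<in> S" for i j S
  proof -
    have 1: "h \<le> \<bar>v (sort_pair i j)\<bar> powr \<alpha>" "h \<le> \<bar>v (sort_pair j i)\<bar> powr \<alpha>"
      using Jheavy[OF J] \<theta>(1) by (auto simp: sort_pair_def)
    show "j \<in> S" "i \<in> S"
      using P(4)[OF S(1) _ Jheavy(4)[OF J] 1(1)] P(4)[OF S(1) _ adj_sym[OF Jheavy(4)[OF J]] 1(2)] S(2) by blast+
  qed
  \<comment> \<open>Two selected edges in one block would cost at least 2 * \<theta> \<ge>
    T.\<close>
  have unique: "e = e'" if e: "e \<in> J" "e' \<in> J" "e \<in> edge_pairs adj S" "e' \<in> edge_pairs adj S" and S: "S \<in> P" for e e' S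
  proof (rule ccontr)
    assume "e \<noteq> e'"
    then have "\<bar>v e\<bar> powr \<alpha> + \<bar>v e'\<bar> powr \<alpha> = (\<Sum>e\<in>{e, e'}. \<bar>v e\<bar> powr \<alpha>)" by simp
    also have "\<dots> \<le> cost v S" using e finite_edge_pairs[OF fin[OF S]] by (intro sum_mono2) auto
    also have "\<dots> < T" by (rule costS[OF S])
    finally show False using e(1,2) \<theta>(2) by (auto simp: J_def)
  qed
  show "disjoint J'"
    unfolding disjoint_def
  proof (intro ballI impI)
    fix A B assume AB: "A \<in> J'" "B \<in> J'" "A \<noteq> B"
    obtain i j where e: "(i, j) \<in> J" "A = {i, j}" using AB(1) by (auto simp: J'_def)
    obtain i' j' where e': "(i', j') \<in> J" "B = {i', j'}" using AB(2) by (auto simp: J'_def)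
    show "A \<inter> B = {}"
    proof (rule ccontr)
      assume "A \<inter> B \<noteq> {}"
      then obtain u where u: "u \<in> {i, j}" "u \<in> {i', j'}" using e(2) e'(2) by blast
      then have "u < n" using Jheavy[OF e(1)] by auto
      then obtain S where S: "S \<in> P" "u \<in> S" using P(2) by blast
      have "i \<in> S" "j \<in> S" "i' \<in> S" "j' \<in> S" using Jblock[OF e(1) S(1)] Jblock[OF e'(1) S(1)] S(2) u by auto
      then have "(i, j) \<in> edge_pairs adj S" "(i', j') \<in> edge_pairs adj S"
        using Jheavy[OF e(1)] Jheavy[OF e'(1)] by (auto simp: edge_pairs_def)
      then have "(i, j) = (i', j')" using unique[OF e(1) e'(1) _ _ S(1)] by blast
      then show False using AB(3) e(2) e'(2) by simp
    qed
  qed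
  define VJ where "VJ = \<Union>J'"
  have VJ: "VJ \<subseteq> {..<n}"
  proof
    fix u assume "u \<in> VJ"
    then obtain i j where "(i, j) \<in> J" "u \<in> {i, j}" by (auto simp: VJ_def J'_def)
    then show "u \<in> {..<n}" using Jheavy[of i j] by auto
  qed
  obtain lam where lam: "qform {..<n} x f = lam * N"
    and lam_le: "\<And>S g. S \<subseteq> {..<n} \<Longrightarrow> qform S x g \<le> lam * sqn S g"
    using rayleigh_quotient[OF f] unfolding x_def N_def by blast
  have ylam: "y < lam" using high_le_quotient[OF S0(2)] lam_le[OF S0(1)] by (simp add: x_def)
  define xl where "xl i j = x i j - heavy_mat v h i j" for i j
  have split: "qform {..<n} x f = qform {..<n} (heavy_mat v h) f + qform {..<n} xl f"
    unfolding qform_def sum.distrib[symmetric] by (intro sum.cong refl) (simp add: xl_def algebra_simps)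
  have light: "qform {..<n} xl f \<le> \<delta> * N"
    unfolding N_def \<delta>_def
  proof (rule qform_le_degree[of "{..<n}" adj])
    show "\<bar>xl i j\<bar> \<le> (if adj i j then h powr (1 / \<alpha>) else 0)" for i j
    proof (cases "adj i j \<and> \<not> heavy v h i j")
      case True
      then have "\<bar>v (sort_pair i j)\<bar> \<le> h powr (1 / \<alpha>)" by (intro abs_le_powr_root) (auto simp: heavy_def)
      then show ?thesis using True by (simp add: xl_def x_def wmat_def heavy_mat_def)
    next
      case False
      then show ?thesis by (auto simp: xl_def x_def wmat_def heavy_mat_def heavy_def)
    qed
    show "card {j \<in> {..<n}. adj i j} \<le> d" if "i \<in> {..<n}" for i using that by (rule degree_lessThan)
  qed (auto intro: adj_sym)
  have heavy_split: "qform {..<n} (heavy_mat v h) f = (\<Sum>S\<in>P. qform S (heavy_mat v h) f)"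
  proof (rule qform_partition[OF finite_lessThan P(2,3)])
    show "j \<in> S" if "S \<in> P" "i \<in> S" "j \<in> {..<n}" "heavy_mat v h i j \<noteq> 0" for S i j
      using P(4)[OF that(1,2), of j] that(4) by (auto simp: heavy_mat_def heavy_def split: if_splits)
  qed
  have sumN: "N = (\<Sum>S\<in>P. sqn S f)" unfolding N_def by (rule sqn_partition[OF finite_lessThan P(2,3)])
  define ind where "ind S = (if edge_pairs adj S \<inter> J = {} then 1 else 0 :: real)" for S
  define mN where "mN = (\<Sum>S\<in>P. ind S * sqn S f)"
  \<comment> \<open>The formula for \<rho> evaluated at \<theta> = T: the same lemma bounds blocks
    with and without a selected edge.\<close>
  have aa: "sqrt (T powr (2 / \<alpha> - 1) * T) = a"
  proof -
    have "T powr (2 / \<alpha> - 1) * T = T powr (2 / \<alpha> - 1) * T powr 1" using T by simp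
    also have "\<dots> = T powr (1 / \<alpha> + 1 / \<alpha>)" by (simp only: powr_add[symmetric]) simp
    also have "\<dots> = a\<^sup>2" by (simp only: a power2_eq_square powr_add)
    finally show ?thesis using a0 by simp
  qed
  have edge_le: "\<bar>v e\<bar> powr \<alpha> \<le> T" if "S \<in> P" "e \<in> edge_pairs adj S" for S e
    using member_le_sum[of e "edge_pairs adj S" "\<lambda>e. \<bar>v e\<bar> powr \<alpha>"] finite_edge_pairs[OF fin[OF that(1)]]
      costS[OF that(1)] that(2) by fastforce
  have noJ: "qform S (heavy_mat v h) f \<le> \<rho> * sqn S f" if S: "S \<in> P" "edge_pairs adj S \<inter> J = {}" for S
    unfolding \<rho>(1)
  proof (rule heavy_qform_le[OF \<alpha> fin[OF S(1)]])
    show False if "heavy v h i j" "heavy v h j k" "heavy v h i k" for i j k using that by (rule tf)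
    show "\<bar>v e\<bar> powr \<alpha> \<le> \<theta>" if e: "e \<in> edge_pairs adj S" for e
    proof -
      have "e \<in> edge_pairs adj {..<n}" using e sub[OF S(1)] by (auto simp: edge_pairs_def)
      then show ?thesis using S(2) e by (force simp: J_def)
    qed
    show "cost v S \<le> T" using costS[OF S(1)] by simp
  qed
  \<comment> \<open>First bound, to be summed over blocks: mass in blocks without a selected edge
    loses a - \<rho>, but the total cannot fall below y, which limits \<open>mN\<close>.\<close>
  have b1: "qform S (heavy_mat v h) f \<le> a * sqn S f - (a - \<rho>) * (ind S * sqn S f)" if S: "S \<in> P" for S
  proof (cases "edge_pairs adj S \<inter> J = {}")
    case True
    then show ?thesis using noJ[OF S True] by (simp add: ind_def algebra_simps)
  next
    case False
    have "qform S (heavy_mat v h) f \<le> a * sqn S f"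
      unfolding aa[symmetric]
    proof (rule heavy_qform_le[OF \<alpha> fin[OF S]])
      show False if "heavy v h i j" "heavy v h j k" "heavy v h i k" for i j k using that by (rule tf)
      show "\<bar>v e\<bar> powr \<alpha> \<le> T" if "e \<in> edge_pairs adj S" for e using edge_le[OF S that] .
      show "cost v S \<le> T" using costS[OF S] by simp
    qed
    then show ?thesis using False by (simp add: ind_def)
  qed
  have \<eta>0: "0 \<le> \<eta>" by (simp add: \<eta>_def)
  \<comment> \<open>Second bound: blocks without a selected edge are estimated crudely, since their
    mass \<open>mN\<close> is already known to be small, and in the others only the selected edge
    matters.\<close>
  have b2: "qform S (heavy_mat v h) f \<le> a * sqn (S \<inter> VJ) f + \<eta> * sqn S f + a * (ind S * sqn S f)" if S: "S \<in> P" for S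
  proof (cases "edge_pairs adj S \<inter> J = {}")
    case True
    have "qform S (heavy_mat v h) f \<le> \<rho> * sqn S f" by (rule noJ[OF S True])
    also have "\<dots> \<le> a * sqn S f" using \<rho>(2) by (intro mult_right_mono sqn_nonneg) simp
    also have "\<dots> \<le> a * sqn (S \<inter> VJ) f + \<eta> * sqn S f + a * sqn S f"
      using a0 \<eta>0 sqn_nonneg[of S f] sqn_nonneg[of "S \<inter> VJ" f] by simp
    finally show ?thesis using True by (simp add: ind_def)
  next
    case False
    then obtain p q where pq: "(p, q) \<in> edge_pairs adj S" "(p, q) \<in> J" by auto
    then have pq': "p \<in> S" "q \<in> S" "p < q" "adj p q" by (auto simp: edge_pairs_def)
    have "{p, q} \<in> J'" unfolding J'_def using pq(2) by force
    then have "{p, q} \<subseteq> S \<inter> VJ" using pq' by (auto simp: VJ_def)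
    then have "sqn {p, q} f \<le> sqn (S \<inter> VJ) f" using fin[OF S] by (intro sqn_mono) auto
    then have "a * sqn {p, q} f \<le> a * sqn (S \<inter> VJ) f" using a0 by simp
    moreover have "qform S (heavy_mat v h) f \<le> a * sqn {p, q} f + \<eta> * sqn S f"
      unfolding a \<eta>_def
      by (rule heavy_qform_single_le[OF sub[OF S] pq']) (use costS[OF S] Jheavy[OF pq(2)] in auto)
    ultimately show ?thesis using False by (simp add: ind_def)
  qed
  have "qform {..<n} (heavy_mat v h) f \<le> (\<Sum>S\<in>P. a * sqn S f - (a - \<rho>) * (ind S * sqn S f))"
    unfolding heavy_split by (rule sum_mono[OF b1])
  also have "\<dots> = a * N - (a - \<rho>) * mN"
    by (simp add: sum_subtractf sumN mN_def sum_distrib_left)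
  finally have "lam * N \<le> a * N - (a - \<rho>) * mN + \<delta> * N" using split light lam by linarith
  moreover have "y * N \<le> lam * N" using ylam N by simp
  ultimately have "(a - \<rho>) * mN \<le> (a - y + \<delta>) * N" by (simp add: algebra_simps)
  then have mN: "mN \<le> (a - y + \<delta>) / (a - \<rho>) * N" using \<rho>(2) by (simp add: field_simps)
  have "qform {..<n} (heavy_mat v h) f \<le> (\<Sum>S\<in>P. a * sqn (S \<inter> VJ) f + \<eta> * sqn S f + a * (ind S * sqn S f))"
    unfolding heavy_split by (rule sum_mono[OF b2])
  also have "\<dots> = a * (\<Sum>S\<in>P. sqn (S \<inter> VJ) f) + \<eta> * N + a * mN"
    by (simp add: sum.distrib sumN mN_def sum_distrib_left)
  also have "(\<Sum>S\<in>P. sqn (S \<inter> VJ) f) = sqn VJ f"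
  proof -
    have "(\<Sum>S\<in>P. sqn (S \<inter> VJ) f) = (\<Sum>S\<in>P. sqn S (\<lambda>i. if i \<in> VJ then f i else 0))"
    proof (rule sum.cong[OF refl])
      fix S assume S: "S \<in> P"
      have "sqn S (\<lambda>i. if i \<in> VJ then f i else 0) = sqn S (\<lambda>i. if i \<in> S \<inter> VJ then f i else 0)"
        by (rule sqn_cong) simp
      also have "\<dots> = sqn (S \<inter> VJ) f" by (rule sqn_restrict[OF fin[OF S]]) simp
      finally show "sqn (S \<inter> VJ) f = sqn S (\<lambda>i. if i \<in> VJ then f i else 0)" by simp
    qed
    also have "\<dots> = sqn {..<n} (\<lambda>i. if i \<in> VJ then f i else 0)"
      by (rule sqn_partition[OF finite_lessThan P(2,3), symmetric])
    also have "\<dots> = sqn VJ f" by (rule sqn_restrict[OF finite_lessThan VJ])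
    finally show ?thesis .
  qed
  finally have "lam * N \<le> a * sqn VJ f + \<eta> * N + a * mN + \<delta> * N" using split light lam by linarith
  then have "y * N \<le> a * sqn VJ f + \<eta> * N + a * mN + \<delta> * N" using \<open>y * N \<le> lam * N\<close> by linarith
  then have "a * N \<le> a * sqn VJ f + (a - y + \<eta> + \<delta>) * N + a * mN" by (simp add: algebra_simps)
  then have "N \<le> (a * sqn VJ f + (a - y + \<eta> + \<delta>) * N + a * mN) / a"
    using a0 by (simp add: pos_le_divide_eq mult.commute)
  also have "\<dots> = sqn VJ f + (a - y + \<eta> + \<delta>) / a * N + mN" using a0 by (simp add: field_simps)
  finally have "N \<le> sqn VJ f + ((a - y + \<eta> + \<delta>) / a + (a - y + \<delta>) / (a - \<rho>)) * N"
    using mN by (simp add: algebra_simps)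
  also have "\<dots> \<le> sqn VJ f + \<epsilon> * N"
    using num N by (intro add_left_mono mult_right_mono) (auto simp: \<eta>_def \<delta>_def)
  finally have le: "(1 - \<epsilon>) * N \<le> sqn VJ f" by (simp add: algebra_simps)
  show "(1 - \<epsilon>) * sqrt (sqn {..<n} f) \<le> sqrt (sqn (\<Union>J') f)"
    using localized_from_mass[OF \<epsilon> less_imp_le[OF N] le] by (simp only: N_def VJ_def)
qed

end

text \<open>Vertex sets of matchings with at most B edges: disjointness as a family of sets means
  that no two edges share a vertex.\<close>

definition matching_covers :: "(nat \<Rightarrow> nat \<Rightarrow> bool) \<Rightarrow> real \<Rightarrow> nat set set" where
  "matching_covers E B = {\<Union>J | J. J \<subseteq> {{i, j} | i j. E i j} \<and> disjoint J \<and> real (card J) \<le> B}"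

lemma matching_coversI:
  "J \<subseteq> {{i, j} | i j. E i j} \<Longrightarrow> disjoint J \<Longrightarrow> real (card J) \<le> B \<Longrightarrow> \<Union>J \<in> matching_covers E B"
  unfolding matching_covers_def by (rule CollectI) (rule exI[of _ J], simp)

lemma matching_coversE:
  assumes "I \<in> matching_covers E B"
  obtains J where "I = \<Union>J" "J \<subseteq> {{i, j} | i j. E i j}" "disjoint J" "real (card J) \<le> B"
  using assms unfolding matching_covers_def by (elim CollectE exE conjE) (rule that)

lemma matching_covers_subset:
  assumes I: "I \<in> matching_covers E B" and E: "\<And>i j. E i j \<Longrightarrow> i < n \<and> j < n"
  shows "I \<subseteq> {..<n}"
proof
  fix u assume u: "u \<in> I"
  obtain J where J: "I = \<Union>J" "J \<subseteq> {{i, j} | i j. E i j}" using I by (rule matching_coversE)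
  have "u \<in> \<Union>J" using u J(1) by simp
  then obtain e where e: "u \<in> e" "e \<in> J" by (rule UnionE)
  have "\<exists>i j. e = {i, j} \<and> E i j" using subsetD[OF J(2) e(2)] by (rule CollectD)
  then obtain i j where ij: "e = {i, j} \<and> E i j" by blast
  then show "u \<in> {..<n}" using e(1) E[of i j] by auto
qed

lemma matching_covers_mono: "B \<le> B' \<Longrightarrow> matching_covers E B \<subseteq> matching_covers E B'"
proof
  fix I assume B: "B \<le> B'" and "I \<in> matching_covers E B"
  from this(2) obtain J where J: "I = \<Union>J" "J \<subseteq> {{i, j} | i j. E i j}" "disjoint J" "real (card J) \<le> B"
    by (rule matching_coversE)
  show "I \<in> matching_covers E B'"
    unfolding J(1) by (rule matching_coversI[OF J(2,3) order.trans[OF J(4) B]])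
qed

lemma bex_matching_covers:
  fixes P :: "nat set \<Rightarrow> bool"
  shows "(\<exists>I\<in>matching_covers E B. P I) \<longleftrightarrow>
    (\<exists>J\<subseteq>{{i, j} | i j. E i j}. disjoint J \<and> real (card J) \<le> B \<and> P (\<Union>J))"
proof
  assume "\<exists>I\<in>matching_covers E B. P I"
  then obtain I where I: "I \<in> matching_covers E B" "P I" by (rule bexE)
  obtain J where J: "I = \<Union>J" "J \<subseteq> {{i, j} | i j. E i j}" "disjoint J" "real (card J) \<le> B"
    using I(1) by (rule matching_coversE)
  then show "\<exists>J\<subseteq>{{i, j} | i j. E i j}. disjoint J \<and> real (card J) \<le> B \<and> P (\<Union>J)"
    using I(2) by (intro exI[of _ J]) simp
next
  assume "\<exists>J\<subseteq>{{i, j} | i j. E i j}. disjoint J \<and> real (card J) \<le> B \<and> P (\<Union>J)"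
  then obtain J where J: "J \<subseteq> {{i, j} | i j. E i j} \<and> disjoint J \<and> real (card J) \<le> B \<and> P (\<Union>J)" by (rule exE)
  then show "\<exists>I\<in>matching_covers E B. P I"
    by (intro bexI[of _ "\<Union>J"] matching_coversI) simp_all
qed

context weighted_graph
begin

lemma card_edge_pairs_le_degree: "card (edge_pairs adj {..<n}) \<le> n * d"
proof -
  have "edge_pairs adj {..<n} \<subseteq> (SIGMA i:{..<n}. {j \<in> {..<n}. adj i j})" by (auto simp: edge_pairs_def)
  then have "card (edge_pairs adj {..<n}) \<le> card (SIGMA i:{..<n}. {j \<in> {..<n}. adj i j})"
    by (intro card_mono) auto
  also have "\<dots> = (\<Sum>i<n. card {j \<in> {..<n}. adj i j})" by (rule card_SigmaI) auto
  also have "\<dots> \<le> (\<Sum>i<n. d)" by (intro sum_mono degree_lessThan)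
  finally show ?thesis by simp
qed

text \<open>The terms bound a list of excessive cost, the absence of a single edge high at y, a
  heavy edge in a triangle, and too many selected edges. The number of triangles stays in the bound
  because it is controlled only on average over the graphs.\<close>

lemma prob_localized_disjoint_edges:
  fixes K :: nat and B :: real
  defines "m \<equiv> Suc K * Suc K"
  assumes \<alpha>: "\<alpha> < 2" and \<epsilon>: "0 < \<epsilon>" "\<epsilon> < 1" and n: "0 < n"
    and par: "disjoint_edges_params \<alpha> d \<epsilon> K T h \<theta> y a \<rho>"
    and B: "0 < B"
  shows "1 - (n * (Suc K * (Suc K * d) ^ Suc K) * ((real T + 1) ^ m * C ^ m * exp (- real T)) +
      real (2 * (2 * (2 * d) ^ 2)) / (n * (c * exp (- (y powr \<alpha> + 1)))) +
      card {(i, j, k). adj i j \<and> adj j k \<and> adj i k} * (C * exp (- h)) +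
      real (n * d) * (C * exp (- \<theta>)) / B) \<le>
    prob (localized_event (matching_covers adj B) \<epsilon>)"
proof -
  have h: "0 \<le> h" "real (T + m) \<le> real K * h" and \<theta>: "h \<le> \<theta>" "real (T + m) \<le> 2 * \<theta>" "\<theta> \<le> real (T + m)"
    and y: "0 < y" and a: "a = real (T + m) powr (1 / \<alpha>)"
    and \<rho>: "\<rho> = sqrt (\<theta> powr (2 / \<alpha> - 1) * real (T + m))" "\<rho> < a"
    and num: "(a - y + d * (real (T + m) - \<theta>) powr (1 / \<alpha>) + d * h powr (1 / \<alpha>)) / a +
      (a - y + d * h powr (1 / \<alpha>)) / (a - \<rho>) \<le> \<epsilon>"
    using par unfolding disjoint_edges_params_def m_def by blast+
  let ?T = "real (T + m)"
  let ?Tri = "{(i, j, k). adj i j \<and> adj j k \<and> adj i k}"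
  let ?E = "edge_pairs adj {..<n}"
  let ?\<I> = "matching_covers adj B"
  have T0: "0 < ?T" unfolding of_nat_0_less_iff by (simp add: m_def)
  define q where "q = n * (Suc K * (Suc K * d) ^ Suc K) * ((real T + 1) ^ m * C ^ m * exp (- real T))"
  define F1 where "F1 = {\<omega> \<in> space M. \<exists>xs\<in>growing_lists {..<n} adj (Suc K). ?T \<le> cost (\<lambda>p. V p \<omega>) (set xs)}"
  define F2 where "F2 = {\<omega> \<in> space M. \<forall>xs\<in>growing_lists {..<n} adj 2. \<not> high adj (set xs) y (\<lambda>p. V p \<omega>)}"
  define H where "H t e = {\<omega> \<in> space M. t \<le> Z e \<omega>}" for t e
  \<comment> \<open>Only the edge between the outer vertices is tested: reordering the triple puts
    any edge of a triangle in this position.\<close>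
  define g where "g t = H h (sort_pair (fst t) (snd (snd t)))" for t :: "nat \<times> nat \<times> nat"
  define F3 where "F3 = (\<Union>t\<in>?Tri. g t)"
  define F4 where "F4 = {\<omega> \<in> space M. B \<le> real (card {e \<in> ?E. \<omega> \<in> H \<theta> e})}"
  have finE: "finite ?E" by (rule finite_edge_pairs) simp
  have Esub: "?E \<subseteq> pairs" by (rule edge_pairs_subset) simp
  have Hev: "H t e \<in> events" if "e \<in> pairs" for t e
    unfolding H_def using Z_meas[OF that] by (intro borel_measurable_le borel_measurable_const)
  have Hprob: "prob (H t e) \<le> C * exp (- t)" if "e \<in> pairs" "0 \<le> t" for t e
    using upper[of e t] that unfolding H_def Z_def pairs_def by simp
  have finTri: "finite ?Tri"
    by (rule finite_subset[of _ "{..<n} \<times> {..<n} \<times> {..<n}"]) (auto dest: adj_less adj_sym)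
  have Tri: "sort_pair (fst t) (snd (snd t)) \<in> pairs" if "t \<in> ?Tri" for t
    using that sort_pair_in_pairs by (cases t) simp
  have gev: "g t \<in> events" if "t \<in> ?Tri" for t unfolding g_def by (rule Hev[OF Tri[OF that]])
  have gprob: "prob (g t) \<le> C * exp (- h)" if "t \<in> ?Tri" for t
    unfolding g_def by (rule Hprob[OF Tri[OF that] h(1)])
  have F1: "prob F1 \<le> q"
    unfolding F1_def q_def m_def by (rule prob_exists_cost_le)
  have low: "0 < n * (c * exp (- (y powr \<alpha> + 1)))" using n c_pos by simp
  have EN: "n * (c * exp (- (y powr \<alpha> + 1))) \<le> expected_high 2 y" by (rule expected_high_ge) (use y in auto)
  have ENpos: "0 < expected_high 2 y" using low EN by linarith
  have "prob F2 \<le> real (2 * (2 * (2 * d) ^ 2)) / expected_high 2 y"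
    unfolding F2_def by (rule prob_no_high_le) (use low EN in linarith)
  also have "\<dots> \<le> real (2 * (2 * (2 * d) ^ 2)) / (n * (c * exp (- (y powr \<alpha> + 1))))"
    using ENpos EN n c_pos by (intro divide_left_mono mult_pos_pos) auto
  finally have F2: "prob F2 \<le> real (2 * (2 * (2 * d) ^ 2)) / (n * (c * exp (- (y powr \<alpha> + 1))))" .
  have "prob F3 \<le> (\<Sum>t\<in>?Tri. prob (g t))"
    unfolding F3_def using gev by (intro finite_measure_subadditive_finite finTri) blast
  also have "\<dots> \<le> (\<Sum>t\<in>?Tri. C * exp (- h))" by (rule sum_mono[OF gprob])
  finally have F3: "prob F3 \<le> card ?Tri * (C * exp (- h))" by simp
  have "prob F4 \<le> (\<Sum>e\<in>?E. prob (H \<theta> e)) / B"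
    unfolding F4_def using Esub Hev by (intro prob_card_ge_le[OF finE _ B]) auto
  also have "\<dots> \<le> (\<Sum>e\<in>?E. C * exp (- \<theta>)) / B"
    using Esub Hprob h(1) \<theta>(1) B by (intro divide_right_mono sum_mono) auto
  also have "\<dots> \<le> real (n * d) * (C * exp (- \<theta>)) / B"
    using card_edge_pairs_le_degree C_ge B
    by (intro divide_right_mono) (auto intro!: mult_right_mono simp del: of_nat_mult)
  finally have F4: "prob F4 \<le> real (n * d) * (C * exp (- \<theta>)) / B" .
  have ev1: "F1 \<in> events" unfolding F1_def by (rule exists_cost_event)
  have ev2: "F2 \<in> events" unfolding F2_def by (rule no_high_event)
  have ev3: "F3 \<in> events" unfolding F3_def using finTri gev by (rule sets.finite_UN)
  have card_sum: "real (card {e \<in> ?E. \<omega> \<in> H \<theta> e}) = (\<Sum>e\<in>?E. indicator (H \<theta> e) \<omega>)" for \<omega>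
    using finE by (simp add: indicator_def sum.If_cases Int_def)
  have ev4: "F4 \<in> events"
    unfolding F4_def card_sum using Esub Hev
    by (intro borel_measurable_le borel_measurable_const borel_measurable_sum borel_measurable_indicator) auto
  have \<I>sub: "I \<subseteq> {..<n}" if "I \<in> ?\<I>" for I
  proof (rule matching_covers_subset[OF that])
    show "i < n \<and> j < n" if "adj i j" for i j using adj_less[OF that] adj_less[OF adj_sym[OF that]] by simp
  qed
  have sub: "space M - localized_event ?\<I> \<epsilon> \<subseteq> F1 \<union> F2 \<union> F3 \<union> F4"
  proof
    fix \<omega> assume w: "\<omega> \<in> space M - localized_event ?\<I> \<epsilon>"
    show "\<omega> \<in> F1 \<union> F2 \<union> F3 \<union> F4"
    proof (rule ccontr)
      assume no: "\<omega> \<notin> F1 \<union> F2 \<union> F3 \<union> F4"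
      define v where "v = (\<lambda>p. V p \<omega>)"
      have c1: "cost v (set xs) < ?T" if "xs \<in> growing_lists {..<n} adj (Suc K)" for xs
        using no w that by (auto simp: F1_def v_def not_le)
      obtain xs0 where xs0: "xs0 \<in> growing_lists {..<n} adj 2" "high adj (set xs0) y v"
        using no w by (auto simp: F2_def v_def)
      have tri: "\<not> heavy v h i k" if "adj i j" "adj j k" "adj i k" for i j k
      proof
        assume "heavy v h i k"
        then have "\<omega> \<in> H h (sort_pair i k)" using w by (simp add: heavy_def H_def Z_def v_def)
        then have "\<omega> \<in> g (i, j, k)" by (simp add: g_def)
        moreover have "(i, j, k) \<in> ?Tri" using that by simp
        ultimately have "\<omega> \<in> F3" unfolding F3_def by (rule UN_I[rotated])
        then show False using no by blast
      qed
      define J where "J = {e \<in> ?E. \<theta> \<le> \<bar>v e\<bar> powr \<alpha>}"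
      define J' where "J' = (\<lambda>(i, j). {i, j}) ` J"
      have finJ: "finite J" unfolding J_def using finE by auto
      have "J = {e \<in> ?E. \<omega> \<in> H \<theta> e}" using w by (auto simp: J_def H_def Z_def v_def)
      then have "real (card J) < B" using no w by (auto simp: F4_def not_le)
      then have card: "real (card J') \<le> B"
        using card_image_le[OF finJ, of "\<lambda>(i, j). {i, j}"] unfolding J'_def by linarith
      have J'sub: "J' \<subseteq> {{i, j} | i j. adj i j}" by (auto simp: J'_def J_def edge_pairs_def)
      have loc: "disjoint J' \<and> (1 - \<epsilon>) * sqrt (sqn {..<n} f) \<le> sqrt (sqn (\<Union>J') f)"
        if f: "rayleigh_max n (wmat adj v) f" "sqn {..<n} f > 0" for f
        unfolding J'_def J_def
      proof (rule conjI, goal_cases)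
        case 1
        show ?case
          by (rule heavy_edges_localize(1)[OF \<alpha> _ h \<theta> T0 _ growing_list_subset[OF xs0(1)] xs0(2) \<epsilon> a \<rho> num f]) (erule c1, erule (2) tri)
      next
        case 2
        show ?case
          by (rule heavy_edges_localize(2)[OF \<alpha> _ h \<theta> T0 _ growing_list_subset[OF xs0(1)] xs0(2) \<epsilon> a \<rho> num f]) (erule c1, erule (2) tri)
      qed
      have "\<omega> \<in> localized_event ?\<I> \<epsilon>"
        unfolding localized_event_def
      proof (intro CollectI conjI allI impI)
        show "\<omega> \<in> space M" using w by simp
        fix f assume "rayleigh_max n (wmat adj (\<lambda>p. V p \<omega>)) f \<and> 0 < sqn {..<n} f"
        then have "rayleigh_max n (wmat adj v) f" "0 < sqn {..<n} f" by (simp_all add: v_def)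
        then have "disjoint J'" "(1 - \<epsilon>) * sqrt (sqn {..<n} f) \<le> sqrt (sqn (\<Union>J') f)"
          using loc by blast+
        then show "\<exists>I\<in>?\<I>. (1 - \<epsilon>) * sqrt (sqn {..<n} f) \<le> sqrt (sqn I f)"
          using J'sub card by (intro bexI[of _ "\<Union>J'"] matching_coversI)
      qed
      then show False using w by blast
    qed
  qed
  have lev: "localized_event ?\<I> \<epsilon> \<in> events" by (rule localized_event_sets[OF \<I>sub])
  have "1 - prob (localized_event ?\<I> \<epsilon>) = prob (space M - localized_event ?\<I> \<epsilon>)"
    using prob_compl[OF lev] by simp
  also have "\<dots> \<le> prob (F1 \<union> F2 \<union> F3 \<union> F4)" using ev1 ev2 ev3 ev4 by (intro finite_measure_mono[OF sub]) auto
  also have "\<dots> \<le> prob F1 + prob F2 + prob F3 + prob F4"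
    using measure_Un_le[of "F1 \<union> F2 \<union> F3" M F4] measure_Un_le[of "F1 \<union> F2" M F3] measure_Un_le[of F1 M F2]
      ev1 ev2 ev3 ev4 by auto
  finally show ?thesis using F1 F2 F3 F4 unfolding q_def by linarith
qed

end

section \<open>Averaging over the random graph\<close>

definition adj_of :: "real mat \<Rightarrow> nat \<Rightarrow> nat \<Rightarrow> bool" where
  "adj_of a i j \<longleftrightarrow> i < dim_row a \<and> j < dim_row a \<and> a $$ (i, j) = 1"

text \<open>Stated by maximizers for a fixed graph, hence measurable in the weights alone, so that
  independence of graph and weights can be applied.\<close>

definition good_weights :: "nat \<Rightarrow> nat set set \<Rightarrow> real \<Rightarrow> real mat \<Rightarrow> real mat set" where
  "good_weights n \<I> \<epsilon> a = {w \<in> carrier_mat n n. \<forall>f. rayleigh_max n (wmat (adj_of a) (\<lambda>p. w $$ p)) f \<and> sqn {..<n} f > 0 \<longrightarrow>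
     (\<exists>I\<in>\<I>. (1 - \<epsilon>) * sqrt (sqn {..<n} f) \<le> sqrt (sqn I f))}"

lemma space_mat_borel: "space (mat_borel n) = carrier_mat n n"
  by (simp add: mat_borel_def)

lemma mat_entry_measurable:
  assumes "p \<in> {..<n} \<times> {..<n}"
  shows "(\<lambda>w. w $$ p) \<in> borel_measurable (mat_borel n)"
proof -
  let ?I = "{..<n} \<times> {..<n}"
  let ?N = "PiM ?I (\<lambda>_. borel :: real measure)"
  have "(\<lambda>A. \<lambda>p\<in>?I. A $$ p) \<in> measurable (mat_borel n) ?N"
    unfolding mat_borel_def by (rule measurable_vimage_algebra1) (auto simp: space_PiM)
  from measurable_compose[OF this measurable_component_singleton[OF assms]]
  show ?thesis using assms by simp
qed

text \<open>Makes the event that A takes a given value accessible to \<open>indep\<close>, which is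
  stated for \<open>mat_borel\<close>.\<close>

lemma singleton_mat_borel:
  assumes a: "a \<in> carrier_mat n n" shows "{a} \<in> sets (mat_borel n)"
proof -
  have "{a} = {w \<in> space (mat_borel n). \<forall>p\<in>{..<n} \<times> {..<n}. w $$ p = a $$ p}"
    using a unfolding space_mat_borel by (auto intro!: eq_matI)
  also have "\<dots> \<in> sets (mat_borel n)"
    by (intro sets.sets_Collect_finite_All borel_measurable_eq mat_entry_measurable borel_measurable_const) auto
  finally show ?thesis .
qed

lemma adj_of_regular:
  assumes "a \<in> regular_adjacency d n"
  shows "adj_of a i j \<Longrightarrow> adj_of a j i" "\<not> adj_of a i i" "adj_of a i j \<Longrightarrow> i < n"
    "i < n \<Longrightarrow> card {j. adj_of a i j} = d"
proof -
  note R = regular_adjacencyD[OF assms]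
  have dim: "dim_row a = n" using R(1) by auto
  show "adj_of a i j \<Longrightarrow> adj_of a j i" using R(3)[of i j] by (auto simp: adj_of_def dim)
  show "\<not> adj_of a i i" using R(4)[of i] by (auto simp: adj_of_def dim)
  show "adj_of a i j \<Longrightarrow> i < n" by (simp add: adj_of_def dim)
  show "i < n \<Longrightarrow> card {j. adj_of a i j} = d" using R(5)[of i] by (simp add: adj_of_def nbrs_def dim)
qed

lemma good_weights_sets:
  assumes a: "a \<in> regular_adjacency d n" and \<I>: "\<And>I. I \<in> \<I> \<Longrightarrow> I \<subseteq> {..<n}"
  shows "good_weights n \<I> \<epsilon> a \<in> sets (mat_borel n)"
  unfolding good_weights_def space_mat_borel[symmetric]
proof (rule sets_maximizers_localized)
  show "(\<lambda>w. wmat (adj_of a) (\<lambda>p. w $$ p) i j) \<in> borel_measurable (mat_borel n)" if "i < n" "j < n" for i j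
    unfolding wmat_def using mat_entry_measurable[of "sort_pair i j" n] that
    by (cases "adj_of a i j") (auto simp: sort_pair_def)
  show "finite \<I>" by (rule finite_subset[of _ "Pow {..<n}"]) (use \<I> in auto)
qed (use \<I> in auto)

text \<open>Symmetry of w matters since \<open>wmat\<close> reads only the entries above the
  diagonal, while the Hadamard product uses all of them.\<close>

lemma good_weights_iff:
  assumes n: "0 < n" and a: "a \<in> regular_adjacency d n" and w: "w \<in> carrier_mat n n" "transpose_mat w = w"
    and \<I>: "\<And>I. I \<in> \<I> \<Longrightarrow> I \<subseteq> {..<n}"
  shows "w \<in> good_weights n \<I> \<epsilon> a \<longleftrightarrow>
    (\<forall>f. top_eigenvector (hadamard_mat a w) f \<longrightarrow> (\<exists>I\<in>\<I>. localized_on \<epsilon> f I))"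
proof -
  note R = regular_adjacencyD[OF a]
  have dim: "dim_row a = n" "dim_col a = n" using R(1) by auto
  have wsym: "w $$ (i, j) = w $$ (j, i)" if "i < n" "j < n" for i j
  proof -
    have "w $$ (i, j) = transpose_mat w $$ (i, j)" using w(2) by simp
    also have "\<dots> = w $$ (j, i)" using w(1) that by auto
    finally show ?thesis .
  qed
  define X where "X = hadamard_mat a w"
  define x where "x = wmat (adj_of a) (\<lambda>p. w $$ p)"
  have X: "X \<in> carrier_mat n n" by (simp add: X_def hadamard_mat_def dim)
  have entry: "X $$ (i, j) = x i j" if "i < n" "j < n" for i j
  proof -
    have "w $$ sort_pair i j = w $$ (i, j)"
      using wsym[OF that] by (simp add: sort_pair_def min_def max_def)
    then show ?thesis
      using R(2)[OF that] that by (auto simp: X_def hadamard_mat_def dim x_def wmat_def adj_of_def)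
  qed
  have Xsym: "X $$ (i, j) = X $$ (j, i)" if "i < n" "j < n" for i j
    using wsym[OF that] R(3)[OF that] that by (simp add: X_def hadamard_mat_def dim)
  have q: "qform {..<n} (\<lambda>i j. X $$ (i, j)) g = qform {..<n} x g" for g
    unfolding qform_def using entry by (intro sum.cong refl) auto
  have top: "top_eigenvector X f \<longleftrightarrow> f \<in> carrier_vec n \<and> f \<noteq> 0\<^sub>v n \<and> rayleigh_max n x (vec_index f)" for f
  proof -
    have "top_eigenvector X f \<longleftrightarrow> f \<in> carrier_vec n \<and> f \<noteq> 0\<^sub>v n \<and> rayleigh_max n (\<lambda>i j. X $$ (i, j)) (vec_index f)"
      by (rule top_eigenvector_iff_rayleigh[OF n X]) (rule Xsym)
    then show ?thesis by (simp only: rayleigh_max_def q)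
  qed
  have loc: "localized_on \<epsilon> f I \<longleftrightarrow> (1 - \<epsilon>) * sqrt (sqn {..<n} (vec_index f)) \<le> sqrt (sqn I (vec_index f))"
    if "f \<in> carrier_vec n" for f I
    using that by (auto simp: localized_on_def L2_set_def sqn_def)
  show ?thesis
    unfolding X_def[symmetric]
  proof
    assume g: "w \<in> good_weights n \<I> \<epsilon> a"
    show "\<forall>f. top_eigenvector X f \<longrightarrow> (\<exists>I\<in>\<I>. localized_on \<epsilon> f I)"
    proof (intro allI impI)
      fix f assume "top_eigenvector X f"
      then have f: "f \<in> carrier_vec n" "f \<noteq> 0\<^sub>v n" "rayleigh_max n x (vec_index f)" using top by auto
      have "\<forall>f. rayleigh_max n x f \<and> sqn {..<n} f > 0 \<longrightarrow>
          (\<exists>I\<in>\<I>. (1 - \<epsilon>) * sqrt (sqn {..<n} f) \<le> sqrt (sqn I f))"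
        using g unfolding good_weights_def x_def by (elim CollectE conjE)
      then have "\<exists>I\<in>\<I>. (1 - \<epsilon>) * sqrt (sqn {..<n} (vec_index f)) \<le> sqrt (sqn I (vec_index f))"
        using f(3) sqn_vec_pos[OF f(1,2)] by blast
      then show "\<exists>I\<in>\<I>. localized_on \<epsilon> f I" using loc[OF f(1)] by blast
    qed
  next
    assume l: "\<forall>f. top_eigenvector X f \<longrightarrow> (\<exists>I\<in>\<I>. localized_on \<epsilon> f I)"
    have "\<exists>I\<in>\<I>. (1 - \<epsilon>) * sqrt (sqn {..<n} g) \<le> sqrt (sqn I g)"
      if g: "rayleigh_max n x g" "sqn {..<n} g > 0" for g
    proof -
      define f where "f = vec n g"
      have f: "f \<in> carrier_vec n" by (simp add: f_def)
      have fg: "vec_index f i = g i" if "i < n" for i using that by (simp add: f_def)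
      have sq: "sqn I (vec_index f) = sqn I g" if "I \<subseteq> {..<n}" for I
        using that fg by (intro sqn_cong) auto
      have "qform {..<n} x (vec_index f) = qform {..<n} x g" using fg by (intro qform_cong) auto
      then have "rayleigh_max n x (vec_index f)" using g(1) sq[of "{..<n}"] by (simp add: rayleigh_max_def)
      moreover have "f \<noteq> 0\<^sub>v n" using g(2) sq[of "{..<n}"] by (auto simp: sqn_def)
      ultimately have "\<exists>I\<in>\<I>. localized_on \<epsilon> f I" using l top f by blast
      then obtain I where I: "I \<in> \<I>" "localized_on \<epsilon> f I" by blast
      then show ?thesis using loc[OF f] sq[OF \<I>[OF I(1)]] sq[of "{..<n}"] by auto
    qed
    then have "\<forall>f. rayleigh_max n x f \<and> sqn {..<n} f > 0 \<longrightarrow>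
        (\<exists>I\<in>\<I>. (1 - \<epsilon>) * sqrt (sqn {..<n} f) \<le> sqrt (sqn I f))" by blast
    with w(1) show "w \<in> good_weights n \<I> \<epsilon> a"
      unfolding good_weights_def x_def by (intro CollectI conjI)
  qed
qed

text \<open>The tail hypothesis starts at t = 1. For z < 1 the bound is trivial because exp 1 * exp
  (- z) \<ge> 1, which explains the constant \<open>max C2 (exp 1)\<close>.\<close>

lemma weibull_two_sided_upper:
  assumes \<mu>: "prob_space \<mu>" "sets \<mu> = sets borel" and \<alpha>: "0 < \<alpha>"
    and up: "\<And>t. 1 \<le> t \<Longrightarrow> measure \<mu> {t..} \<le> C2 / 2 * exp (- (t powr \<alpha>))"
      "\<And>t. 1 \<le> t \<Longrightarrow> measure \<mu> {..-t} \<le> C2 / 2 * exp (- (t powr \<alpha>))"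
    and z: "0 \<le> z"
  shows "measure \<mu> {v. z \<le> \<bar>v\<bar> powr \<alpha>} \<le> max C2 (exp 1) * exp (- z)"
proof -
  interpret prob_space \<mu> by fact
  show ?thesis
  proof (cases "z < 1")
    case True
    have "measure \<mu> {v. z \<le> \<bar>v\<bar> powr \<alpha>} \<le> exp 1 * exp (- z)"
      using True order.trans[OF prob_le_1, of "exp 1 * exp (- z)"] by (simp add: exp_add[symmetric])
    also have "\<dots> \<le> max C2 (exp 1) * exp (- z)" by (intro mult_right_mono) auto
    finally show ?thesis .
  next
    case False
    define t where "t = z powr (1 / \<alpha>)"
    have t1: "1 \<le> t" unfolding t_def using False \<alpha> by (intro ge_one_powr_ge_zero) auto
    have tz: "t powr \<alpha> = z" unfolding t_def using False \<alpha> by (simp add: powr_powr)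
    have sub: "{v. z \<le> \<bar>v\<bar> powr \<alpha>} \<subseteq> {t..} \<union> {..-t}"
    proof
      fix v assume "v \<in> {v. z \<le> \<bar>v\<bar> powr \<alpha>}"
      then have "z powr (1 / \<alpha>) \<le> (\<bar>v\<bar> powr \<alpha>) powr (1 / \<alpha>)" using z \<alpha> by (intro powr_mono2) auto
      then have "t \<le> \<bar>v\<bar>" using \<alpha> by (simp add: t_def powr_powr)
      then show "v \<in> {t..} \<union> {..-t}" by auto
    qed
    have "measure \<mu> {v. z \<le> \<bar>v\<bar> powr \<alpha>} \<le> measure \<mu> ({t..} \<union> {..-t})"
      by (rule finite_measure_mono[OF sub]) (simp add: \<mu>(2))
    also have "\<dots> \<le> measure \<mu> {t..} + measure \<mu> {..-t}"
      by (rule measure_Un_le) (simp_all add: \<mu>(2))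
    also have "\<dots> \<le> C2 * exp (- z)" using up(1)[OF t1] up(2)[OF t1] unfolding tz by linarith
    also have "\<dots> \<le> max C2 (exp 1) * exp (- z)" by (intro mult_right_mono) auto
    finally show ?thesis .
  qed
qed

context weighted_random_regular_graph
begin

lemma fixed_graph:
  assumes a: "a \<in> regular_adjacency d n" and d: "0 < d" and \<alpha>: "0 < \<alpha>"
    and \<mu>: "prob_space \<mu>" "sets \<mu> = sets borel" and C1: "0 < C1"
    and b: "\<And>t. 1 \<le> t \<Longrightarrow> C1 / 2 * exp (- (t powr \<alpha>)) \<le> measure \<mu> {t..}"
      "\<And>t. 1 \<le> t \<Longrightarrow> measure \<mu> {t..} \<le> C2 / 2 * exp (- (t powr \<alpha>))"
      "\<And>t. 1 \<le> t \<Longrightarrow> measure \<mu> {..-t} \<le> C2 / 2 * exp (- (t powr \<alpha>))"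
  shows "weighted_graph M n d (adj_of a) (\<lambda>p \<omega>. W \<omega> $$ p) \<alpha> (max C2 (exp 1)) (min (C1 / 2) 1)"
proof
  note R = adj_of_regular[OF a]
  have rv: "(\<lambda>\<omega>. W \<omega> $$ p) \<in> borel_measurable M" if "p \<in> {(i, j). i < j \<and> j < n}" for p
    using weights_indep that unfolding indep_vars_def by auto
  have law: "prob {\<omega> \<in> space M. W \<omega> $$ p \<in> B} = measure \<mu> B"
    if "p \<in> {(i, j). i < j \<and> j < n}" "B \<in> sets borel" for p B
  proof -
    obtain i j where p: "p = (i, j)" "i < j" "j < n" using \<open>p \<in> _\<close> by auto
    have "measure \<mu> B = measure (distr M borel (\<lambda>\<omega>. W \<omega> $$ p)) B"
      using weights_law[OF p(2,3)] by (simp add: p(1))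
    also have "\<dots> = prob ((\<lambda>\<omega>. W \<omega> $$ p) -` B \<inter> space M)"
      by (rule measure_distr[OF rv that(2)]) (rule that(1))
    also have "(\<lambda>\<omega>. W \<omega> $$ p) -` B \<inter> space M = {\<omega> \<in> space M. W \<omega> $$ p \<in> B}" by auto
    finally show ?thesis by simp
  qed
  show "adj_of a i j \<Longrightarrow> adj_of a j i" for i j by (rule R(1))
  show "\<not> adj_of a i i" for i by (rule R(2))
  show "adj_of a i j \<Longrightarrow> i < n" for i j by (rule R(3))
  show "i < n \<Longrightarrow> card {j. adj_of a i j} = d" for i by (rule R(4))
  show "d > 0" by (rule d)
  show "indep_vars (\<lambda>_. borel) (\<lambda>p \<omega>. W \<omega> $$ p) {(i, j). i < j \<and> j < n}" by (rule weights_indep)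
  show "prob {\<omega> \<in> space M. z \<le> \<bar>W \<omega> $$ p\<bar> powr \<alpha>} \<le> max C2 (exp 1) * exp (- z)"
    if "p \<in> {(i, j). i < j \<and> j < n}" "0 \<le> z" for p z
  proof -
    have "{v :: real. z \<le> \<bar>v\<bar> powr \<alpha>} \<in> sets borel" by measurable
    from law[OF that(1) this] weibull_two_sided_upper[OF \<mu> \<alpha> b(2,3) that(2)] show ?thesis by simp
  qed
  show "min (C1 / 2) 1 * exp (- (t powr \<alpha>)) \<le> prob {\<omega> \<in> space M. t \<le> W \<omega> $$ p}"
    if "p \<in> {(i, j). i < j \<and> j < n}" "1 \<le> t" for p t
  proof -
    have "min (C1 / 2) 1 * exp (- (t powr \<alpha>)) \<le> C1 / 2 * exp (- (t powr \<alpha>))"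
      by (intro mult_right_mono) auto
    also have "\<dots> \<le> measure \<mu> {t..}" by (rule b(1)[OF that(2)])
    also have "\<dots> = prob {\<omega> \<in> space M. t \<le> W \<omega> $$ p}" using law[OF that(1), of "{t..}"] by simp
    finally show ?thesis .
  qed
  show "\<alpha> > 0" by (rule \<alpha>)
  have "exp 0 \<le> exp (1 :: real)" by (subst exp_le_cancel_iff) simp
  then show "max C2 (exp 1) \<ge> 1" by (simp add: le_max_iff_disj)
  show "min (C1 / 2) 1 > 0" using C1 by simp
  show "min (C1 / 2) 1 \<le> 1" by simp
qed

section \<open>Conditioning on the graph\<close>

text \<open>The graph takes finitely many equally likely values, and independence turns the
  probability into an average over them. The error p may depend on the graph, which admits
  quantities bounded only on average.\<close>

lemma prob_good_mixture:
  assumes G: "\<And>a. a \<in> regular_adjacency d n \<Longrightarrow> G a \<in> sets (mat_borel n)"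
    and p: "\<And>a. a \<in> regular_adjacency d n \<Longrightarrow> 1 - p a \<le> prob {\<omega> \<in> space M. W \<omega> \<in> G a}"
  shows "1 - (\<Sum>a\<in>regular_adjacency d n. p a) / card (regular_adjacency d n) \<le>
    prob {\<omega> \<in> space M. W \<omega> \<in> G (A \<omega>)}"
    and "regular_adjacency d n \<noteq> {}"
proof -
  let ?R = "regular_adjacency d n"
  have AR: "A \<omega> \<in> ?R" if "\<omega> \<in> space M" for \<omega> using measurable_space[OF adjacency that] by simp
  show ne: "?R \<noteq> {}" using AR not_empty by blast
  have fin: "finite ?R" by (rule finite_regular_adjacency)
  have PA: "prob (A -` {a} \<inter> space M) = 1 / card ?R" if "a \<in> ?R" for a
  proof -
    have "prob (A -` {a} \<inter> space M) = measure (distr M (count_space ?R) A) {a}"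
      using that by (intro measure_distr[symmetric] adjacency) simp
    also have "\<dots> = 1 / card ?R" unfolding uniform using fin that by (simp add: measure_uniform_count_measure)
    finally show ?thesis .
  qed
  define E where "E a = (A -` {a} \<inter> space M) \<inter> (W -` G a \<inter> space M)" for a
  have PE: "prob (E a) = 1 / card ?R * prob {\<omega> \<in> space M. W \<omega> \<in> G a}" if a: "a \<in> ?R" for a
  proof -
    have "{a} \<in> sets (mat_borel n)" using singleton_mat_borel regular_adjacencyD(1)[OF a] by blast
    from indep_varD[OF indep this G[OF a]]
    have "prob ((\<lambda>x. (A x, W x)) -` ({a} \<times> G a) \<inter> space M) =
      prob (A -` {a} \<inter> space M) * prob (W -` G a \<inter> space M)" .
    moreover have "(\<lambda>x. (A x, W x)) -` ({a} \<times> G a) \<inter> space M = E a" by (auto simp: E_def)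
    moreover have "W -` G a \<inter> space M = {\<omega> \<in> space M. W \<omega> \<in> G a}" by auto
    ultimately show ?thesis using PA[OF a] by simp
  qed
  have Eev: "E a \<in> events" if a: "a \<in> ?R" for a
  proof -
    have "A -` {a} \<inter> space M \<in> events" using a by (intro measurable_sets[OF adjacency]) simp
    moreover have "W -` G a \<inter> space M \<in> events" by (rule measurable_sets[OF weights G[OF a]])
    ultimately show ?thesis unfolding E_def by (rule sets.Int)
  qed
  have "{\<omega> \<in> space M. W \<omega> \<in> G (A \<omega>)} = (\<Union>a\<in>?R. E a)" using AR by (auto simp: E_def)
  also have "prob \<dots> = (\<Sum>a\<in>?R. prob (E a))"
    using fin Eev by (intro finite_measure_finite_Union) (auto simp: disjoint_family_on_def E_def)
  also have "\<dots> \<ge> (\<Sum>a\<in>?R. 1 / card ?R * (1 - p a))"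
    using PE p by (intro sum_mono) (auto intro!: divide_right_mono)
  also have "(\<Sum>a\<in>?R. 1 / card ?R * (1 - p a)) = 1 - (\<Sum>a\<in>?R. p a) / card ?R"
  proof -
    have "card ?R > 0" using ne fin by (simp add: card_gt_0_iff)
    then show ?thesis by (simp add: sum_subtractf sum_divide_distrib[symmetric] diff_divide_distrib)
  qed
  finally show "1 - (\<Sum>a\<in>?R. p a) / card ?R \<le> prob {\<omega> \<in> space M. W \<omega> \<in> G (A \<omega>)}" .
qed

text \<open>The primed data allow the fixed-graph estimate to be run with a smaller \<epsilon>' and
  a smaller family, since localization is monotone in both.\<close>

lemma prob_top_localized_mixture:
  assumes n: "0 < n"
    and graph: "\<And>a. a \<in> regular_adjacency d n \<Longrightarrow> weighted_graph M n d (adj_of a) (\<lambda>p \<omega>. W \<omega> $$ p) \<alpha> C c"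
    and \<epsilon>: "\<epsilon>' \<le> \<epsilon>"
    and \<I>: "\<And>a I. a \<in> regular_adjacency d n \<Longrightarrow> I \<in> \<I> a \<Longrightarrow> I \<subseteq> {..<n}"
    and \<I>': "\<And>a. a \<in> regular_adjacency d n \<Longrightarrow> \<I>' a \<subseteq> \<I> a"
    and p: "\<And>a. a \<in> regular_adjacency d n \<Longrightarrow>
      1 - p a \<le> prob (weighted_graph.localized_event M n (adj_of a) (\<lambda>p \<omega>. W \<omega> $$ p) (\<I>' a) \<epsilon>')"
  shows "1 - (\<Sum>a\<in>regular_adjacency d n. p a) / card (regular_adjacency d n) \<le>
    \<P>(\<omega> in M. \<forall>f. top_eigenvector (hadamard_mat (A \<omega>) (W \<omega>)) f \<longrightarrow> (\<exists>I\<in>\<I> (A \<omega>). localized_on \<epsilon> f I))"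
proof -
  let ?G = "\<lambda>a. good_weights n (\<I> a) \<epsilon> a"
  have Wc: "W \<omega> \<in> carrier_mat n n" if "\<omega> \<in> space M" for \<omega>
    using measurable_space[OF weights that] by (simp add: space_mat_borel)
  have AR: "A \<omega> \<in> regular_adjacency d n" if "\<omega> \<in> space M" for \<omega>
    using measurable_space[OF adjacency that] by simp
  have Gs: "?G a \<in> sets (mat_borel n)" if "a \<in> regular_adjacency d n" for a
    using that \<I> by (intro good_weights_sets)
  have Gp: "1 - p a \<le> prob {\<omega> \<in> space M. W \<omega> \<in> ?G a}" if a: "a \<in> regular_adjacency d n" for a
  proof -
    interpret G: weighted_graph M n d "adj_of a" "\<lambda>p \<omega>. W \<omega> $$ p" \<alpha> C c by (rule graph[OF a])
    have "1 - p a \<le> prob (G.localized_event (\<I>' a) \<epsilon>')" by (rule p[OF a])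
    also have "\<dots> \<le> prob {\<omega> \<in> space M. W \<omega> \<in> ?G a}"
    proof (rule finite_measure_mono)
      have "W -` ?G a \<inter> space M \<in> events" by (rule measurable_sets[OF weights Gs[OF a]])
      moreover have "W -` ?G a \<inter> space M = {\<omega> \<in> space M. W \<omega> \<in> ?G a}" by auto
      ultimately show "{\<omega> \<in> space M. W \<omega> \<in> ?G a} \<in> events" by simp
      show "G.localized_event (\<I>' a) \<epsilon>' \<subseteq> {\<omega> \<in> space M. W \<omega> \<in> ?G a}"
      proof
        fix \<omega> assume w: "\<omega> \<in> G.localized_event (\<I>' a) \<epsilon>'"
        have ws: "\<omega> \<in> space M" using w by (simp add: G.localized_event_def)
        have "\<exists>I\<in>\<I> a. (1 - \<epsilon>) * sqrt (sqn {..<n} f) \<le> sqrt (sqn I f)"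
          if f: "rayleigh_max n (wmat (adj_of a) (\<lambda>p. W \<omega> $$ p)) f" "sqn {..<n} f > 0" for f
        proof -
          obtain I where I: "I \<in> \<I>' a" "(1 - \<epsilon>') * sqrt (sqn {..<n} f) \<le> sqrt (sqn I f)"
            using w f unfolding G.localized_event_def by blast
          have "(1 - \<epsilon>) * sqrt (sqn {..<n} f) \<le> (1 - \<epsilon>') * sqrt (sqn {..<n} f)"
            using \<epsilon> f(2) by (intro mult_right_mono) auto
          then show ?thesis using I \<I>'[OF a] by (meson order.trans subsetD)
        qed
        then show "\<omega> \<in> {\<omega> \<in> space M. W \<omega> \<in> ?G a}"
          using ws Wc[OF ws] unfolding good_weights_def by blast
      qed
    qed
    finally show ?thesis .
  qed
  have "{\<omega> \<in> space M. W \<omega> \<in> ?G (A \<omega>)} =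
    {\<omega> \<in> space M. \<forall>f. top_eigenvector (hadamard_mat (A \<omega>) (W \<omega>)) f \<longrightarrow> (\<exists>I\<in>\<I> (A \<omega>). localized_on \<epsilon> f I)}"
  proof (rule Collect_cong, rule conj_cong[OF refl])
    fix \<omega> assume "\<omega> \<in> space M"
    then show "W \<omega> \<in> ?G (A \<omega>) \<longleftrightarrow>
      (\<forall>f. top_eigenvector (hadamard_mat (A \<omega>) (W \<omega>)) f \<longrightarrow> (\<exists>I\<in>\<I> (A \<omega>). localized_on \<epsilon> f I))"
      using \<I>[OF AR] by (intro good_weights_iff[OF n AR Wc weights_symmetric])
  qed
  then show ?thesis using prob_good_mixture(1)[of ?G p, OF Gs Gp] by simp
qed

end

text \<open>The constants are obtained before n, the probability space and the graph, so that the
  threshold N can be uniform in all of them.\<close>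

lemma weibull_fixed_graph:
  assumes \<mu>: "weibull_law \<alpha> \<mu>" and \<alpha>: "0 < \<alpha>" and d: "0 < d"
  obtains C c where "1 \<le> C" "0 < c" "c \<le> 1"
    and "\<And>(M :: 'a measure) n A W a. weighted_random_regular_graph M d n \<mu> A W \<Longrightarrow> a \<in> regular_adjacency d n \<Longrightarrow>
      weighted_graph M n d (adj_of a) (\<lambda>p \<omega>. W \<omega> $$ p) \<alpha> C c"
proof -
  obtain C1 C2 where \<mu>p: "prob_space \<mu>" "sets \<mu> = sets borel" and C1: "0 < C1"
    and b: "\<And>t. 1 \<le> t \<Longrightarrow> C1 / 2 * exp (- (t powr \<alpha>)) \<le> measure \<mu> {t..}"
      "\<And>t. 1 \<le> t \<Longrightarrow> measure \<mu> {t..} \<le> C2 / 2 * exp (- (t powr \<alpha>))"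
      "\<And>t. 1 \<le> t \<Longrightarrow> measure \<mu> {..-t} \<le> C2 / 2 * exp (- (t powr \<alpha>))"
    using \<mu> unfolding weibull_law_def by blast
  show thesis
  proof (rule that[of "max C2 (exp 1)" "min (C1 / 2) 1"])
    have "exp 0 \<le> exp (1 :: real)" by (subst exp_le_cancel_iff) simp
    then show "1 \<le> max C2 (exp 1)" by (simp add: le_max_iff_disj)
    show "0 < min (C1 / 2) 1" "min (C1 / 2) 1 \<le> 1" using C1 by auto
    fix M :: "'a measure" and n A W a
    assume "weighted_random_regular_graph M d n \<mu> A W" "a \<in> regular_adjacency d n"
    then show "weighted_graph M n d (adj_of a) (\<lambda>p \<omega>. W \<omega> $$ p) \<alpha> (max C2 (exp 1)) (min (C1 / 2) 1)"
      by (rule weighted_random_regular_graph.fixed_graph[OF _ _ d \<alpha> \<mu>p C1 b])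
  qed
qed

lemma top_eigenvector_few_vertices:
  fixes \<alpha> \<epsilon> :: real
  assumes \<alpha>: "\<alpha> > 0" and d: "d \<ge> 3" and \<mu>: "weibull_law \<alpha> \<mu>" and \<epsilon>: "\<epsilon> > 0"
  shows "\<exists>N. \<forall>n\<ge>N. \<forall>(M :: 'a measure) A W. weighted_random_regular_graph M d n \<mu> A W \<longrightarrow>
    \<P>(\<omega> in M. \<forall>f. top_eigenvector (hadamard_mat (A \<omega>) (W \<omega>)) f \<longrightarrow>
      (\<exists>I\<subseteq>{..<n}. real (card I) \<le> real n powr \<epsilon> \<and> localized_on \<epsilon> f I))
    \<ge> 1 - exp (- (ln (real n) powr (1/2)))"
proof -
  \<comment> \<open>The fixed-graph estimates require \<epsilon> < 1, whereas the claim is for all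
    \<epsilon> > 0.\<close>
  define \<epsilon>' where "\<epsilon>' = min \<epsilon> (1/2)"
  have \<epsilon>': "0 < \<epsilon>'" "\<epsilon>' < 1" "\<epsilon>' \<le> \<epsilon>" using \<epsilon> by (auto simp: \<epsilon>'_def)
  have d0: "0 < d" using d by simp
  obtain C c where C: "1 \<le> C" and c: "0 < c" "c \<le> 1"
    and fixed: "\<And>(M :: 'a measure) n A W a. weighted_random_regular_graph M d n \<mu> A W \<Longrightarrow> a \<in> regular_adjacency d n \<Longrightarrow>
      weighted_graph M n d (adj_of a) (\<lambda>p \<omega>. W \<omega> $$ p) \<alpha> C c"
    using weibull_fixed_graph[OF \<mu> \<alpha> d0, where 'a = 'a] by blast
  from ex_few_vertices_params[OF \<alpha> d0 C c \<epsilon>'(1,2)] obtain N where N: "\<forall>n\<ge>N. \<exists>K T s y0 h \<delta> q R. few_vertices_params \<alpha> d C c \<epsilon>' n K T s y0 h \<delta> q R \<and>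
      q + real (K * (K * (K * d) ^ K)) / \<delta> + (1 + R * (1 + R * \<delta>)) * real K / real n powr \<epsilon>' \<le> exp (- (ln (real n) powr (1/2)))" by (rule exE)
  show ?thesis
  proof (intro exI[of _ "max N 1"] allI impI)
    fix n and M :: "'a measure" and A W
    assume n: "max N 1 \<le> n" and WR: "weighted_random_regular_graph M d n \<mu> A W"
    interpret weighted_random_regular_graph M d n \<mu> A W by (rule WR)
    let ?e = "exp (- (ln (real n) powr (1/2)))"
    let ?\<I> = "\<lambda>\<epsilon>. {I. I \<subseteq> {..<n} \<and> real (card I) \<le> n powr \<epsilon>}"
    have "N \<le> n" using n by simp
    from N[rule_format, OF this] obtain K T s y0 h \<delta> q R where par: "few_vertices_params \<alpha> d C c \<epsilon>' n K T s y0 h \<delta> q R"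
      and total: "q + real (K * (K * (K * d) ^ K)) / \<delta> + (1 + R * (1 + R * \<delta>)) * real K / real n powr \<epsilon>' \<le> ?e"
      by (elim exE conjE) (rule that)
    have graph: "weighted_graph M n d (adj_of a) (\<lambda>p \<omega>. W \<omega> $$ p) \<alpha> C c" if "a \<in> regular_adjacency d n" for a
      by (rule fixed[OF WR that])
    have "1 - (\<Sum>a\<in>regular_adjacency d n. ?e) / card (regular_adjacency d n) \<le>
      \<P>(\<omega> in M. \<forall>f. top_eigenvector (hadamard_mat (A \<omega>) (W \<omega>)) f \<longrightarrow> (\<exists>I\<in>?\<I> \<epsilon>. localized_on \<epsilon> f I))"
    proof (rule prob_top_localized_mixture[where \<I> = "\<lambda>_. ?\<I> \<epsilon>" and \<I>' = "\<lambda>_. ?\<I> \<epsilon>'", OF _ graph \<epsilon>'(3)])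
      show "0 < n" using n by simp
      show "?\<I> \<epsilon>' \<subseteq> ?\<I> \<epsilon>"
        using powr_mono[OF \<epsilon>'(3), of "real n"] n by auto
      fix a assume a: "a \<in> regular_adjacency d n"
      interpret G: weighted_graph M n d "adj_of a" "\<lambda>p \<omega>. W \<omega> $$ p" \<alpha> C c by (rule graph[OF a])
      have "1 - (q + real (K * (K * (K * d) ^ K)) / \<delta> + (1 + R * (1 + R * \<delta>)) * real K / real n powr \<epsilon>') \<le>
          prob (G.localized_event (?\<I> \<epsilon>') \<epsilon>')"
        by (rule G.prob_localized_few_vertices[OF \<epsilon>'(1,2) par])
      then show "1 - ?e \<le> prob (G.localized_event (?\<I> \<epsilon>') \<epsilon>')" using total by linarith
    qed auto
    moreover have "(\<Sum>a\<in>regular_adjacency d n. ?e) / card (regular_adjacency d n) \<le> ?e" by simp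
    moreover have "(\<exists>I\<in>?\<I> \<epsilon>. localized_on \<epsilon> f I) \<longleftrightarrow>
      (\<exists>I\<subseteq>{..<n}. real (card I) \<le> real n powr \<epsilon> \<and> localized_on \<epsilon> f I)" for f by blast
    ultimately show "1 - ?e \<le> \<P>(\<omega> in M. \<forall>f. top_eigenvector (hadamard_mat (A \<omega>) (W \<omega>)) f \<longrightarrow>
      (\<exists>I\<subseteq>{..<n}. real (card I) \<le> real n powr \<epsilon> \<and> localized_on \<epsilon> f I))" by simp
  qed
qed

lemma top_eigenvector_disjoint_edges:
  fixes \<alpha> \<epsilon> :: real
  assumes \<alpha>: "\<alpha> > 0" "\<alpha> < 2" and d: "d \<ge> 3" and \<mu>: "weibull_law \<alpha> \<mu>" and \<epsilon>: "\<epsilon> > 0"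
  shows "\<exists>N. \<forall>n\<ge>N. \<forall>(M :: 'a measure) A W. weighted_random_regular_graph M d n \<mu> A W \<longrightarrow>
    \<P>(\<omega> in M. \<forall>f. top_eigenvector (hadamard_mat (A \<omega>) (W \<omega>)) f \<longrightarrow>
      (\<exists>J\<subseteq>edges (A \<omega>). disjoint J \<and> real (card J) \<le> exp (\<epsilon> * ln (real n) powr (31/32)) \<and> localized_on \<epsilon> f (\<Union>J)))
    \<ge> 1 - exp (- (ln (real n) powr (1/2)))"
proof -
  define \<epsilon>' where "\<epsilon>' = min \<epsilon> (1/2)"
  have \<epsilon>': "0 < \<epsilon>'" "\<epsilon>' < 1" "\<epsilon>' \<le> \<epsilon>" using \<epsilon> by (auto simp: \<epsilon>'_def)
  have d0: "0 < d" using d by simp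
  obtain C c where C: "1 \<le> C" and c: "0 < c" "c \<le> 1"
    and fixed: "\<And>(M :: 'a measure) n A W a. weighted_random_regular_graph M d n \<mu> A W \<Longrightarrow> a \<in> regular_adjacency d n \<Longrightarrow>
      weighted_graph M n d (adj_of a) (\<lambda>p \<omega>. W \<omega> $$ p) \<alpha> C c"
    using weibull_fixed_graph[OF \<mu> \<alpha>(1) d0, where 'a = 'a] by blast
  from ex_disjoint_edges_params[OF \<alpha> d0 C c \<epsilon>'(1,2)] obtain N where N: "\<forall>n\<ge>N. \<exists>K T h \<theta> y x \<rho>. disjoint_edges_params \<alpha> d \<epsilon>' K T h \<theta> y x \<rho> \<and>
      real (n * (Suc K * (Suc K * d) ^ Suc K)) *
        ((real T + 1) ^ (Suc K * Suc K) * C ^ (Suc K * Suc K) * exp (- real T)) +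
      real (2 * (2 * (2 * d) ^ 2)) / (real n * (c * exp (- (y powr \<alpha> + 1)))) +
      real (2 * d ^ 3) * (C * exp (- h)) +
      real (n * d) * (C * exp (- \<theta>)) / exp (\<epsilon>' * ln (real n) powr (31/32)) \<le> exp (- (ln (real n) powr (1/2)))"
    by (rule exE)
  \<comment> \<open>The maximum with 4 * (d + 2) makes the triangle bound of
    \<open>sum_card_triangles_le\<close> available.\<close>
  show ?thesis
  proof (intro exI[of _ "max N (4 * (d + 2))"] allI impI)
    fix n and M :: "'a measure" and A W
    assume n: "max N (4 * (d + 2)) \<le> n" and WR: "weighted_random_regular_graph M d n \<mu> A W"
    interpret weighted_random_regular_graph M d n \<mu> A W by (rule WR)
    let ?R = "regular_adjacency d n"
    let ?e = "exp (- (ln (real n) powr (1/2)))"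
    let ?B = "\<lambda>\<epsilon>. exp (\<epsilon> * ln (real n) powr (31/32))"
    let ?\<I> = "\<lambda>\<epsilon> a. matching_covers (adj_of a) (?B \<epsilon>)"
    have n0: "0 < n" and n4: "4 * (d + 2) \<le> n" and "N \<le> n" using n by auto
    from N[rule_format, OF \<open>N \<le> n\<close>] obtain K T h \<theta> y x \<rho> where par: "disjoint_edges_params \<alpha> d \<epsilon>' K T h \<theta> y x \<rho>"
      and total: "real (n * (Suc K * (Suc K * d) ^ Suc K)) *
        ((real T + 1) ^ (Suc K * Suc K) * C ^ (Suc K * Suc K) * exp (- real T)) +
      real (2 * (2 * (2 * d) ^ 2)) / (real n * (c * exp (- (y powr \<alpha> + 1)))) +
      real (2 * d ^ 3) * (C * exp (- h)) +
      real (n * d) * (C * exp (- \<theta>)) / ?B \<epsilon>' \<le> ?e"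
      by (elim exE conjE) (rule that)
    have graph: "weighted_graph M n d (adj_of a) (\<lambda>p \<omega>. W \<omega> $$ p) \<alpha> C c" if "a \<in> ?R" for a
      by (rule fixed[OF WR that])
    define p1 where "p1 = real (n * (Suc K * (Suc K * d) ^ Suc K)) *
        ((real T + 1) ^ (Suc K * Suc K) * C ^ (Suc K * Suc K) * exp (- real T)) +
      real (2 * (2 * (2 * d) ^ 2)) / (real n * (c * exp (- (y powr \<alpha> + 1))))"
    define p2 where "p2 = C * exp (- h)"
    define p3 where "p3 = real (n * d) * (C * exp (- \<theta>)) / ?B \<epsilon>'"
    \<comment> \<open>The failure bound depends on the graph only through its number of triangles,
      whose average is at most 2 * d^3.\<close>
    define p where "p a = p1 + card (triangles a) * p2 + p3" for a
    have adj_less: "adj_of a i j \<Longrightarrow> i < n \<and> j < n" if "a \<in> ?R" for a i j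
      using adj_of_regular(3)[OF that] adj_of_regular(1)[OF that] by blast
    have main: "1 - (\<Sum>a\<in>?R. p a) / card ?R \<le>
      \<P>(\<omega> in M. \<forall>f. top_eigenvector (hadamard_mat (A \<omega>) (W \<omega>)) f \<longrightarrow> (\<exists>I\<in>?\<I> \<epsilon> (A \<omega>). localized_on \<epsilon> f I))"
    proof (rule prob_top_localized_mixture[where \<I> = "?\<I> \<epsilon>" and \<I>' = "?\<I> \<epsilon>'", OF n0 graph \<epsilon>'(3)])
      fix a assume a: "a \<in> ?R"
      show "I \<subseteq> {..<n}" if "I \<in> ?\<I> \<epsilon> a" for I
        using that adj_less[OF a] by (rule matching_covers_subset)
      have "\<epsilon>' * ln (real n) powr (31/32) \<le> \<epsilon> * ln (real n) powr (31/32)"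
        using \<epsilon>'(3) by (intro mult_right_mono) auto
      then have "?B \<epsilon>' \<le> ?B \<epsilon>" by simp
      then show "?\<I> \<epsilon>' a \<subseteq> ?\<I> \<epsilon> a" by (rule matching_covers_mono)
      interpret G: weighted_graph M n d "adj_of a" "\<lambda>p \<omega>. W \<omega> $$ p" \<alpha> C c by (rule graph[OF a])
      have "{(i, j, k). adj_of a i j \<and> adj_of a j k \<and> adj_of a i k} = triangles a"
        by (auto simp: adj_of_def triangles_def)
      then show "1 - p a \<le> prob (G.localized_event (?\<I> \<epsilon>' a) \<epsilon>')"
        using G.prob_localized_disjoint_edges[OF \<alpha>(2) \<epsilon>'(1,2) n0 par, of "?B \<epsilon>'"]
        by (simp only: p_def p1_def p2_def p3_def exp_gt_zero simp_thms)
    qed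
    have fin: "finite ?R" by (rule finite_regular_adjacency)
    have "?R \<noteq> {}" by (rule prob_good_mixture(2)[of "\<lambda>_. {}" "\<lambda>_. 1"]) auto
    then have cR: "0 < card ?R" using fin by (simp add: card_gt_0_iff)
    have p20: "0 \<le> p2" using C by (simp add: p2_def)
    have tri: "(\<Sum>a\<in>?R. real (card (triangles a))) \<le> real (2 * d ^ 3 * card ?R)"
      using sum_card_triangles_le[OF n4 d0] by (simp only: of_nat_sum[symmetric] of_nat_le_iff)
    have "(\<Sum>a\<in>?R. p a) = (\<Sum>a\<in>?R. (p1 + p3) + real (card (triangles a)) * p2)"
      unfolding p_def by (intro sum.cong refl) simp
    also have "\<dots> = card ?R * (p1 + p3) + (\<Sum>a\<in>?R. real (card (triangles a))) * p2"
      by (simp add: sum.distrib sum_distrib_right)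
    also have "\<dots> \<le> card ?R * (p1 + p3) + real (2 * d ^ 3 * card ?R) * p2"
      using tri p20 by (intro add_left_mono mult_right_mono)
    also have "\<dots> = card ?R * (p1 + real (2 * d ^ 3) * p2 + p3)" by (simp add: algebra_simps)
    also have "\<dots> \<le> card ?R * ?e"
      using total unfolding p1_def p2_def p3_def by (intro mult_left_mono) auto
    finally have "(\<Sum>a\<in>?R. p a) / card ?R \<le> ?e" using cR by (simp add: field_simps)
    moreover have "(\<exists>I\<in>?\<I> \<epsilon> (A \<omega>). localized_on \<epsilon> f I) \<longleftrightarrow>
      (\<exists>J\<subseteq>edges (A \<omega>). disjoint J \<and> real (card J) \<le> ?B \<epsilon> \<and> localized_on \<epsilon> f (\<Union>J))" for \<omega> f
    proof -
      have "edges (A \<omega>) = {{i, j} | i j. adj_of (A \<omega>) i j}" by (simp add: edges_def adj_of_def conj_assoc)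
      then show ?thesis by (simp only: bex_matching_covers)
    qed
    ultimately show "1 - ?e \<le> \<P>(\<omega> in M. \<forall>f. top_eigenvector (hadamard_mat (A \<omega>) (W \<omega>)) f \<longrightarrow>
      (\<exists>J\<subseteq>edges (A \<omega>). disjoint J \<and> real (card J) \<le> ?B \<epsilon> \<and> localized_on \<epsilon> f (\<Union>J)))"
      using main by simp
  qed
qed

theorem theorem2:
  fixes \<alpha> :: real
  assumes "\<alpha> > 0"
  shows
    "(\<forall>d\<ge>3. \<forall>\<mu>. weibull_law \<alpha> \<mu> \<longrightarrow> (\<forall>\<epsilon>>0. \<exists>N. \<forall>n\<ge>N.
        \<forall>(M :: 'a measure) A W. weighted_random_regular_graph M d n \<mu> A W \<longrightarrow>
          \<P>(\<omega> in M. \<forall>f. top_eigenvector (hadamard_mat (A \<omega>) (W \<omega>)) f \<longrightarrow>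
              (\<exists>I\<subseteq>{..<n}. real (card I) \<le> real n powr \<epsilon> \<and> localized_on \<epsilon> f I))
            \<ge> 1 - exp (- (ln (real n) powr (1/2))))) \<and>
     (\<alpha> < 2 \<longrightarrow> (\<exists>\<zeta>. 0 < \<zeta> \<and> \<zeta> < 1 \<and>
        (\<forall>d\<ge>3. \<forall>\<mu>. weibull_law \<alpha> \<mu> \<longrightarrow> (\<forall>\<epsilon>>0. \<exists>N. \<forall>n\<ge>N.
          \<forall>(M :: 'a measure) A W. weighted_random_regular_graph M d n \<mu> A W \<longrightarrow>
            \<P>(\<omega> in M. \<forall>f. top_eigenvector (hadamard_mat (A \<omega>) (W \<omega>)) f \<longrightarrow>
                (\<exists>J\<subseteq>edges (A \<omega>). disjoint J \<and>
                   real (card J) \<le> exp (\<epsilon> * ln (real n) powr \<zeta>) \<and> localized_on \<epsilon> f (\<Union>J)))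
              \<ge> 1 - exp (- (ln (real n) powr (1/2)))))))"
proof (intro conjI impI)
  show "\<forall>d\<ge>3. \<forall>\<mu>. weibull_law \<alpha> \<mu> \<longrightarrow> (\<forall>\<epsilon>>0. \<exists>N. \<forall>n\<ge>N.
        \<forall>(M :: 'a measure) A W. weighted_random_regular_graph M d n \<mu> A W \<longrightarrow>
          \<P>(\<omega> in M. \<forall>f. top_eigenvector (hadamard_mat (A \<omega>) (W \<omega>)) f \<longrightarrow>
              (\<exists>I\<subseteq>{..<n}. real (card I) \<le> real n powr \<epsilon> \<and> localized_on \<epsilon> f I))
            \<ge> 1 - exp (- (ln (real n) powr (1/2))))"
    using top_eigenvector_few_vertices[OF assms] by (intro allI impI)
  assume "\<alpha> < 2"
  \<comment> \<open>The same exponent serves all \<alpha> < 2, since its choice rests only on 1 /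
    \<alpha> > 1/2.\<close>
  show "\<exists>\<zeta>. 0 < \<zeta> \<and> \<zeta> < 1 \<and>
        (\<forall>d\<ge>3. \<forall>\<mu>. weibull_law \<alpha> \<mu> \<longrightarrow> (\<forall>\<epsilon>>0. \<exists>N. \<forall>n\<ge>N.
          \<forall>(M :: 'a measure) A W. weighted_random_regular_graph M d n \<mu> A W \<longrightarrow>
            \<P>(\<omega> in M. \<forall>f. top_eigenvector (hadamard_mat (A \<omega>) (W \<omega>)) f \<longrightarrow>
                (\<exists>J\<subseteq>edges (A \<omega>). disjoint J \<and>
                   real (card J) \<le> exp (\<epsilon> * ln (real n) powr \<zeta>) \<and> localized_on \<epsilon> f (\<Union>J)))
              \<ge> 1 - exp (- (ln (real n) powr (1/2)))))"
    using top_eigenvector_disjoint_edges[OF assms \<open>\<alpha> < 2\<close>]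
    by (intro exI[of _ "31/32"] conjI allI impI) simp_all
qed

end
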